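(* Let $m\ge 1$ and let $L(m,q)$ be a lens space with its metric of constant curvature $1$, where $L(1,0)=S^3$, $L(2,1)=\mathbb{RP}^3$, and for $m>2$ one takes $1\le q<m/2$ with $\gcd(m,q)=1$. Let $\mathrm{Isom}(L(m,q))$ be the full isometry group and $\mathcal I(L(m,q))=\pi_0(\mathrm{Isom}(L(m,q)))$ its group of path components. Then, up to isomorphism (of topological groups, respectively of groups): \begin{enumerate} \item If $m=1$: $\mathrm{Isom}(L(m,q))\cong \mathrm{O}(4)$ and $\mathcal I(L(m,q))\cong C_2$. \item If $m=2$: $\mathrm{Isom}(L(m,q))\cong(\mathrm{SO}(3)\times \mathrm{SO}(3))\rtimes C_2$, where $C_2$ acts by interchanging the two factors, and $\mathcal I(L(m,q))\cong C_2$. \item If $m>2$ is odd and $q=1$: $\mathrm{Isom}(L(m,q))\cong \mathrm{O}(2)^*\,\widetilde\times\, S^3$ and $\mathcal I(L(m,q))\cong C_2$. \item If $m>2$ is even and $q=1$: $\mathrm{Isom}(L(m,q))\cong \mathrm{O}(2)\times \mathrm{SO}(3)$ and $\mathcal I(L(m,q))\cong C_2$. \item If $m>2$, $1<q<m/2$ and $q^2\not\equiv\pm1 \pmod m$: $\mathrm{Isom}(L(m,q))\cong \mathrm{Dih}(S^1\times S^1)$ and $\mathcal I(L(m,q))\cong C_2$. \item If $m>2$, $1<q<m/2$ and $q^2\equiv-1\pmod m$: $\mathrm{Isom}(L(m,q))\cong (S^1\,\widetilde\times\, S^1)\rtimes C_4$, where a generator of $C_4$ acts by sending $(z_0,w_0)$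 to $(w_0,\overline{z_0})$, and $\mathcal I(L(m,q))\cong C_4$. \item If $m>2$, $1<q<m/2$, $q^2\equiv1\pmod m$ and $\gcd(m,q+1)\gcd(m,q-1)=m$: $\mathrm{Isom}(L(m,q))\cong \mathrm{O}(2)\,\widetilde\times\, \mathrm{O}(2)$ and $\mathcal I(L(m,q))\cong C_2\times C_2$. \item If $m>2$, $1<q<m/2$, $q^2\equiv1\pmod m$ and $\gcd(m,q+1)\gcd(m,q-1)=2m$: $\mathrm{Isom}(L(m,q))\cong \mathrm{O}(2)\times \mathrm{O}(2)$ and $\mathcal I(L(m,q))\cong C_2\times C_2$. \end{enumerate}
   Context: $S^3=\{(z_0,z_1)\in\mathbb C^2 : |z_0|^2+|z_1|^2=1\}$ is regarded as the group of unit quaternions $z=z_0+z_1j$, with $j^2=-1$ and $jz_i=\overline{z_i}j$. $L(m,q)$ is the quotient of $S^3$ by the cyclic group of order $m$ generated by $z_0+z_1j\mapsto \xi_m z_0+\xi_m^q z_1j$, $\xi_m=\exp(2\pi i/m)$, with the induced metric. $S^1\subset S^3$ is the subgroup of $z$ with $z_1=0$, and $\mathrm{O}(2)^*=S^1\cup S^1j\subset S^3$. $\mathrm{O}(2)$ is described as $S^1\cup S^1j_0$ with $j_0^2=1$, $j_0z_0=\overline{z_0}j_0$ for $z_0\in S^1$. If $H_1,H_2$ are groups each containing a central involution denoted $-1$, then $H_1\,\widetilde\times\, H_2=(H_1\times H_2)/\langle(-1,-1)\rangle$; in $S^1$, $\mathrm{O}(2)^*$, $S^3$ and $\mathrm{O}(2)$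 the involution is $-1$ (for $\mathrm{O}(2)$, it is $-1\in S^1$). $\mathrm{Dih}(S^1\times S^1)$ is the semidirect product $(S^1\times S^1)\rtimes C_2$ where $C_2$ acts by complex conjugation in both factors. $C_k$ denotes the cyclic group of order $k$. *)

theory Defs
  imports "HOL-Analysis.Analysis" "HOL-Algebra.Bij" "HOL-Algebra.Elementary_Groups"
    "HOL-Number_Theory.Cong"
begin

section \<open>Topological groups\<close>

record 'a topgroup = "'a monoid" +
  gtopology :: "'a topology"

definition with_topology :: "'a monoid \<Rightarrow> 'a topology \<Rightarrow> 'a topgroup" where
  "with_topology G X =
     \<lparr>carrier = carrier G, monoid.mult = monoid.mult G, one = one G, gtopology = X\<rparr>"

definition topgroup_iso :: "'a topgroup \<Rightarrow> 'b topgroup \<Rightarrow> bool" where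
  "topgroup_iso G H \<longleftrightarrow>
     (\<exists>h \<in> Group.iso G H. homeomorphic_map (gtopology G) (gtopology H) h)"

definition topgroup_prod :: "'a topgroup \<Rightarrow> 'b topgroup \<Rightarrow> ('a \<times> 'b) topgroup" where
  "topgroup_prod G H = with_topology (G \<times>\<times> H) (prod_topology (gtopology G) (gtopology H))"

definition quotient_topology :: "'a topology \<Rightarrow> ('a \<Rightarrow> 'b) \<Rightarrow> 'b topology" where
  "quotient_topology X p =
     topology (\<lambda>U. U \<subseteq> p ` topspace X \<and> openin X {x \<in> topspace X. p x \<in> U})"

lemma openin_quotient_topology:
  "openin (quotient_topology X p) U \<longleftrightarrow>
     U \<subseteq> p ` topspace X \<and> openin X {x \<in> topspace X. p x \<in> U}"
proof -
  have "istopology (\<lambda>U. U \<subseteq> p ` topspace X \<and> openin X {x \<in> topspace X. p x \<in> U})"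
    unfolding istopology_def
  proof (intro conjI allI impI)
    fix S T
    assume "S \<subseteq> p ` topspace X \<and> openin X {x \<in> topspace X. p x \<in> S}"
      and "T \<subseteq> p ` topspace X \<and> openin X {x \<in> topspace X. p x \<in> T}"
    then have "openin X ({x \<in> topspace X. p x \<in> S} \<inter> {x \<in> topspace X. p x \<in> T})"
      by blast
    moreover have "{x \<in> topspace X. p x \<in> S} \<inter> {x \<in> topspace X. p x \<in> T} =
        {x \<in> topspace X. p x \<in> S \<inter> T}" by blast
    ultimately show "openin X {x \<in> topspace X. p x \<in> S \<inter> T}" by simp
  next
    fix \<K>
    assume *: "\<forall>K\<in>\<K>. K \<subseteq> p ` topspace X \<and> openin X {x \<in> topspace X. p x \<in> K}"
    have "{x \<in> topspace X. p x \<in> \<Union>\<K>} = (\<Union>K\<in>\<K>. {x \<in> topspace X. p x \<in> K})"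
      by blast
    with * show "openin X {x \<in> topspace X. p x \<in> \<Union>\<K>}"
      by (metis (no_types, lifting) imageE openin_Union)
  qed blast+
  then show ?thesis
    by (simp add: quotient_topology_def)
qed

lemma quotient_map_quotient_topology: "quotient_map X (quotient_topology X p) p"
proof -
  have "{x \<in> topspace X. p x \<in> p ` topspace X} = topspace X" by blast
  then have "openin (quotient_topology X p) (p ` topspace X)"
    by (simp add: openin_quotient_topology)
  then have "topspace (quotient_topology X p) = p ` topspace X"
    by (meson openin_quotient_topology openin_subset openin_topspace subset_antisym)
  then show ?thesis
    by (auto simp: quotient_map_def openin_quotient_topology)
qed

definition topgroup_quotient :: "'a topgroup \<Rightarrow> 'a set \<Rightarrow> 'a set topgroup" where
  "topgroup_quotient G N =
     with_topology (G Mod N) (quotient_topology (gtopology G) (r_coset G N))"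

text \<open>The product of \<open>G\<close> and \<open>H\<close> with the central involutions \<open>-1\<close> amalgamated;
  in all uses, \<open>-1\<close> is the additive inverse of the identity element.\<close>

definition twisted_prod ::
  "'a::uminus topgroup \<Rightarrow> 'b::uminus topgroup \<Rightarrow> ('a \<times> 'b) set topgroup"  (infixr \<open>\<times>\<^sub>~\<close> 80) where
  "G \<times>\<^sub>~ H = topgroup_quotient (topgroup_prod G H)
     {(\<one>\<^bsub>G\<^esub>, \<one>\<^bsub>H\<^esub>), (- \<one>\<^bsub>G\<^esub>, - \<one>\<^bsub>H\<^esub>)}"

text \<open>The semidirect product \<open>N \<rtimes> C\<^sub>k\<close> in which the generator \<open>1\<close> of \<open>C\<^sub>k\<close>, the integers
  modulo \<open>k\<close>, acts on \<open>N\<close> by the automorphism \<open>\<phi>\<close>, where \<open>\<phi>\<^sup>k\<close> is the identity on \<open>N\<close>.\<close>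

definition semidirect_cyclic :: "'a topgroup \<Rightarrow> nat \<Rightarrow> ('a \<Rightarrow> 'a) \<Rightarrow> ('a \<times> int) topgroup" where
  "semidirect_cyclic N k \<phi> = with_topology
     \<lparr>carrier = carrier N \<times> carrier (integer_mod_group k),
      monoid.mult = (\<lambda>(x, a) (y, b). (x \<otimes>\<^bsub>N\<^esub> (\<phi> ^^ nat a) y, a \<otimes>\<^bsub>integer_mod_group k\<^esub> b)),
      one = (\<one>\<^bsub>N\<^esub>, \<one>\<^bsub>integer_mod_group k\<^esub>)\<rparr>
     (prod_topology (gtopology N) (discrete_topology (carrier (integer_mod_group k))))"

definition pi0_group :: "'a topgroup \<Rightarrow> 'a set monoid" where
  "pi0_group G =
     \<lparr>carrier = path_components_of (gtopology G),
      monoid.mult = (\<lambda>A B. A <#>\<^bsub>G\<^esub> B),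
      one = path_component_of_set (gtopology G) \<one>\<^bsub>G\<^esub>\<rparr>"


section \<open>The model groups\<close>

definition orthogonal_group :: "(real^'n^'n) topgroup" where
  "orthogonal_group =
     \<lparr>carrier = {A. orthogonal_matrix A}, monoid.mult = (**), one = mat 1,
      gtopology = top_of_set {A. orthogonal_matrix A}\<rparr>"

definition special_orthogonal_group :: "(real^'n^'n) topgroup" where
  "special_orthogonal_group =
     \<lparr>carrier = {A. rotation_matrix A}, monoid.mult = (**), one = mat 1,
      gtopology = top_of_set {A. rotation_matrix A}\<rparr>"

definition circle_group :: "complex topgroup" where
  "circle_group =
     \<lparr>carrier = sphere 0 1, monoid.mult = (*), one = 1, gtopology = top_of_set (sphere 0 1)\<rparr>"

text \<open>The pair \<open>(z\<^sub>0, z\<^sub>1)\<close> stands for the quaternion \<open>z\<^sub>0 + z\<^sub>1 j\<close>.\<close>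

definition S3 :: "(complex \<times> complex) set" where
  "S3 = {(z0, z1). (cmod z0)\<^sup>2 + (cmod z1)\<^sup>2 = 1}"

fun quat_mult :: "complex \<times> complex \<Rightarrow> complex \<times> complex \<Rightarrow> complex \<times> complex" where
  "quat_mult (z0, z1) (w0, w1) = (z0 * w0 - z1 * cnj w1, z0 * w1 + z1 * cnj w0)"

definition S3_group :: "(complex \<times> complex) topgroup" where
  "S3_group =
     \<lparr>carrier = S3, monoid.mult = quat_mult, one = (1, 0), gtopology = top_of_set S3\<rparr>"

text \<open>The union of \<open>S\<^sup>1\<close> and \<open>S\<^sup>1 j\<close>; it carries both \<open>O(2)\<^sup>*\<close> (with \<open>j\<^sup>2 = -1\<close>) and \<open>O(2)\<close>
  (with \<open>j\<close> replaced by \<open>j\<^sub>0\<close>, where \<open>j\<^sub>0\<^sup>2 = 1\<close>).\<close>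

definition two_circles :: "(complex \<times> complex) set" where
  "two_circles = (\<lambda>z. (z, 0)) ` sphere 0 1 \<union> (\<lambda>z. (0, z)) ` sphere 0 1"

definition O2_star :: "(complex \<times> complex) topgroup" where
  "O2_star =
     \<lparr>carrier = two_circles, monoid.mult = quat_mult, one = (1, 0),
      gtopology = top_of_set two_circles\<rparr>"

fun O2_mult :: "complex \<times> complex \<Rightarrow> complex \<times> complex \<Rightarrow> complex \<times> complex" where
  "O2_mult (z0, z1) (w0, w1) = (z0 * w0 + z1 * cnj w1, z0 * w1 + z1 * cnj w0)"

definition O2 :: "(complex \<times> complex) topgroup" where
  "O2 =
     \<lparr>carrier = two_circles, monoid.mult = O2_mult, one = (1, 0),
      gtopology = top_of_set two_circles\<rparr>"

definition Dih_torus :: "((complex \<times> complex) \<times> int) topgroup" where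
  "Dih_torus =
     semidirect_cyclic (topgroup_prod circle_group circle_group) 2 (\<lambda>(z, w). (cnj z, cnj w))"


section \<open>Isometry groups\<close>

text \<open>For compact \<open>M\<close>, the topology of uniform convergence used here is the compact-open one.
  Elements are undefined outside \<open>mspace M\<close>.\<close>

definition isom_group :: "'a metric \<Rightarrow> ('a \<Rightarrow> 'a) topgroup" where
  "isom_group M =
     (let I = {f \<in> Bij (mspace M). \<forall>x \<in> mspace M. \<forall>y \<in> mspace M.
                 mdist M (f x) (f y) = mdist M x y}
      in \<lparr>carrier = I, monoid.mult = compose (mspace M), one = (\<lambda>x \<in> mspace M. x),
          gtopology = subtopology (mtopology_of (cfunspace (mtopology_of M) M)) I\<rparr>)"

definition isom_pi0 :: "'a metric \<Rightarrow> ('a \<Rightarrow> 'a) set monoid" where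
  "isom_pi0 M = pi0_group (isom_group M)"


section \<open>Lens spaces\<close>

definition lens_rotation :: "nat \<Rightarrow> nat \<Rightarrow> complex \<times> complex \<Rightarrow> complex \<times> complex" where
  "lens_rotation m q = (\<lambda>(z0, z1).
     let \<xi> = exp (2 * of_real pi * \<i> / of_nat m) in (\<xi> * z0, \<xi> ^ q * z1))"

text \<open>Since the generator has finite order, its nonnegative powers form the whole cyclic group.\<close>

definition lens_orbit :: "nat \<Rightarrow> nat \<Rightarrow> complex \<times> complex \<Rightarrow> (complex \<times> complex) set" where
  "lens_orbit m q z = range (\<lambda>k. (lens_rotation m q ^^ k) z)"

text \<open>The distance of the round metric on \<open>S\<^sup>3\<close> is the angle, and a minimal geodesic between two
  points of the quotient lifts to a minimal geodesic between their orbits.\<close>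

definition lens_dist :: "(complex \<times> complex) set \<Rightarrow> (complex \<times> complex) set \<Rightarrow> real" where
  "lens_dist A B = (INF (x, y) \<in> A \<times> B. arccos (x \<bullet> y))"

text \<open>The library's metric spaces require a distance function that is nonnegative and symmetric on
  the whole type, so it is set to zero outside the carrier.\<close>

definition lens_space :: "nat \<Rightarrow> nat \<Rightarrow> (complex \<times> complex) set metric" where
  "lens_space m q =
     (let L = lens_orbit m q ` S3
      in metric (L, \<lambda>A B. if A \<in> L \<and> B \<in> L then lens_dist A B else 0))"


subsection \<open>The distance is a metric\<close>

lemma arccos_triangle:
  fixes x y z :: "'a::real_inner"
  assumes "norm x = 1" "norm y = 1" "norm z = 1"
  shows "arccos (x \<bullet> z) \<le> arccos (x \<bullet> y) + arccos (y \<bullet> z)"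
proof (cases "arccos (x \<bullet> y) + arccos (y \<bullet> z) \<le> pi")
  case True
  have *: "\<bar>u \<bullet> v\<bar> \<le> 1" if "norm u = 1" "norm v = 1" for u v :: 'a
    using Cauchy_Schwarz_ineq2[of u v] that by simp
  note xy = *[OF assms(1,2)] and yz = *[OF assms(2,3)] and xz = *[OF assms(1,3)]
  have sq: "x \<bullet> x = 1" "y \<bullet> y = 1" "z \<bullet> z = 1"
    using assms by (simp_all add: dot_square_norm)
  define u where "u = x - (x \<bullet> y) *\<^sub>R y"
  define v where "v = z - (y \<bullet> z) *\<^sub>R y"
  have uv: "u \<bullet> v = x \<bullet> z - (x \<bullet> y) * (y \<bullet> z)"
    by (simp add: u_def v_def inner_diff_left inner_diff_right sq inner_commute)
  have uu: "u \<bullet> u = 1 - (x \<bullet> y)\<^sup>2"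
    by (simp add: u_def inner_diff_left inner_diff_right sq inner_commute power2_eq_square)
  have vv: "v \<bullet> v = 1 - (y \<bullet> z)\<^sup>2"
    by (simp add: v_def inner_diff_left inner_diff_right sq inner_commute power2_eq_square)
  have "norm u = sin (arccos (x \<bullet> y))" "norm v = sin (arccos (y \<bullet> z))"
    using xy yz uu vv by (simp_all add: sin_arccos_abs norm_eq_sqrt_inner)
  then have "cos (arccos (x \<bullet> y) + arccos (y \<bullet> z)) = (x \<bullet> y) * (y \<bullet> z) - norm u * norm v"
    using xy yz by (simp add: cos_add cos_arccos_abs)
  also have "\<dots> \<le> x \<bullet> z"
    using Cauchy_Schwarz_ineq2[of u v] uv by linarith
  also have "\<dots> = cos (arccos (x \<bullet> z))"
    using xz by (simp add: cos_arccos_abs)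
  finally show ?thesis
    using True xy yz xz
    by (subst (asm) cos_mono_le_eq) (auto intro!: add_nonneg_nonneg arccos_lbound arccos_ubound simp: abs_le_iff)
next
  case False
  have "\<bar>x \<bullet> z\<bar> \<le> 1"
    using Cauchy_Schwarz_ineq2[of x z] assms by simp
  then show ?thesis
    using False arccos_ubound[of "x \<bullet> z"] by (simp add: abs_le_iff)
qed

lemma S3_eq_sphere: "S3 = sphere 0 1"
  by (auto simp: S3_def norm_Pair real_sqrt_eq_1_iff)

lemma lens_rotation_inner: "lens_rotation m q x \<bullet> lens_rotation m q y = x \<bullet> y"
proof -
  have *: "(c * z) \<bullet> (c * w) = z \<bullet> w" if "cmod c = 1" for c z w :: complex
  proof -
    have "(c * z) \<bullet> (c * w) = ((Re c)\<^sup>2 + (Im c)\<^sup>2) * (z \<bullet> w)"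
      by (simp add: inner_complex_def algebra_simps power2_eq_square)
    also have "(Re c)\<^sup>2 + (Im c)\<^sup>2 = 1"
      using that by (simp add: cmod_def)
    finally show ?thesis by simp
  qed
  have "cmod (exp (2 * of_real pi * \<i> / of_nat m)) = 1"
    by (simp add: norm_exp_eq_Re)
  then show ?thesis
    by (cases x; cases y) (simp add: lens_rotation_def Let_def * norm_power)
qed

lemma lens_rotation_funpow_inner:
  "(lens_rotation m q ^^ k) x \<bullet> (lens_rotation m q ^^ k) y = x \<bullet> y"
  by (induction k) (simp_all add: lens_rotation_inner)

lemma lens_rotation_funpow_period: 
  assumes "m \<ge> 1"
  shows "(lens_rotation m q ^^ m) x = x"
proof -
  define \<xi> where "\<xi> = exp (2 * of_real pi * \<i> / of_nat m)"
  have "\<xi> ^ m = 1"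
    using assms by (simp add: \<xi>_def flip: exp_of_nat_mult)
  then have "(\<xi> ^ q) ^ m = 1"
    by (metis mult.commute power_mult power_one)
  moreover have "(lens_rotation m q ^^ k) (z, w) = (\<xi> ^ k * z, (\<xi> ^ q) ^ k * w)" for k z w
    by (induction k) (simp_all add: lens_rotation_def Let_def \<xi>_def)
  ultimately show ?thesis
    using \<open>\<xi> ^ m = 1\<close> by (cases x) simp
qed

lemma lens_rotation_funpow_period_mult:
  assumes "m \<ge> 1"
  shows "(lens_rotation m q ^^ (m * k)) x = x"
  by (induction k) (simp_all add: funpow_add lens_rotation_funpow_period[OF assms])

lemma lens_orbit_trans:
  assumes "y \<in> lens_orbit m q x" "z \<in> lens_orbit m q y"
  shows "z \<in> lens_orbit m q x"
proof -
  obtain k l where "y = (lens_rotation m q ^^ k) x" "z = (lens_rotation m q ^^ l) y"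
    using assms by (auto simp: lens_orbit_def)
  then have "z = (lens_rotation m q ^^ (l + k)) x"
    by (simp add: funpow_add)
  then show ?thesis by (auto simp: lens_orbit_def)
qed

lemma lens_orbit_eq:
  assumes "m \<ge> 1" "y \<in> lens_orbit m q x"
  shows "lens_orbit m q y = lens_orbit m q x"
proof -
  obtain k where k: "y = (lens_rotation m q ^^ k) x"
    using assms by (auto simp: lens_orbit_def)
  have "(lens_rotation m q ^^ (m * k - k)) y = (lens_rotation m q ^^ (m * k - k + k)) x"
    by (simp add: k funpow_add)
  also have "m * k - k + k = m * k"
    using assms by simp
  finally have "x = (lens_rotation m q ^^ (m * k - k)) y"
    using assms by (simp add: lens_rotation_funpow_period_mult)
  then have "x \<in> lens_orbit m q y"
    by (auto simp: lens_orbit_def)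
  with assms show ?thesis
    using lens_orbit_trans by blast
qed

lemma lens_orbit_self: "x \<in> lens_orbit m q x"
  unfolding lens_orbit_def by (rule range_eqI[of _ _ 0]) simp

lemma lens_orbit_subset_S3:
  assumes "x \<in> S3"
  shows "lens_orbit m q x \<subseteq> S3"
  using assms by (auto simp: lens_orbit_def S3_eq_sphere norm_eq_sqrt_inner lens_rotation_funpow_inner)

lemma finite_lens_orbit:
  assumes "m \<ge> 1"
  shows "finite (lens_orbit m q x)"
proof -
  have "(lens_rotation m q ^^ k) x = (lens_rotation m q ^^ (k mod m)) x" for k
  proof -
    have "(lens_rotation m q ^^ (k mod m + m * (k div m))) x = (lens_rotation m q ^^ (k mod m)) x"
      unfolding funpow_add by (simp add: lens_rotation_funpow_period_mult[OF assms])
    then show ?thesis by simp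
  qed
  moreover have "k mod m \<in> {..<m}" for k
    using assms by simp
  ultimately have "lens_orbit m q x \<subseteq> (\<lambda>k. (lens_rotation m q ^^ k) x) ` {..<m}"
    unfolding lens_orbit_def by blast
  then show ?thesis
    using finite_surj by blast
qed

lemma lens_dist_le:
  assumes "m \<ge> 1" "A \<in> lens_orbit m q ` S3" "B \<in> lens_orbit m q ` S3" "x \<in> A" "y \<in> B"
  shows "lens_dist A B \<le> arccos (x \<bullet> y)"
proof -
  have "finite (A \<times> B)"
    using assms finite_lens_orbit by blast
  then have "lens_dist A B \<le> (\<lambda>(x, y). arccos (x \<bullet> y)) (x, y)"
    unfolding lens_dist_def using assms by (intro cINF_lower) auto
  then show ?thesis by simp
qed

lemma lens_dist_attained:
  assumes "m \<ge> 1" "A \<in> lens_orbit m q ` S3" "B \<in> lens_orbit m q ` S3" "x \<in> A"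
  obtains y where "y \<in> B" "lens_dist A B = arccos (x \<bullet> y)"
proof -
  have fin: "finite (A \<times> B)"
    using assms finite_lens_orbit by blast
  moreover have ne: "A \<times> B \<noteq> {}"
    using assms lens_orbit_self by fastforce
  ultimately have "lens_dist A B \<in> (\<lambda>(x, y). arccos (x \<bullet> y)) ` (A \<times> B)"
    unfolding lens_dist_def by (subst cInf_eq_Min) (auto intro!: Min_in simp del: Sigma_empty1)
  then obtain a b where ab: "a \<in> A" "b \<in> B" "lens_dist A B = arccos (a \<bullet> b)"
    by auto
  have "A = lens_orbit m q a" "B = lens_orbit m q b"
    using assms(1-3) ab lens_orbit_eq by (metis imageE)+
  then obtain k where k: "x = (lens_rotation m q ^^ k) a"
    using assms by (auto simp: lens_orbit_def)
  show thesis
  proof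
    show "(lens_rotation m q ^^ k) b \<in> B"
      using \<open>B = lens_orbit m q b\<close> by (auto simp: lens_orbit_def)
    show "lens_dist A B = arccos (x \<bullet> (lens_rotation m q ^^ k) b)"
      by (simp add: k ab lens_rotation_funpow_inner)
  qed
qed

lemma Metric_space_lens:
  fixes m q :: nat
  assumes "m \<ge> 1"
  defines "L \<equiv> lens_orbit m q ` S3"
  shows "Metric_space L (\<lambda>A B. if A \<in> L \<and> B \<in> L then lens_dist A B else 0)"
proof -
  have S3: "x \<in> S3" if "A \<in> L" "x \<in> A" for A x
    using that lens_orbit_subset_S3 unfolding L_def by (metis imageE subsetD)
  have ne: "\<exists>x. x \<in> A" if "A \<in> L" for A
    using that lens_orbit_self unfolding L_def by (metis imageE)
  have abs_le: "\<bar>x \<bullet> y\<bar> \<le> 1" if "x \<in> S3" "y \<in> S3" for x y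
    using that Cauchy_Schwarz_ineq2[of x y] by (simp add: S3_eq_sphere)
  note att = lens_dist_attained[OF assms(1), of _ q, folded L_def]
  note le = lens_dist_le[OF assms(1), of _ q, folded L_def]
  have comm_le: "lens_dist A B \<le> lens_dist B A" if AB: "A \<in> L" "B \<in> L" for A B
  proof -
    obtain y where y: "y \<in> B" using ne AB by blast
    obtain x where "x \<in> A" "lens_dist B A = arccos (y \<bullet> x)"
      using att[OF AB(2,1) y] .
    then show ?thesis
      using le[OF AB _ y] by (metis inner_commute)
  qed
  have nonneg: "0 \<le> lens_dist A B" if AB: "A \<in> L" "B \<in> L" for A B
  proof -
    obtain x where x: "x \<in> A" using ne AB by blast
    obtain y where "y \<in> B" "lens_dist A B = arccos (x \<bullet> y)"
      using att[OF AB x] .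
    then show ?thesis
      using abs_le[OF S3[OF AB(1) x] S3[OF AB(2)], of y] by (simp add: abs_le_iff arccos_lbound)
  qed
  have zero: "lens_dist A B = 0 \<longleftrightarrow> A = B" if AB: "A \<in> L" "B \<in> L" for A B
  proof
    obtain x where x: "x \<in> A" using ne AB by blast
    have xx: "x \<bullet> x = 1"
      using S3[OF AB(1) x] by (simp add: S3_eq_sphere dot_square_norm)
    show "lens_dist A B = 0" if "A = B"
      using le[OF AB x] nonneg[OF AB] x xx that by fastforce
    assume 0: "lens_dist A B = 0"
    obtain y where y: "y \<in> B" "lens_dist A B = arccos (x \<bullet> y)"
      using att[OF AB x] .
    have "x \<in> S3" "y \<in> S3"
      using S3 AB x y by auto
    then have "cos (arccos (x \<bullet> y)) = x \<bullet> y"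
      by (simp add: abs_le cos_arccos_abs)
    then have "x \<bullet> y = 1"
      using 0 y by simp
    moreover have "y \<bullet> y = 1"
      using \<open>y \<in> S3\<close> by (simp add: S3_eq_sphere dot_square_norm)
    ultimately have "(x - y) \<bullet> (x - y) = 0"
      using xx by (simp only: inner_diff_left inner_diff_right inner_commute[of y x])
    then have "x = y"
      by (metis eq_iff_diff_eq_0 inner_eq_zero_iff)
    then show "A = B"
      using AB x y lens_orbit_eq[OF assms(1)] unfolding L_def by (metis imageE)
  qed
  have tri: "lens_dist A C \<le> lens_dist A B + lens_dist B C"
    if ABC: "A \<in> L" "B \<in> L" "C \<in> L" for A B C
  proof -
    obtain x where x: "x \<in> A" using ABC ne by blast
    obtain y where y: "y \<in> B" "lens_dist A B = arccos (x \<bullet> y)"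
      using att[OF ABC(1,2) x] .
    obtain z where z: "z \<in> C" "lens_dist B C = arccos (y \<bullet> z)"
      using att[OF ABC(2,3) y(1)] .
    have "arccos (x \<bullet> z) \<le> arccos (x \<bullet> y) + arccos (y \<bullet> z)"
      using S3 ABC x y z by (intro arccos_triangle) (auto simp: S3_eq_sphere)
    then show ?thesis
      using le[OF ABC(1,3) x z(1)] y z by simp
  qed
  show ?thesis
  proof
    fix A B
    show "(if A \<in> L \<and> B \<in> L then lens_dist A B else 0) =
          (if B \<in> L \<and> A \<in> L then lens_dist B A else 0)"
      using comm_le by (auto intro: antisym)
  qed (use nonneg zero tri in auto)
qed

lemma
  assumes "m \<ge> 1"
  shows mspace_lens_space: "mspace (lens_space m q) = lens_orbit m q ` S3"
    and mdist_lens_space: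
      "\<lbrakk>A \<in> lens_orbit m q ` S3; B \<in> lens_orbit m q ` S3\<rbrakk>
         \<Longrightarrow> mdist (lens_space m q) A B = lens_dist A B"
  using Metric_space.mspace_metric[OF Metric_space_lens[OF assms]]
    Metric_space.mdist_metric[OF Metric_space_lens[OF assms]]
  by (simp_all add: lens_space_def Let_def)


subsection \<open>Isometries form a group\<close>

lemma group_isom_group: "group (isom_group M)"
proof -
  let ?S = "mspace M"
  let ?I = "{f \<in> Bij ?S. \<forall>x \<in> ?S. \<forall>y \<in> ?S. mdist M (f x) (f y) = mdist M x y}"
  have mem: "f x \<in> ?S" if "f \<in> Bij ?S" "x \<in> ?S" for f x
    using that Bij_imp_funcset by blast
  show ?thesis
  proof (rule groupI)
    fix f assume "f \<in> carrier (isom_group M)"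
    then have f: "f \<in> ?I" by (simp add: isom_group_def Let_def)
    let ?g = "restrict (inv_into ?S f) ?S"
    have g: "?g \<in> Bij ?S"
      using f by (simp add: restrict_inv_into_Bij)
    have "f (?g x) = x" if "x \<in> ?S" for x
      using f that by (auto simp: Bij_def bij_betw_def f_inv_into_f)
    then have "?g \<in> ?I"
      using f g mem[OF g] by (smt (verit) mem_Collect_eq)
    then show "\<exists>g \<in> carrier (isom_group M). g \<otimes>\<^bsub>isom_group M\<^esub> f = \<one>\<^bsub>isom_group M\<^esub>"
      using f by (auto simp: isom_group_def Let_def Bij_compose_restrict_eq intro!: bexI[of _ ?g])
  qed (auto simp: isom_group_def Let_def compose_Bij id_Bij mem compose_eq Bij_imp_funcset
      Bij_imp_extensional intro: compose_assoc[symmetric])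
qed

end

theory Submission
  imports Defs
begin

text \<open>
  The isometry group of a lens space is the normalizer of its deck group in \<open>O(4)\<close>, divided by the deck
  group. Indeed, near a point an isometry of \<open>L(m, q)\<close> is a distance preserving map between small balls of
  the sphere; it preserves inner products there, hence extends to an orthogonal map of \<open>\<complex>\<^sup>2\<close>
  (\<open>local_lift\<close>). Two such extensions that agree at a point agree everywhere, because distinct points of
  one orbit are a definite distance apart, so connectedness of \<open>S\<^sup>3\<close> makes one local extension a global
  lift, and comparing the lift with its composition with the generator shows that it normalizes the deck
  group (\<open>isometry_lift\<close>).

  Each normalizer is then presented by a compact group \<open>K\<close> acting orthogonally (\<open>lens_action\<close>).
  For \<open>m \<le> 2\<close> the deck group consists of real scalars and the normalizer is all of \<open>O(4)\<close>, that is, the maps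
  \<open>x \<mapsto> a x b\<^sup>-\<^sup>1\<close> and their compositions with quaternion conjugation. For \<open>q = 1\<close> the generator is left
  multiplication by a complex number that is not real, a normalizing map commutes or anticommutes with \<open>\<i>\<close>, and
  such maps are \<open>x \<mapsto> a x b\<^sup>-\<^sup>1\<close> with \<open>a\<close> in \<open>O(2)\<^sup>*\<close> (\<open>normalizer_form\<close>). For \<open>q > 1\<close> the
  sum of the generator and its inverse has different real eigenvalues on the two coordinate axes, so a
  normalizing map preserves or exchanges the axes, and an exchange forces \<open>q\<^sup>2 \<equiv> \<plusminus>1\<close>
  (\<open>normalizer_axes\<close>, \<open>normalizer_monomial\<close>).

  To identify the quotient with the group in the statement, that group is also written as a quotient of
  \<open>K\<close>, and the two kernels are compared: by compactness, two Hausdorff quotients of \<open>K\<close> with one kernel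
  are isomorphic as topological groups (\<open>topgroup_iso_common_cover\<close>). The path components are read off from
  a locally constant homomorphism on \<open>K\<close> that kills the kernel and has path connected fibres
  (\<open>pi0_group_labelling\<close>).

  The comparison of kernels is arithmetic in the last three cases. When \<open>q\<^sup>2 \<equiv> -1\<close>, the torus is \<open>\<complex> / \<int>[\<i>]\<close>
  and the deck group is the kernel of a Gaussian integer of norm \<open>m\<close>, which exists because \<open>m\<close> divides
  \<open>q\<^sup>2 + 1\<close> (\<open>gaussian_factor\<close>, \<open>gauss_kernel\<close>). When \<open>q\<^sup>2 \<equiv> 1\<close>, the normalizer is the image of
  \<open>O(2) \<times> O(2)\<close>, where the power maps with exponents \<open>gcd(m, q - 1)\<close> and \<open>gcd(m, q + 1)\<close> exhibit the group that
  acts by deck transformations as the preimage of \<open>(1, 1)\<close> or of \<open>\<plusminus>(1, 1)\<close>, according to the product of the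
  two divisors (\<open>dihedral_kernel_double\<close>, \<open>dihedral_kernel_single\<close>).
\<close>

section \<open>Compact groups and their quotients\<close>

lemma with_topology_simps [simp]:
  "carrier (with_topology G X) = carrier G"
  "monoid.mult (with_topology G X) = monoid.mult G"
  "one (with_topology G X) = one G"
  "gtopology (with_topology G X) = X"
  by (simp_all add: with_topology_def)

lemma group_with_topology: "group G \<Longrightarrow> group (with_topology G X)"
  unfolding group_def group_axioms_def monoid_def Units_def by simp

lemma topgroup_prod_simps [simp]:
  "carrier (topgroup_prod G H) = carrier G \<times> carrier H"
  "monoid.mult (topgroup_prod G H) = (\<lambda>(a, b) (c, d). (a \<otimes>\<^bsub>G\<^esub> c, b \<otimes>\<^bsub>H\<^esub> d))"
  "one (topgroup_prod G H) = (\<one>\<^bsub>G\<^esub>, \<one>\<^bsub>H\<^esub>)"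
  "gtopology (topgroup_prod G H) = prod_topology (gtopology G) (gtopology H)"
  by (simp_all add: topgroup_prod_def DirProd_def)

definition compact_topgroup :: "'a topgroup \<Rightarrow> bool" where
  "compact_topgroup K \<longleftrightarrow> group K \<and> topspace (gtopology K) = carrier K \<and>
     compact_space (gtopology K) \<and> Hausdorff_space (gtopology K)"

lemma compact_topgroup_prod:
  assumes "compact_topgroup G" "compact_topgroup H"
  shows "compact_topgroup (topgroup_prod G H)"
  using assms unfolding compact_topgroup_def
  by (simp add: compact_space_prod_topology Hausdorff_space_prod_topology)
    (simp add: topgroup_prod_def DirProd_group group_with_topology)

definition quotient_hom :: "'a topgroup \<Rightarrow> 'b topgroup \<Rightarrow> ('a \<Rightarrow> 'b) \<Rightarrow> bool" where
  "quotient_hom K H p \<longleftrightarrow> p \<in> hom K H \<and> topspace (gtopology K) = carrier K \<and>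
     quotient_map (gtopology K) (gtopology H) p \<and> topspace (gtopology H) = carrier H"

lemma quotient_hom_compose:
  assumes "quotient_hom K H p" "quotient_hom H G r"
  shows "quotient_hom K G (r \<circ> p)"
  using assms hom_compose quotient_map_compose unfolding quotient_hom_def by blast

lemma quotient_hom_surj: "quotient_hom K H p \<Longrightarrow> p ` carrier K = carrier H"
  unfolding quotient_hom_def by (metis quotient_imp_surjective_map)

lemma quotient_hom_compact:
  assumes "compact_topgroup K" "p \<in> hom K H" "continuous_map (gtopology K) (gtopology H) p"
    "p ` carrier K = carrier H" "topspace (gtopology H) = carrier H" "Hausdorff_space (gtopology H)"
  shows "quotient_hom K H p"
  using assms unfolding quotient_hom_def compact_topgroup_def
  by (simp add: continuous_imp_quotient_map)

lemma hom_eq_iff_kernel: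
  assumes "group K" and p: "p \<in> hom K H" and r: "r \<in> hom K G"
    and ker: "\<And>k. k \<in> carrier K \<Longrightarrow> p k = p \<one>\<^bsub>K\<^esub> \<Longrightarrow> r k = r \<one>\<^bsub>K\<^esub>"
    and k: "k \<in> carrier K" and l: "l \<in> carrier K" and eq: "p k = p l"
  shows "r k = r l"
proof -
  interpret group K by fact
  define d where "d = inv\<^bsub>K\<^esub> l \<otimes>\<^bsub>K\<^esub> k"
  have d: "d \<in> carrier K" and ld: "l \<otimes>\<^bsub>K\<^esub> d = k"
    using k l by (simp_all add: d_def m_assoc[symmetric])
  have "p d = p (inv\<^bsub>K\<^esub> l \<otimes>\<^bsub>K\<^esub> l)"
    using hom_mult[OF p, of "inv\<^bsub>K\<^esub> l" k] hom_mult[OF p, of "inv\<^bsub>K\<^esub> l" l] k l eq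
    by (simp add: d_def del: l_inv)
  then have "r d = r \<one>\<^bsub>K\<^esub>"
    using ker[OF d] l by simp
  then have "r (l \<otimes>\<^bsub>K\<^esub> d) = r (l \<otimes>\<^bsub>K\<^esub> \<one>\<^bsub>K\<^esub>)"
    using hom_mult[OF r l d] hom_mult[OF r l one_closed] by simp
  then show ?thesis using ld l by simp
qed

text \<open>Both sides are the quotient of \<open>K\<close> by the common kernel, topologically as well: compactness
  makes a continuous bijection onto a Hausdorff group a homeomorphism.\<close>

lemma topgroup_iso_common_cover:
  assumes K: "compact_topgroup K" and p: "quotient_hom K H p"
    and hom: "\<Psi> \<in> hom K G" and cont: "continuous_map (gtopology K) (gtopology G) \<Psi>"
    and surj: "\<Psi> ` carrier K = carrier G" and topG: "topspace (gtopology G) = carrier G"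
    and haus: "Hausdorff_space (gtopology G)"
    and ker: "\<And>k. k \<in> carrier K \<Longrightarrow> p k = p \<one>\<^bsub>K\<^esub> \<longleftrightarrow> \<Psi> k = \<Psi> \<one>\<^bsub>K\<^esub>"
  shows "topgroup_iso G H"
proof -
  have grp: "group K" and topK: "topspace (gtopology K) = carrier K"
    using K by (auto simp: compact_topgroup_def)
  interpret group K by fact
  have q: "quotient_map (gtopology K) (gtopology H) p" and ph: "p \<in> hom K H"
    using p by (auto simp: quotient_hom_def)
  have psurj: "p ` carrier K = carrier H"
    using p by (rule quotient_hom_surj)
  have r: "quotient_hom K G \<Psi>"
    using K hom cont surj topG haus by (rule quotient_hom_compact)
  then have rq: "quotient_map (gtopology K) (gtopology G) \<Psi>"
    by (simp add: quotient_hom_def)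
  have eq: "p k = p l \<longleftrightarrow> \<Psi> k = \<Psi> l" if "k \<in> carrier K" "l \<in> carrier K" for k l
    using hom_eq_iff_kernel[OF grp ph hom _ that] hom_eq_iff_kernel[OF grp hom ph _ that] ker
    by blast
  define h where "h g = p (inv_into (carrier K) \<Psi> g)" for g
  have h: "h (\<Psi> k) = p k" if "k \<in> carrier K" for k
  proof -
    have "inv_into (carrier K) \<Psi> (\<Psi> k) \<in> carrier K" "\<Psi> (inv_into (carrier K) \<Psi> (\<Psi> k)) = \<Psi> k"
      using that by (auto intro: inv_into_into f_inv_into_f)
    then show ?thesis using eq that by (simp add: h_def)
  qed
  have "h \<in> hom G H"
  proof (rule homI)
    fix x y assume "x \<in> carrier G" "y \<in> carrier G"
    then obtain k l where "k \<in> carrier K" "x = \<Psi> k" "l \<in> carrier K" "y = \<Psi> l"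
      using surj by blast
    then show "h (x \<otimes>\<^bsub>G\<^esub> y) = h x \<otimes>\<^bsub>H\<^esub> h y"
      using h hom_mult[OF ph] hom_mult[OF hom] by (metis m_closed)
  next
    fix x assume "x \<in> carrier G"
    then obtain k where "k \<in> carrier K" "x = \<Psi> k"
      using surj by blast
    then show "h x \<in> carrier H" using h psurj by auto
  qed
  moreover have "inj_on h (carrier G)"
    unfolding surj[symmetric] by (auto simp: inj_on_def h eq)
  moreover have "h ` carrier G = carrier H"
    unfolding surj[symmetric] psurj[symmetric] image_image using h by simp
  ultimately have iso: "h \<in> Group.iso G H"
    by (simp add: Group.iso_def bij_betw_def)
  have "quotient_map (gtopology K) (gtopology H) (h \<circ> \<Psi>)"
    by (rule quotient_map_eq[OF q]) (simp add: topK h)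
  then have "quotient_map (gtopology G) (gtopology H) h"
    using quotient_map_compose_eq[OF rq] by blast
  then have "homeomorphic_map (gtopology G) (gtopology H) h"
    unfolding homeomorphic_map_def using \<open>inj_on h (carrier G)\<close> topG by simp
  then show ?thesis
    using iso unfolding topgroup_iso_def by blast
qed

text \<open>The labelling \<open>c\<close> descends along \<open>\<Psi>\<close> to a locally constant map, so the images of its path
  connected fibres are the path components.\<close>

lemma pi0_group_labelling:
  fixes K :: "'a topgroup" and G :: "'b topgroup" and D :: "'d monoid"
  assumes K: "compact_topgroup K"
    and hom: "\<Psi> \<in> hom K G" and cont: "continuous_map (gtopology K) (gtopology G) \<Psi>"
    and surj: "\<Psi> ` carrier K = carrier G" and topG: "topspace (gtopology G) = carrier G"
    and haus: "Hausdorff_space (gtopology G)"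
    and c: "c \<in> hom K D" and csurj: "c ` carrier K = carrier D"
    and ccont: "continuous_map (gtopology K) (discrete_topology (carrier D)) c"
    and cpath: "\<And>d. d \<in> carrier D \<Longrightarrow> path_connectedin (gtopology K) {k \<in> carrier K. c k = d}"
    and ker: "\<And>k. k \<in> carrier K \<Longrightarrow> \<Psi> k = \<Psi> \<one>\<^bsub>K\<^esub> \<Longrightarrow> c k = c \<one>\<^bsub>K\<^esub>"
  shows "pi0_group G \<cong> D"
proof -
  have grp: "group K" and topK: "topspace (gtopology K) = carrier K"
    using K by (auto simp: compact_topgroup_def)
  interpret group K by fact
  have "quotient_hom K G \<Psi>"
    using K hom cont surj topG haus by (rule quotient_hom_compact)
  then have rq: "quotient_map (gtopology K) (gtopology G) \<Psi>"
    by (simp add: quotient_hom_def)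
  define e where "e g = c (inv_into (carrier K) \<Psi> g)" for g
  have e: "e (\<Psi> k) = c k" if "k \<in> carrier K" for k
  proof -
    have "inv_into (carrier K) \<Psi> (\<Psi> k) \<in> carrier K" "\<Psi> (inv_into (carrier K) \<Psi> (\<Psi> k)) = \<Psi> k"
      using that by (auto intro: inv_into_into f_inv_into_f)
    then show ?thesis unfolding e_def using hom_eq_iff_kernel[OF grp hom c ker _ that] by blast
  qed
  have econt: "continuous_map (gtopology G) (discrete_topology (carrier D)) e"
    unfolding continuous_compose_quotient_map_eq[OF rq, symmetric]
    by (rule continuous_map_eq[OF ccont]) (simp add: topK e)
  define F where "F d = \<Psi> ` {k \<in> carrier K. c k = d}" for d
  have comp: "path_component_of_set (gtopology G) (\<Psi> k) = F (c k)" if k: "k \<in> carrier K" for k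
  proof (rule path_component_of_unique)
    show "\<Psi> k \<in> F (c k)" using k by (auto simp: F_def)
    have "c k \<in> carrier D" using k csurj by blast
    then show "path_connectedin (gtopology G) (F (c k))"
      unfolding F_def by (intro path_connectedin_continuous_map_image[OF cont] cpath)
    fix C' assume C': "\<Psi> k \<in> C'" "path_connectedin (gtopology G) C'"
    have "path_connectedin (discrete_topology (carrier D)) (e ` C')"
      using path_connectedin_continuous_map_image[OF econt C'(2)] .
    then obtain d where "e ` C' \<subseteq> {d}"
      by (metis path_connectedin_discrete_topology)
    then have *: "e g = c k" if "g \<in> C'" for g
      using C'(1) e[OF k] that by (metis image_eqI singletonD subsetD)
    have "C' \<subseteq> carrier G"
      using path_connectedin_subset_topspace[OF C'(2)] topG by simp
    show "C' \<subseteq> F (c k)"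
    proof
      fix g assume g: "g \<in> C'"
      then obtain k' where k': "k' \<in> carrier K" "g = \<Psi> k'"
        using \<open>C' \<subseteq> carrier G\<close> surj by blast
      then show "g \<in> F (c k)"
        using *[OF g] e[OF k'(1)] by (auto simp: F_def)
    qed
  qed
  have carr: "carrier (pi0_group G) = F ` carrier D"
    unfolding pi0_group_def path_components_of_def topG csurj[symmetric] surj[symmetric]
    by (auto simp: comp image_image)
  define h where "h A = e (SOME g. g \<in> A)" for A
  have h: "h (F d) = d" if "d \<in> carrier D" for d
  proof -
    have "F d \<noteq> {}" using that unfolding csurj[symmetric] by (auto simp: F_def)
    then have "(SOME g. g \<in> F d) \<in> F d" by (simp add: some_in_eq)
    then show ?thesis using e by (auto simp: h_def F_def)
  qed
  have cm: "c (k \<otimes>\<^bsub>K\<^esub> l) = c k \<otimes>\<^bsub>D\<^esub> c l" if "k \<in> carrier K" "l \<in> carrier K" for k l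
    using hom_mult[OF c that] .
  have mult: "F a \<otimes>\<^bsub>pi0_group G\<^esub> F b = F (a \<otimes>\<^bsub>D\<^esub> b)"
    if ab: "a \<in> carrier D" "b \<in> carrier D" for a b
  proof -
    obtain k where k: "k \<in> carrier K" "c k = a"
      using ab(1) unfolding csurj[symmetric] by auto
    have "F (a \<otimes>\<^bsub>D\<^esub> b) \<subseteq> F a <#>\<^bsub>G\<^esub> F b"
    proof
      fix x assume "x \<in> F (a \<otimes>\<^bsub>D\<^esub> b)"
      then obtain l where l: "l \<in> carrier K" "c l = a \<otimes>\<^bsub>D\<^esub> b" "x = \<Psi> l" by (auto simp: F_def)
      define t where "t = inv\<^bsub>K\<^esub> k \<otimes>\<^bsub>K\<^esub> l"
      have t: "t \<in> carrier K" "k \<otimes>\<^bsub>K\<^esub> t = l"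
        using k l by (simp_all add: t_def m_assoc[symmetric])
      obtain k' where k': "k' \<in> carrier K" "c k' = b"
        using ab(2) unfolding csurj[symmetric] by auto
      have "c t = c (inv\<^bsub>K\<^esub> k) \<otimes>\<^bsub>D\<^esub> c (k \<otimes>\<^bsub>K\<^esub> k')"
        using cm[of "inv\<^bsub>K\<^esub> k" l] cm[of k k'] k l k' by (simp add: t_def)
      also have "\<dots> = c (inv\<^bsub>K\<^esub> k \<otimes>\<^bsub>K\<^esub> (k \<otimes>\<^bsub>K\<^esub> k'))"
        using k k' by (intro cm[symmetric]) auto
      also have "\<dots> = b" using k k' by (simp add: m_assoc[symmetric])
      finally show "x \<in> F a <#>\<^bsub>G\<^esub> F b"
        unfolding set_mult_def F_def using t k l hom_mult[OF hom k(1) t(1)] by auto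
    qed
    moreover have "F a <#>\<^bsub>G\<^esub> F b \<subseteq> F (a \<otimes>\<^bsub>D\<^esub> b)"
    proof
      fix x assume "x \<in> F a <#>\<^bsub>G\<^esub> F b"
      then obtain k l where kl: "k \<in> carrier K" "c k = a" "l \<in> carrier K" "c l = b"
        "x = \<Psi> k \<otimes>\<^bsub>G\<^esub> \<Psi> l" unfolding set_mult_def F_def by auto
      then have "x = \<Psi> (k \<otimes>\<^bsub>K\<^esub> l)" "c (k \<otimes>\<^bsub>K\<^esub> l) = a \<otimes>\<^bsub>D\<^esub> b"
        using hom_mult[OF hom kl(1,3)] cm[OF kl(1,3)] by simp_all
      then show "x \<in> F (a \<otimes>\<^bsub>D\<^esub> b)" using kl by (auto simp: F_def)
    qed
    ultimately show ?thesis by (simp add: pi0_group_def)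
  qed
  have closed: "a \<otimes>\<^bsub>D\<^esub> b \<in> carrier D" if "a \<in> carrier D" "b \<in> carrier D" for a b
    using that cm[symmetric] unfolding csurj[symmetric] by auto
  have "h \<in> Group.iso (pi0_group G) D"
    unfolding Group.iso_def bij_betw_def
    by (auto simp: carr h mult closed inj_on_def image_image intro!: homI)
  then show ?thesis
    unfolding is_iso_def by blast
qed

subsection \<open>Semidirect products with cyclic groups\<close>

lemma semidirect_cyclic_simps [simp]:
  "carrier (semidirect_cyclic N k \<phi>) = carrier N \<times> carrier (integer_mod_group k)"
  "monoid.mult (semidirect_cyclic N k \<phi>) = 
     (\<lambda>(x, a) (y, b). (x \<otimes>\<^bsub>N\<^esub> (\<phi> ^^ nat a) y, (a + b) mod int k))"
  "one (semidirect_cyclic N k \<phi>) = (\<one>\<^bsub>N\<^esub>, 0)"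
  "gtopology (semidirect_cyclic N k \<phi>) = 
     prod_topology (gtopology N) (discrete_topology (carrier (integer_mod_group k)))"
  by (simp_all add: semidirect_cyclic_def)

definition cyclic_action :: "('a, 'm) monoid_scheme \<Rightarrow> nat \<Rightarrow> ('a \<Rightarrow> 'a) \<Rightarrow> bool" where
  "cyclic_action N k \<phi> \<longleftrightarrow> k > 0 \<and> \<phi> \<in> hom N N \<and> (\<forall>x \<in> carrier N. (\<phi> ^^ k) x = x)"

lemma funpow_periodic_mod:
  assumes "(f ^^ k) x = x"
  shows "(f ^^ n) x = (f ^^ (n mod k)) x"
proof -
  have "(f ^^ (k * j)) x = x" for j
    by (induction j) (simp_all add: funpow_add assms)
  then have "(f ^^ (n mod k + k * (n div k))) x = (f ^^ (n mod k)) x"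
    unfolding funpow_add by simp
  then show ?thesis by simp
qed

lemma funpow_int_mod:
  assumes "(f ^^ k) x = x" "k > 0" "0 \<le> a" "0 \<le> b"
  shows "(f ^^ nat ((a + b) mod int k)) x = (f ^^ nat a) ((f ^^ nat b) x)"
proof -
  have "nat ((a + b) mod int k) = (nat a + nat b) mod k"
    using assms by (simp add: nat_mod_distrib nat_add_distrib)
  then show ?thesis
    using funpow_periodic_mod[OF assms(1), of "nat a + nat b"] by (simp add: funpow_add)
qed

lemma funpow_closed:
  assumes "\<And>x. x \<in> A \<Longrightarrow> f x \<in> A" "x \<in> A"
  shows "(f ^^ n) x \<in> A"
  using assms(2) by (induction n) (auto intro: assms(1))

lemma compact_topgroup_semidirect:
  assumes N: "compact_topgroup N" and \<phi>: "cyclic_action N k \<phi>"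
  shows "compact_topgroup (semidirect_cyclic N k \<phi>)"
proof -
  interpret N: group N using N by (simp add: compact_topgroup_def)
  have k: "k > 0" and hom: "\<phi> \<in> hom N N" and per: "\<And>x. x \<in> carrier N \<Longrightarrow> (\<phi> ^^ k) x = x"
    using \<phi> by (auto simp: cyclic_action_def)
  have cl1: "\<phi> x \<in> carrier N" if "x \<in> carrier N" for x
    using hom that by (auto simp: hom_def)
  have cl: "(\<phi> ^^ n) x \<in> carrier N" if "x \<in> carrier N" for n x
    using cl1 that by (rule funpow_closed)
  have m: "(\<phi> ^^ n) (x \<otimes>\<^bsub>N\<^esub> y) = (\<phi> ^^ n) x \<otimes>\<^bsub>N\<^esub> (\<phi> ^^ n) y"
    if "x \<in> carrier N" "y \<in> carrier N" for n x y
    using that by (induction n) (auto simp: hom_mult[OF hom] cl)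
  have one: "(\<phi> ^^ n) \<one>\<^bsub>N\<^esub> = \<one>\<^bsub>N\<^esub>" for n
    using m[of "\<one>\<^bsub>N\<^esub>" "\<one>\<^bsub>N\<^esub>" n] cl[of "\<one>\<^bsub>N\<^esub>" n] by simp
  have "group (semidirect_cyclic N k \<phi>)"
  proof (rule groupI)
    fix x y z
    assume "x \<in> carrier (semidirect_cyclic N k \<phi>)" "y \<in> carrier (semidirect_cyclic N k \<phi>)"
      "z \<in> carrier (semidirect_cyclic N k \<phi>)"
    then show "x \<otimes>\<^bsub>semidirect_cyclic N k \<phi>\<^esub> y \<otimes>\<^bsub>semidirect_cyclic N k \<phi>\<^esub> z =
      x \<otimes>\<^bsub>semidirect_cyclic N k \<phi>\<^esub> (y \<otimes>\<^bsub>semidirect_cyclic N k \<phi>\<^esub> z)"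
      using k by (auto simp: carrier_integer_mod_group funpow_int_mod[OF per] m cl N.m_assoc
          mod_simps algebra_simps)
  next
    fix x assume x: "x \<in> carrier (semidirect_cyclic N k \<phi>)"
    obtain n a where na: "x = (n, a)" "n \<in> carrier N" "0 \<le> a" "a < int k"
      using x k by (cases x) (auto simp: carrier_integer_mod_group)
    let ?b = "(- a) mod int k"
    let ?y = "((\<phi> ^^ nat ?b) (inv\<^bsub>N\<^esub> n), ?b)"
    have "?y \<otimes>\<^bsub>semidirect_cyclic N k \<phi>\<^esub> x = \<one>\<^bsub>semidirect_cyclic N k \<phi>\<^esub>"
      using na k m[of "inv\<^bsub>N\<^esub> n" n] by (simp add: one mod_simps flip: m)
    moreover have "?y \<in> carrier (semidirect_cyclic N k \<phi>)"
      using na k cl by (simp add: carrier_integer_mod_group)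
    ultimately show "\<exists>y \<in> carrier (semidirect_cyclic N k \<phi>).
        y \<otimes>\<^bsub>semidirect_cyclic N k \<phi>\<^esub> x = \<one>\<^bsub>semidirect_cyclic N k \<phi>\<^esub>" by blast
  qed (use k in \<open>auto simp: carrier_integer_mod_group cl\<close>)
  then show ?thesis
    using N k by (simp add: compact_topgroup_def compact_space_prod_topology Hausdorff_space_prod_topology
        compact_space_discrete_topology carrier_integer_mod_group)
qed

lemma openin_prod_discrete:
  "openin (prod_topology X (discrete_topology D)) U \<longleftrightarrow>
     U \<subseteq> topspace X \<times> D \<and> (\<forall>d \<in> D. openin X {x \<in> topspace X. (x, d) \<in> U})" (is "?L \<longleftrightarrow> ?R")
proof
  assume L: ?L
  have "openin X {x \<in> topspace X. (x, d) \<in> U}" if "d \<in> D" for d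
  proof -
    have "continuous_map X (prod_topology X (discrete_topology D)) (\<lambda>x. (x, d))"
      using that by (intro continuous_map_pairedI) auto
    from openin_continuous_map_preimage[OF this L] show ?thesis .
  qed
  then show ?R using openin_subset[OF L] by simp
next
  assume R: ?R
  have "U = (\<Union>d\<in>D. {x \<in> topspace X. (x, d) \<in> U} \<times> {d})"
    using R by auto
  moreover have "openin (prod_topology X (discrete_topology D)) \<dots>"
    using R by (intro openin_Union) (auto simp: openin_prod_Times_iff)
  ultimately show ?L by simp
qed

lemma continuous_map_prod_discrete:
  assumes "\<And>d. d \<in> D \<Longrightarrow> continuous_map X Y (\<lambda>x. f (x, d))"
  shows "continuous_map (prod_topology X (discrete_topology D)) Y f"
  unfolding continuous_map_def
proof (intro conjI allI impI)
  show "f \<in> topspace (prod_topology X (discrete_topology D)) \<rightarrow> topspace Y"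
    using assms by (auto simp: continuous_map_def Pi_iff)
  fix U assume U: "openin Y U"
  show "openin (prod_topology X (discrete_topology D))
         {x \<in> topspace (prod_topology X (discrete_topology D)). f x \<in> U}"
    unfolding openin_prod_discrete
  proof (intro conjI ballI)
    fix d assume "d \<in> D"
    then show "openin X {x \<in> topspace X. (x, d)
          \<in> {x \<in> topspace (prod_topology X (discrete_topology D)). f x \<in> U}}"
      using openin_continuous_map_preimage[OF assms U] by simp
  qed auto
qed

lemma quotient_hom_semidirect:
  assumes p: "quotient_hom N N' p" and k: "k > 0"
    and cl: "\<And>x. x \<in> carrier N \<Longrightarrow> \<phi> x \<in> carrier N"
    and equiv: "\<And>x. x \<in> carrier N \<Longrightarrow> p (\<phi> x) = \<phi>' (p x)"
  shows "quotient_hom (semidirect_cyclic N k \<phi>) (semidirect_cyclic N' k \<phi>') (\<lambda>(x, n). (p x, n))"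
proof -
  let ?D = "carrier (integer_mod_group k)"
  have hom: "p \<in> hom N N'" and top: "topspace (gtopology N) = carrier N" "topspace (gtopology N') = carrier N'"
    and q: "quotient_map (gtopology N) (gtopology N') p"
    using p by (auto simp: quotient_hom_def)
  have surj: "p ` carrier N = carrier N'" using quotient_hom_surj[OF p] .
  have eq: "p ((\<phi> ^^ n) x) = (\<phi>' ^^ n) (p x)" if "x \<in> carrier N" for n x
    using that by (induction n) (auto simp: equiv funpow_closed cl)
  have "(\<lambda>(x, n). (p x, n)) \<in> hom (semidirect_cyclic N k \<phi>) (semidirect_cyclic N' k \<phi>')"
    using k surj by (intro homI)
      (auto simp: carrier_integer_mod_group hom_mult[OF hom] eq funpow_closed cl)
  moreover have "quotient_map (prod_topology (gtopology N) (discrete_topology ?D))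
     (prod_topology (gtopology N') (discrete_topology ?D)) (\<lambda>(x, n). (p x, n))"
    unfolding quotient_map_def
  proof (intro conjI allI impI)
    show "(\<lambda>(x, n). (p x, n)) ` topspace (prod_topology (gtopology N) (discrete_topology ?D)) =
      topspace (prod_topology (gtopology N') (discrete_topology ?D))"
      unfolding topspace_prod_topology top topspace_discrete_topology surj[symmetric]
      by (auto simp: image_iff)
    fix U assume U: "U \<subseteq> topspace (prod_topology (gtopology N') (discrete_topology ?D))"
    let ?V = "{x \<in> topspace (prod_topology (gtopology N) (discrete_topology ?D)). 
                 (case x of (x, n) \<Rightarrow> (p x, n)) \<in> U}"
    have "openin (gtopology N) {x \<in> topspace (gtopology N). (x, d) \<in> ?V} \<longleftrightarrow>
      openin (gtopology N') {y \<in> topspace (gtopology N'). (y, d) \<in> U}" if "d \<in> ?D" for d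
    proof -
      let ?W = "{y \<in> topspace (gtopology N'). (y, d) \<in> U}"
      have "{x \<in> topspace (gtopology N). (x, d) \<in> ?V} = {x \<in> topspace (gtopology N). p x \<in> ?W}"
        using that surj top by auto
      moreover have "openin (gtopology N) {x \<in> topspace (gtopology N). p x \<in> ?W} \<longleftrightarrow>
          openin (gtopology N') ?W"
        by (rule q[unfolded quotient_map_def, THEN conjunct2, rule_format]) (rule Collect_restrict)
      ultimately show ?thesis by (simp only:)
    qed
    then show "openin (prod_topology (gtopology N) (discrete_topology ?D)) ?V \<longleftrightarrow>
      openin (prod_topology (gtopology N') (discrete_topology ?D)) U"
      unfolding openin_prod_discrete using U by auto
  qed
  ultimately show ?thesis
    by (simp add: quotient_hom_def top)
qed

lemma semidirect_label:
  fixes N :: "'a topgroup" and \<phi> :: "'a \<Rightarrow> 'a"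
  assumes "k > 0" and N: "compact_topgroup N" and pc: "path_connected_space (gtopology N)"
  defines "K \<equiv> semidirect_cyclic N k \<phi>"
  shows "snd \<in> hom K (integer_mod_group k)"
    and "snd ` carrier K = carrier (integer_mod_group k)"
    and "continuous_map (gtopology K) (discrete_topology (carrier (integer_mod_group k))) snd"
    and "\<And>d. d \<in> carrier (integer_mod_group k) \<Longrightarrow>
            path_connectedin (gtopology K) {x \<in> carrier K. snd x = d}"
proof -
  have top: "topspace (gtopology N) = carrier N" and ne: "\<one>\<^bsub>N\<^esub> \<in> carrier N"
    using N group.is_monoid monoid.one_closed by (auto simp: compact_topgroup_def)
  show "snd \<in> hom K (integer_mod_group k)"
    using \<open>k > 0\<close> by (auto simp: K_def hom_def carrier_integer_mod_group)
  show "snd ` carrier K = carrier (integer_mod_group k)"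
    using ne by (auto simp: K_def image_iff)
  show "continuous_map (gtopology K) (discrete_topology (carrier (integer_mod_group k))) snd"
    unfolding K_def semidirect_cyclic_simps by (rule continuous_map_snd)
  fix d assume d: "d \<in> carrier (integer_mod_group k)"
  have "{x \<in> carrier K. snd x = d} = topspace (gtopology N) \<times> {d}"
    using d by (auto simp: K_def top)
  then show "path_connectedin (gtopology K) {x \<in> carrier K. snd x = d}"
    using d pc by (simp add: K_def path_connectedin_Times path_connectedin_topspace)
qed

text \<open>A semidirect product acts once \<open>N\<close> acts and some \<open>\<sigma>\<close> realises the automorphism by conjugation.\<close>

lemma semidirect_action:
  assumes act: "\<And>x y. x \<in> carrier N \<Longrightarrow> y \<in> carrier N \<Longrightarrow> act (x \<otimes>\<^bsub>N\<^esub> y) = act x \<circ> act y"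
    and \<sigma>: "\<And>x. x \<in> carrier N \<Longrightarrow> \<sigma> \<circ> act x = act (\<phi> x) \<circ> \<sigma>"
    and per: "\<And>z. (\<sigma> ^^ k) z = z" and k: "k > 0"
    and cl: "\<And>x. x \<in> carrier N \<Longrightarrow> \<phi> x \<in> carrier N"
    and g: "g \<in> carrier (semidirect_cyclic N k \<phi>)" and h: "h \<in> carrier (semidirect_cyclic N k \<phi>)"
  defines "a \<equiv> \<lambda>(x, n). act x \<circ> \<sigma> ^^ nat n"
  shows "a (g \<otimes>\<^bsub>semidirect_cyclic N k \<phi>\<^esub> h) = a g \<circ> a h"
proof -
  obtain x n y l where gh: "g = (x, n)" "h = (y, l)" "x \<in> carrier N" "y \<in> carrier N"
      "0 \<le> n" "0 \<le> l"
    using g h k by (cases g; cases h) (auto simp: carrier_integer_mod_group)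
  have *: "(\<sigma> ^^ i) \<circ> act y = act ((\<phi> ^^ i) y) \<circ> (\<sigma> ^^ i)" for i
  proof (induction i)
    case (Suc i)
    have "\<sigma> ^^ Suc i \<circ> act y = \<sigma> \<circ> (\<sigma> ^^ i \<circ> act y)"
      by (simp only: funpow.simps comp_assoc)
    also have "\<dots> = (\<sigma> \<circ> act ((\<phi> ^^ i) y)) \<circ> \<sigma> ^^ i"
      by (simp only: Suc comp_assoc)
    also have "\<dots> = act ((\<phi> ^^ Suc i) y) \<circ> \<sigma> ^^ Suc i"
      by (subst \<sigma>[OF funpow_closed[where f = \<phi> and n = i, OF cl \<open>y \<in> carrier N\<close>]])
        (auto simp: comp_assoc)
    finally show ?case .
  qed simp
  have "\<sigma> ^^ nat ((n + l) mod int k) = \<sigma> ^^ nat n \<circ> \<sigma> ^^ nat l"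
    using funpow_int_mod[OF per k, of n l] gh by (auto simp: fun_eq_iff)
  then have "a (g \<otimes>\<^bsub>semidirect_cyclic N k \<phi>\<^esub> h) =
      act x \<circ> (act ((\<phi> ^^ nat n) y) \<circ> \<sigma> ^^ nat n) \<circ> \<sigma> ^^ nat l"
    using gh by (simp add: a_def act funpow_closed cl comp_assoc)
  also have "\<dots> = a g \<circ> a h"
    by (simp add: a_def gh *[symmetric] comp_assoc)
  finally show ?thesis .
qed

subsection \<open>Amalgamating the central involutions\<close>

text \<open>The twisted product is formed with the negation of the carrier type; this ties that negation to the
  group law, so that it is multiplication by a central involution.\<close>

definition has_minus_one :: "'a::uminus topgroup \<Rightarrow> bool" where
  "has_minus_one G \<longleftrightarrow> - \<one>\<^bsub>G\<^esub> \<in> carrier G \<and> (\<forall>x \<in> carrier G. - \<one>\<^bsub>G\<^esub> \<otimes>\<^bsub>G\<^esub> x = - x \<and> x \<otimes>\<^bsub>G\<^esub> - \<one>\<^bsub>G\<^esub> = - x)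
     \<and> - (- \<one>\<^bsub>G\<^esub>) = \<one>\<^bsub>G\<^esub>"

lemma quotient_hom_twisted:
  fixes G :: "'a::uminus topgroup" and H :: "'b::uminus topgroup"
  assumes G: "compact_topgroup G" "has_minus_one G" and H: "compact_topgroup H" "has_minus_one H"
  defines "P \<equiv> topgroup_prod G H"
    and "N \<equiv> {(\<one>\<^bsub>G\<^esub>, \<one>\<^bsub>H\<^esub>), (- \<one>\<^bsub>G\<^esub>, - \<one>\<^bsub>H\<^esub>)}"
  shows "quotient_hom P (G \<times>\<^sub>~ H) (r_coset P N)"
    and "\<And>x. x \<in> carrier P \<Longrightarrow> r_coset P N x = r_coset P N \<one>\<^bsub>P\<^esub> \<longleftrightarrow> x \<in> N"
    and "\<And>x. x \<in> carrier P \<Longrightarrow> r_coset P N x = {x, (- fst x, - snd x)}"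
proof -
  have P: "compact_topgroup P"
    unfolding P_def using G H by (simp add: compact_topgroup_prod)
  interpret G: group G using G by (simp add: compact_topgroup_def)
  interpret H: group H using H by (simp add: compact_topgroup_def)
  interpret P: group P using P by (simp add: compact_topgroup_def)
  have mG: "- \<one>\<^bsub>G\<^esub> \<in> carrier G" "- (- \<one>\<^bsub>G\<^esub>) = \<one>\<^bsub>G\<^esub>"
    "\<And>x. x \<in> carrier G \<Longrightarrow> - \<one>\<^bsub>G\<^esub> \<otimes>\<^bsub>G\<^esub> x = - x" "\<And>x. x \<in> carrier G \<Longrightarrow> x \<otimes>\<^bsub>G\<^esub> - \<one>\<^bsub>G\<^esub> = - x"
    using G by (auto simp: has_minus_one_def)
  have mH: "- \<one>\<^bsub>H\<^esub> \<in> carrier H" "- (- \<one>\<^bsub>H\<^esub>) = \<one>\<^bsub>H\<^esub>"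
    "\<And>x. x \<in> carrier H \<Longrightarrow> - \<one>\<^bsub>H\<^esub> \<otimes>\<^bsub>H\<^esub> x = - x" "\<And>x. x \<in> carrier H \<Longrightarrow> x \<otimes>\<^bsub>H\<^esub> - \<one>\<^bsub>H\<^esub> = - x"
    using H by (auto simp: has_minus_one_def)
  have cos: "r_coset P N x = {x, (- fst x, - snd x)}" if "x \<in> carrier P" for x
    using that by (cases x) (auto simp: r_coset_def N_def P_def mG mH)
  have NP: "N \<subseteq> carrier P" by (auto simp: N_def P_def mG mH)
  have inv: "inv\<^bsub>P\<^esub> x = x" if "x \<in> N" for x
    using that NP by (intro P.inv_equality) (auto simp: N_def P_def mG mH)
  have "subgroup N P"
  proof (rule P.subgroupI)
    show "inv\<^bsub>P\<^esub> a \<in> N" if "a \<in> N" for a using inv that by simp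
    show "a \<otimes>\<^bsub>P\<^esub> b \<in> N" if "a \<in> N" "b \<in> N" for a b
      using that by (auto simp: N_def P_def mG mH)
  qed (use NP in \<open>auto simp: N_def\<close>)
  then have "N \<lhd> P"
  proof (rule P.normalI)
    show "\<forall>x\<in>carrier P. N #>\<^bsub>P\<^esub> x = x <#\<^bsub>P\<^esub> N"
      by (auto simp: r_coset_def l_coset_def N_def P_def mG mH)
  qed
  then interpret normal N P .
  have top: "topspace (gtopology P) = carrier P"
    using P by (simp add: compact_topgroup_def)
  have tw: "G \<times>\<^sub>~ H = topgroup_quotient P N"
    by (simp add: twisted_prod_def P_def N_def)
  have q: "quotient_map (gtopology P) (gtopology (G \<times>\<^sub>~ H)) (r_coset P N)"
    by (simp add: tw topgroup_quotient_def quotient_map_quotient_topology)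
  have "topspace (gtopology (G \<times>\<^sub>~ H)) = carrier (G \<times>\<^sub>~ H)"
    using quotient_imp_surjective_map[OF q, symmetric]
    by (auto simp: top tw topgroup_quotient_def FactGroup_def RCOSETS_def)
  moreover have "r_coset P N \<in> hom P (G \<times>\<^sub>~ H)"
    using r_coset_hom_Mod by (simp add: tw topgroup_quotient_def hom_def)
  ultimately show "quotient_hom P (G \<times>\<^sub>~ H) (r_coset P N)"
    using q top by (simp add: quotient_hom_def)
  show "r_coset P N x = {x, (- fst x, - snd x)}" if "x \<in> carrier P" for x
    using cos that .
  have "\<one>\<^bsub>P\<^esub> = (\<one>\<^bsub>G\<^esub>, \<one>\<^bsub>H\<^esub>)" by (simp add: P_def)
  show "r_coset P N x = r_coset P N \<one>\<^bsub>P\<^esub> \<longleftrightarrow> x \<in> N" if x: "x \<in> carrier P" for x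
    using P.coset_join1[OF _ x \<open>subgroup N P\<close>] P.coset_join2[OF x \<open>subgroup N P\<close>]
      P.coset_mult_one[OF NP] x by auto
qed

section \<open>Unit quaternions and rotations\<close>

lemma S3_iff_norm: "x \<in> S3 \<longleftrightarrow> norm x = 1"
  by (simp add: S3_eq_sphere)

lemma quat_mult_eq: "quat_mult x y =
    (fst x * fst y - snd x * cnj (snd y), fst x * snd y + snd x * cnj (fst y))"
  by (cases x; cases y) simp

definition quat_cnj :: "complex \<times> complex \<Rightarrow> complex \<times> complex" where
  "quat_cnj x = (cnj (fst x), - snd x)"

lemma quat_mult_assoc: "quat_mult (quat_mult x y) z = quat_mult x (quat_mult y z)"
  by (simp add: quat_mult_eq algebra_simps)

lemma quat_mult_one [simp]: "quat_mult (1, 0) x = x" "quat_mult x (1, 0) = x"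
  by (simp_all add: quat_mult_eq)

lemma norm_quat_mult: "norm (quat_mult x y) = norm x * norm y"
proof -
  obtain a b c d where xy: "x = (a, b)" "y = (c, d)" by (cases x; cases y)
  have "(norm (quat_mult x y))\<^sup>2 = (norm x * norm y)\<^sup>2"
    by (simp add: xy norm_Pair power_mult_distrib cmod_power2) algebra
  then show ?thesis by simp
qed

lemma norm_quat_cnj [simp]: "norm (quat_cnj x) = norm x"
  by (cases x) (simp add: quat_cnj_def norm_Pair)

lemma quat_cnj_cnj [simp]: "quat_cnj (quat_cnj x) = x"
  by (simp add: quat_cnj_def)

lemma quat_cnj_mult: "quat_cnj (quat_mult x y) = quat_mult (quat_cnj y) (quat_cnj x)"
  by (simp add: quat_cnj_def quat_mult_eq)

lemma quat_mult_cnj: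
  assumes "norm x = 1"
  shows "quat_mult x (quat_cnj x) = (1, 0)" "quat_mult (quat_cnj x) x = (1, 0)"
proof -
  have "(cmod (fst x))\<^sup>2 + (cmod (snd x))\<^sup>2 = 1"
    using assms by (cases x) (simp add: norm_Pair real_sqrt_eq_1_iff)
  then have *: "fst x * cnj (fst x) + snd x * cnj (snd x) = 1"
    by (metis complex_norm_square of_real_1 of_real_add)
  then show "quat_mult x (quat_cnj x) = (1, 0)" "quat_mult (quat_cnj x) x = (1, 0)"
    by (simp_all add: quat_mult_eq quat_cnj_def mult.commute)
qed

lemma quat_mult_cnj_cancel:
  assumes "norm x = 1"
  shows "quat_mult (quat_cnj x) (quat_mult x y) = y" "quat_mult x (quat_mult (quat_cnj x) y) = y"
  using quat_mult_cnj[OF assms] by (simp_all flip: quat_mult_assoc)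

lemma linear_quat_mult: "linear (quat_mult a)" "linear (\<lambda>x. quat_mult x a)" "linear quat_cnj"
  by (auto intro!: linearI simp: quat_mult_eq quat_cnj_def algebra_simps scaleR_conv_of_real)

lemma continuous_on_quat_mult [continuous_intros]:
  assumes "continuous_on A f" "continuous_on A g"
  shows "continuous_on A (\<lambda>x. quat_mult (f x) (g x))"
  unfolding quat_mult_eq by (intro continuous_intros assms)

lemma continuous_on_quat_cnj [continuous_intros]:
  assumes "continuous_on A f"
  shows "continuous_on A (\<lambda>x. quat_cnj (f x))"
  unfolding quat_cnj_def by (intro continuous_intros assms)

lemma continuous_map_top_of_set_iff:
  "continuous_map (top_of_set A) (top_of_set B) f \<longleftrightarrow> continuous_on A f \<and> f ` A \<subseteq> B"
  by (auto simp: continuous_map_in_subtopology)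

lemma compact_topgroup_euclidean:
  fixes S :: "'a::metric_space set"
  assumes "group G" "carrier G = S" "gtopology G = top_of_set S" "compact S"
  shows "compact_topgroup G"
  using assms Hausdorff_space_subtopology[OF Hausdorff_space_euclidean, of S]
  by (simp add: compact_topgroup_def compact_space_subtopology flip: compactin_euclidean_iff)

subsection \<open>The standard groups are compact\<close>

lemma S3_group_simps [simp]:
  "carrier S3_group = S3" "monoid.mult S3_group = quat_mult" "one S3_group = (1, 0)"
  "gtopology S3_group = top_of_set S3"
  by (simp_all add: S3_group_def)

lemma circle_group_simps [simp]:
  "carrier circle_group = sphere 0 1" "monoid.mult circle_group = (*)" "one circle_group = 1"
  "gtopology circle_group = top_of_set (sphere 0 1)"
  by (simp_all add: circle_group_def)

lemma O2_star_simps [simp]: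
  "carrier O2_star = two_circles" "monoid.mult O2_star = quat_mult" "one O2_star = (1, 0)"
  "gtopology O2_star = top_of_set two_circles"
  by (simp_all add: O2_star_def)

lemma O2_simps [simp]:
  "carrier O2 = two_circles" "monoid.mult O2 = O2_mult" "one O2 = (1, 0)"
  "gtopology O2 = top_of_set two_circles"
  by (simp_all add: O2_def)

lemma unit_mult_cnj: "cmod z = 1 \<Longrightarrow> z * cnj z = 1" "cmod z = 1 \<Longrightarrow> cnj z * z = 1"
  using complex_norm_square[of z] by (simp_all add: mult.commute)

lemma group_S3: "group S3_group"
proof (rule groupI)
  show "\<exists>y\<in>carrier S3_group. y \<otimes>\<^bsub>S3_group\<^esub> x = \<one>\<^bsub>S3_group\<^esub>" if "x \<in> carrier S3_group" for x
    using that quat_mult_cnj[of x] by (intro bexI[of _ "quat_cnj x"]) (simp_all add: S3_iff_norm)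
qed (auto simp: S3_iff_norm norm_quat_mult quat_mult_assoc norm_Pair)

lemma compact_S3_group: "compact_topgroup S3_group"
  by (rule compact_topgroup_euclidean[OF group_S3]) (auto simp: S3_eq_sphere)

lemma compact_circle_group: "compact_topgroup circle_group"
proof (rule compact_topgroup_euclidean)
  show "group circle_group"
  proof (rule groupI)
    show "\<exists>y\<in>carrier circle_group. y \<otimes>\<^bsub>circle_group\<^esub> x = \<one>\<^bsub>circle_group\<^esub>"
      if "x \<in> carrier circle_group" for x
      using that by (intro bexI[of _ "cnj x"]) (auto simp: unit_mult_cnj)
  qed (auto simp: norm_mult)
qed auto

lemma two_circles_cases [case_names fst snd]:
  assumes "x \<in> two_circles"
  obtains z where "cmod z = 1" "x = (z, 0)" | z where "cmod z = 1" "x = (0, z)"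
  using assms by (auto simp: two_circles_def)

lemma two_circles_iff [simp]:
  "(z, 0) \<in> two_circles \<longleftrightarrow> cmod z = 1" "(0, z) \<in> two_circles \<longleftrightarrow> cmod z = 1"
  by (auto simp: two_circles_def)

lemma compact_two_circles: "compact two_circles"
  unfolding two_circles_def by (intro compact_Un compact_continuous_image continuous_intros) auto

lemma two_circles_subset_S3: "two_circles \<subseteq> S3"
  by (auto simp: two_circles_def S3_def)

lemma compact_O2_star: "compact_topgroup O2_star"
proof (rule compact_topgroup_euclidean[OF _ _ _ compact_two_circles])
  show "group O2_star"
  proof (rule groupI)
    fix x assume x: "x \<in> carrier O2_star"
    then have "quat_cnj x \<in> two_circles"
      by (auto elim!: two_circles_cases simp: quat_cnj_def)
    moreover have "norm x = 1" using x two_circles_subset_S3 by (auto simp: S3_iff_norm)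
    ultimately show "\<exists>y\<in>carrier O2_star. y \<otimes>\<^bsub>O2_star\<^esub> x = \<one>\<^bsub>O2_star\<^esub>"
      using quat_mult_cnj[of x] by (intro bexI[of _ "quat_cnj x"]) simp_all
  qed (auto simp: quat_mult_assoc norm_mult elim!: two_circles_cases)
qed auto

lemma compact_O2: "compact_topgroup O2"
proof (rule compact_topgroup_euclidean[OF _ _ _ compact_two_circles])
  show "group O2"
  proof (rule groupI)
    fix x assume x: "x \<in> carrier O2"
    then show "\<exists>y\<in>carrier O2. y \<otimes>\<^bsub>O2\<^esub> x = \<one>\<^bsub>O2\<^esub>"
      by (intro bexI[of _ "(cnj (fst x), snd x)"]) (auto simp: unit_mult_cnj elim!: two_circles_cases)
  qed (auto simp: norm_mult elim!: two_circles_cases)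
qed auto

lemma has_minus_one:
  "has_minus_one S3_group" "has_minus_one circle_group" "has_minus_one O2_star" "has_minus_one O2"
  by (auto simp: has_minus_one_def S3_iff_norm norm_Pair quat_mult_eq elim!: two_circles_cases)

definition circle_label :: "complex \<times> complex \<Rightarrow> int" where
  "circle_label x = (if snd x = 0 then 0 else 1)"

lemma circle_label:
  shows "circle_label \<in> hom O2 (integer_mod_group 2)" "circle_label \<in> hom O2_star (integer_mod_group 2)"
    "circle_label ` two_circles = carrier (integer_mod_group 2)"
    "continuous_map (top_of_set two_circles) (discrete_topology (carrier (integer_mod_group 2))) circle_label"
    "\<And>d. d \<in> carrier (integer_mod_group 2) \<Longrightarrow> path_connected {x \<in> two_circles. circle_label x = d}"
proof -
  show "circle_label \<in> hom O2 (integer_mod_group 2)" "circle_label \<in> hom O2_star (integer_mod_group 2)"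
    by (auto intro!: homI elim!: two_circles_cases simp: circle_label_def carrier_integer_mod_group)
  have "circle_label (1, 0) = 0" "circle_label (0, 1) = 1" by (simp_all add: circle_label_def)
  moreover have D: "carrier (integer_mod_group 2) = {0, 1}"
    by (auto simp: carrier_integer_mod_group)
  ultimately show "circle_label ` two_circles = carrier (integer_mod_group 2)"
    unfolding D by (auto simp: circle_label_def intro: rev_image_eqI[of "(1, 0)"] rev_image_eqI[of "(0, 1)"])
  have fib: "{x \<in> two_circles. circle_label x = 0} = (\<lambda>z. (z, 0)) ` sphere 0 1"
    "{x \<in> two_circles. circle_label x = 1} = (\<lambda>z. (0, z)) ` sphere 0 1"
    by (auto simp: circle_label_def two_circles_def)
  show "path_connected {x \<in> two_circles. circle_label x = d}" if "d \<in> carrier (integer_mod_group 2)" for d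
    using that unfolding D
    by (auto simp: fib intro!: path_connected_continuous_image continuous_intros path_connected_sphere)
  have "{x \<in> two_circles. circle_label x = 0} = two_circles \<inter> {x. norm (snd x) < 1/2}"
    "{x \<in> two_circles. circle_label x = 1} = two_circles \<inter> {x. norm (fst x) < 1/2}"
    by (auto simp: circle_label_def two_circles_def)
  moreover have "open {x::complex \<times> complex. norm (snd x) < 1/2}" "open {x::complex \<times> complex. norm (fst x) < 1/2}"
    by (intro open_Collect_less continuous_intros)+
  ultimately have op: "openin (top_of_set two_circles) {x \<in> two_circles. circle_label x = d}" if "d \<in> {0, 1}" for d
    using that by (auto simp: openin_open)
  show "continuous_map (top_of_set two_circles) (discrete_topology (carrier (integer_mod_group 2))) circle_label"
    unfolding continuous_map_def D
  proof (intro conjI allI impI)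
    fix U :: "int set" assume "openin (discrete_topology {0, 1}) U"
    then have U: "U \<subseteq> {0, 1}" by simp
    have "{x \<in> topspace (top_of_set two_circles). circle_label x \<in> U} = (\<Union>d\<in>U. {x \<in> two_circles. circle_label x = d})"
      by auto
    moreover have "openin (top_of_set two_circles) (\<Union>d\<in>U. {x \<in> two_circles. circle_label x = d})"
      using op U by (intro openin_Union) (auto simp del: UN_simps)
    ultimately show "openin (top_of_set two_circles) {x \<in> topspace (top_of_set two_circles). circle_label x \<in> U}"
      by (simp only:)
  qed (auto simp: circle_label_def)
qed

lemma circle_root:
  assumes "cmod z = 1" "n > 0"
  obtains w where "cmod w = 1" "w ^ n = z"
proof
  show "cmod (cis (Arg z / n)) = 1" by simp
  have "cis (Arg z) = z"
    using rcis_cmod_Arg[of z] assms by (simp add: rcis_def)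
  moreover have "cis (Arg z / n) ^ n = cis (real n * (Arg z / n))"
    by (rule Complex.DeMoivre)
  ultimately show "cis (Arg z / n) ^ n = z"
    using assms(2) by simp
qed

subsection \<open>Orthogonal maps of the quaternions\<close>

lemma orthogonal_transformation_inner:
  "orthogonal_transformation T \<Longrightarrow> T x \<bullet> T y = x \<bullet> y"
  by (simp add: orthogonal_transformation_def)

lemma orthogonal_transformation_complex:
  fixes T :: "complex \<Rightarrow> complex"
  assumes T: "orthogonal_transformation T"
  obtains u where "cmod u = 1" "T = (\<lambda>z. u * z) \<or> T = (\<lambda>z. u * cnj z)"
proof -
  define u where "u = T 1"
  have lin: "linear T" using T by (rule orthogonal_transformation_linear)
  have u: "cmod u = 1" "u * cnj u = 1"
    using orthogonal_transformation_norm[OF T, of 1] unit_mult_cnj by (auto simp: u_def)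
  define v where "v = cnj u * T \<i>"
  have Ti: "T \<i> = u * v" using u by (simp add: v_def mult.assoc[symmetric])
  have "cmod v = 1"
    using orthogonal_transformation_norm[OF T, of \<i>] u by (simp add: v_def norm_mult)
  moreover have "Re v = 0"
    using orthogonal_transformation_inner[OF T, of 1 \<i>]
    by (simp add: v_def u_def inner_complex_def algebra_simps)
  ultimately have "v = \<i> \<or> v = - \<i>"
    by (auto simp: complex_eq_iff cmod_def real_sqrt_eq_1_iff power2_eq_1_iff)
  have Tz: "T z = of_real (Re z) * u + of_real (Im z) * T \<i>" for z
  proof -
    have "z = Re z *\<^sub>R 1 + Im z *\<^sub>R \<i>" by (simp add: complex_eq_iff)
    then have "T z = T (Re z *\<^sub>R 1 + Im z *\<^sub>R \<i>)" by simp
    also have "\<dots> = of_real (Re z) * u + of_real (Im z) * T \<i>"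
      unfolding linear_add[OF lin] linear_scale[OF lin] u_def by (simp only: scaleR_conv_of_real)
    finally show ?thesis .
  qed
  from \<open>v = \<i> \<or> v = - \<i>\<close> have "T = (\<lambda>z. u * z) \<or> T = (\<lambda>z. u * cnj z)"
  proof
    assume "v = \<i>"
    then have "T z = u * z" for z
      unfolding Tz[of z] Ti by (simp add: complex_eq_iff algebra_simps)
    then show ?thesis by blast
  next
    assume "v = - \<i>"
    then have "T z = u * cnj z" for z
      unfolding Tz[of z] Ti by (simp add: complex_eq_iff algebra_simps)
    then show ?thesis by blast
  qed
  with u that show ?thesis by blast
qed

definition quat_conj :: "complex \<times> complex \<Rightarrow> complex \<times> complex \<Rightarrow> complex \<times> complex" where
  "quat_conj b x = quat_mult (quat_mult b x) (quat_cnj b)"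

lemma quat_conj_mult: "quat_conj (quat_mult a b) x = quat_conj a (quat_conj b x)"
  by (simp add: quat_conj_def quat_cnj_mult quat_mult_assoc)

lemma linear_quat_conj: "linear (quat_conj b)"
  unfolding quat_conj_def
  using linear_compose[OF linear_quat_mult(1)[of b] linear_quat_mult(2)[of "quat_cnj b"]] by (simp add: o_def)

lemma orthogonal_quat_mult:
  assumes "norm a = 1" "norm b = 1"
  shows "orthogonal_transformation (\<lambda>x. quat_mult (quat_mult a x) b)"
  unfolding orthogonal_transformation
  using linear_compose[OF linear_quat_mult(1)[of a] linear_quat_mult(2)[of b]] assms
  by (simp add: o_def norm_quat_mult)

lemma orthogonal_quat_conj: "norm b = 1 \<Longrightarrow> orthogonal_transformation (quat_conj b)"
  using orthogonal_quat_mult[of b "quat_cnj b"] by (simp add: quat_conj_def[abs_def])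

lemma orthogonal_quat_cnj: "orthogonal_transformation quat_cnj"
  by (simp add: orthogonal_transformation linear_quat_mult)

lemma quat_conj_cancel:
  assumes "norm b = 1"
  shows "quat_conj b (quat_conj (quat_cnj b) x) = x" "quat_conj (quat_cnj b) (quat_conj b x) = x"
  unfolding quat_conj_mult[symmetric] quat_mult_cnj[OF assms] by (simp_all add: quat_conj_def quat_cnj_def)

lemma quat_conj_one: "norm b = 1 \<Longrightarrow> quat_conj b (1, 0) = (1, 0)"
  by (simp add: quat_conj_def quat_mult_cnj)

lemma quat_conj_circle: "quat_conj (w, 0) (z0, z1) = (w * cnj w * z0, w\<^sup>2 * z1)"
  by (simp add: quat_conj_def quat_cnj_def power2_eq_square algebra_simps)

text \<open>The unit imaginary quaternions form one conjugacy class: for \<open>p \<noteq> -\<i>\<close> the quaternion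
  \<open>1 - p\<i>\<close> conjugates \<open>\<i>\<close> to \<open>p\<close>.\<close>

lemma quat_conj_transitive:
  assumes "norm p = 1" "Re (fst p) = 0"
  obtains b where "norm b = 1" "quat_conj b (\<i>, 0) = p"
proof (cases "p = (- \<i>, 0)")
  case True
  show ?thesis
    by (rule that[of "(0, 1)"]) (auto simp: norm_Pair True quat_conj_def quat_cnj_def)
next
  case False
  define r where "r = Im (fst p)"
  define w where "w = snd p"
  have p: "p = (Complex 0 r, w)"
    using assms by (cases p) (auto simp: r_def w_def complex_eq_iff)
  have rw: "r\<^sup>2 + (cmod w)\<^sup>2 = 1"
    using assms(1) by (simp add: p norm_Pair cmod_def real_sqrt_eq_1_iff)
  have "r \<noteq> - 1"
  proof
    assume "r = -1"
    then have "w = 0" using rw by simp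
    then show False using False \<open>r = -1\<close> by (simp add: p complex_eq_iff)
  qed
  have "r\<^sup>2 \<le> 1" using rw by (smt (verit) zero_le_power2)
  then have "r > -1" using \<open>r \<noteq> -1\<close> by (simp add: abs_square_le_1)
  define x where "x = sqrt ((1 + r) / 2)"
  have x: "x > 0" "x\<^sup>2 = (1 + r) / 2"
    using \<open>r > -1\<close> by (auto simp: x_def)
  define c where "c = \<i> * w / of_real (2 * x)"
  have "(cmod c)\<^sup>2 = (cmod w)\<^sup>2 / (4 * x\<^sup>2)"
    using x(1) by (simp add: c_def norm_divide norm_mult power_divide power_mult_distrib)
  also have "\<dots> = (1 - r\<^sup>2) / (2 * (1 + r))"
  proof -
    have "(cmod w)\<^sup>2 = 1 - r\<^sup>2" "4 * x\<^sup>2 = 2 * (1 + r)"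
      using rw x(2) by simp_all
    then show ?thesis by (simp only:)
  qed
  also have "\<dots> = (1 - r) / 2"
    using \<open>r > -1\<close> by (simp add: field_simps power2_eq_square)
  finally have c: "(cmod c)\<^sup>2 = (1 - r) / 2" .
  show ?thesis
  proof
    show "norm (complex_of_real x, c) = 1"
      using c x by (simp add: norm_Pair field_simps)
    have "of_real x * of_real x - c * cnj c = (of_real r :: complex)"
      using c x(2) by (simp add: complex_norm_square[symmetric] flip: of_real_mult power2_eq_square)
        (simp add: field_simps flip: of_real_power of_real_diff)
    then have "\<i> * (of_real x * of_real x - c * cnj c) = Complex 0 r"
      by (simp add: complex_eq_iff)
    moreover have "- 2 * \<i> * of_real x * c = w"
      using x(1) by (simp add: c_def field_simps)
    ultimately show "quat_conj (complex_of_real x, c) (\<i>, 0) = p"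
      by (simp add: quat_conj_def quat_cnj_def p algebra_simps)
  qed
qed

lemma inner_quat: "(z0, z1) \<bullet> (w0, w1) = Re (z0 * cnj w0) + Re (z1 * cnj w1)"
  by (simp add: inner_complex_def)

text \<open>Conjugating by a suitable unit quaternion makes the map fix \<open>\<i>\<close> as well, and then it is an
  isometry of the plane spanned by \<open>j\<close> and \<open>\<i>j\<close>.\<close>

lemma orthogonal_fixing_one:
  assumes T: "orthogonal_transformation T" and one: "T (1, 0) = (1, 0)"
  obtains b where "norm b = 1"
    "(\<forall>x. T x = quat_conj b x) \<or> (\<forall>x. T x = quat_conj b (quat_cnj x))"
proof -
  have "norm (T (\<i>, 0)) = 1"
    using orthogonal_transformation_norm[OF T] by (simp add: norm_Pair)
  moreover have "Re (fst (T (\<i>, 0))) = 0"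
    using orthogonal_transformation_inner[OF T, of "(\<i>, 0)" "(1, 0)"] one
    by (cases "T (\<i>, 0)") (simp add: inner_quat)
  ultimately obtain b where b: "norm b = 1" "quat_conj b (\<i>, 0) = T (\<i>, 0)"
    by (rule quat_conj_transitive)
  define S where "S x = quat_conj (quat_cnj b) (T x)" for x
  have S: "orthogonal_transformation S"
    using orthogonal_transformation_compose[OF orthogonal_quat_conj T, of "quat_cnj b"] b
    by (simp add: S_def[abs_def] o_def)
  have TS: "T x = quat_conj b (S x)" for x
    using quat_conj_cancel[OF b(1)] by (simp add: S_def)
  have S1: "S (1, 0) = (1, 0)"
    using b by (simp add: S_def one quat_conj_one)
  have Si: "S (\<i>, 0) = (\<i>, 0)"
    using quat_conj_cancel[OF b(1)] by (simp add: S_def b(2)[symmetric])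
  have lin: "linear S" using S by (rule orthogonal_transformation_linear)
  have Sz: "S (z, 0) = (z, 0)" for z
  proof -
    have z: "(z, 0) = Re z *\<^sub>R (1, 0) + Im z *\<^sub>R (\<i>, 0::complex)" by (simp add: complex_eq_iff)
    have "S (z, 0) = Re z *\<^sub>R S (1, 0) + Im z *\<^sub>R S (\<i>, 0)"
      by (subst z) (simp only: linear_add[OF lin] linear_scale[OF lin])
    then show ?thesis unfolding S1 Si z[symmetric] .
  qed
  have fst0: "fst (S (0, z)) = 0" for z
    using orthogonal_transformation_inner[OF S, of "(0, z)" "(1, 0)"]
      orthogonal_transformation_inner[OF S, of "(0, z)" "(\<i>, 0)"]
    by (cases "S (0, z)") (simp add: S1 Si inner_quat complex_eq_iff)
  define B where "B z = snd (S (0, z))" for z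
  have SB: "S (0, z) = (0, B z)" for z
    using fst0[of z] by (simp add: B_def prod_eq_iff)
  have "orthogonal_transformation B"
    unfolding orthogonal_transformation
  proof
    show "linear B"
    proof (rule linearI)
      show "B (x + y) = B x + B y" for x y
        using linear_add[OF lin, of "(0, x)" "(0, y)"] by (simp add: SB)
      show "B (c *\<^sub>R x) = c *\<^sub>R B x" for c x
        using linear_scale[OF lin, of c "(0, x)"] by (simp add: SB)
    qed
    show "\<forall>v. norm (B v) = norm v"
      using orthogonal_transformation_norm[OF S, of "(0, _)"] by (simp add: SB norm_Pair)
  qed
  then obtain u where u: "cmod u = 1" "B = (\<lambda>z. u * z) \<or> B = (\<lambda>z. u * cnj z)"
    by (rule orthogonal_transformation_complex)
  obtain w where w: "cmod w = 1" "w\<^sup>2 = u"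
    using circle_root[OF u(1), of 2] by auto
  have Sx: "S (z0, z1) = (z0, B z1)" for z0 z1
    using linear_add[OF lin, of "(z0, 0)" "(0, z1)"] by (simp add: SB Sz)
  from u(2) show ?thesis
  proof
    assume B: "B = (\<lambda>z. u * z)"
    have "S x = quat_conj (w, 0) x" for x
      using w by (cases x) (simp add: Sx B quat_conj_circle unit_mult_cnj)
    then have "T x = quat_conj (quat_mult b (w, 0)) x" for x
      by (simp add: TS quat_conj_mult)
    moreover have "norm (quat_mult b (w, 0)) = 1"
      using w b by (simp add: norm_quat_mult norm_Pair)
    ultimately show ?thesis using that by blast
  next
    assume B: "B = (\<lambda>z. u * cnj z)"
    have "S x = quat_conj (0, \<i> * w) (quat_cnj x)" for x
      using w unit_mult_cnj[OF w(1)]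
      by (cases x) (simp add: Sx B quat_conj_def quat_cnj_def power2_eq_square algebra_simps)
    then have "T x = quat_conj (quat_mult b (0, \<i> * w)) (quat_cnj x)" for x
      by (simp add: TS quat_conj_mult)
    moreover have "norm (quat_mult b (0, \<i> * w)) = 1"
      using w b by (simp add: norm_quat_mult norm_Pair norm_mult)
    ultimately show ?thesis using that by blast
  qed
qed

text \<open>Left division by the image of \<open>1\<close> reduces this to maps that fix \<open>1\<close>.\<close>

lemma orthogonal_quaternion_form:
  assumes T: "orthogonal_transformation T"
  obtains a b where "norm a = 1" "norm b = 1"
    "(\<forall>x. T x = quat_mult (quat_mult a x) (quat_cnj b)) \<or>
     (\<forall>x. T x = quat_mult (quat_mult a (quat_cnj x)) (quat_cnj b))"
proof -
  define a where "a = T (1, 0)"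
  have a: "norm a = 1"
    using orthogonal_transformation_norm[OF T] by (simp add: a_def norm_Pair)
  define S where "S x = quat_mult (quat_cnj a) (T x)" for x
  have S: "orthogonal_transformation S"
    using orthogonal_transformation_compose[OF orthogonal_quat_mult[of "quat_cnj a" "(1, 0)"] T] a
    by (simp add: S_def[abs_def] o_def norm_Pair)
  have "S (1, 0) = (1, 0)"
    using a by (simp add: S_def a_def quat_mult_cnj)
  with S obtain b where b: "norm b = 1"
    "(\<forall>x. S x = quat_conj b x) \<or> (\<forall>x. S x = quat_conj b (quat_cnj x))"
    by (rule orthogonal_fixing_one)
  have TS: "T x = quat_mult a (S x)" for x
    using quat_mult_cnj_cancel[OF a] by (simp add: S_def)
  have "norm (quat_mult a b) = 1" using a b by (simp add: norm_quat_mult)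
  moreover have "(\<forall>x. T x = quat_mult (quat_mult (quat_mult a b) x) (quat_cnj b)) \<or>
     (\<forall>x. T x = quat_mult (quat_mult (quat_mult a b) (quat_cnj x)) (quat_cnj b))"
    using b(2) by (auto simp: TS quat_conj_def quat_mult_assoc)
  ultimately show ?thesis using that b(1) by blast
qed

subsection \<open>The double cover of the rotation group\<close>

definition im_quat :: "real^3 \<Rightarrow> complex \<times> complex" where
  "im_quat v = (Complex 0 (v $ 1), Complex (v $ 2) (v $ 3))"

definition im_coords :: "complex \<times> complex \<Rightarrow> real^3" where
  "im_coords x = vector [Im (fst x), Re (snd x), Im (snd x)]"

definition quat_rotation :: "complex \<times> complex \<Rightarrow> real^3^3" where
  "quat_rotation b = matrix (\<lambda>v. im_coords (quat_conj b (im_quat v)))"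

lemma im_coords_nth [simp]:
  "im_coords x $ 1 = Im (fst x)" "im_coords x $ 2 = Re (snd x)" "im_coords x $ 3 = Im (snd x)"
  by (simp_all add: im_coords_def)

lemma im_coords_im_quat [simp]: "im_coords (im_quat v) = v"
  by (simp add: im_quat_def vec_eq_iff forall_3)

lemma im_quat_im_coords: "Re (fst x) = 0 \<Longrightarrow> im_quat (im_coords x) = x"
  by (simp add: im_quat_def prod_eq_iff complex_eq_iff)

lemma linear_im: "linear im_quat" "linear im_coords"
  by (auto intro!: linearI simp: im_quat_def vec_eq_iff forall_3 complex_eq_iff)

lemma norm_im_quat: "norm (im_quat v) = norm v"
  by (simp add: im_quat_def norm_vec_def L2_set_def sum_3 norm_Pair cmod_def)

lemma Re_im_quat [simp]: "Re (fst (im_quat v)) = 0"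
  by (simp add: im_quat_def)

lemma Re_quat_conj: "norm b = 1 \<Longrightarrow> Re (fst (quat_conj b x)) = Re (fst x)"
  using orthogonal_transformation_inner[OF orthogonal_quat_conj, of b x "(1, 0)"]
  by (cases x; cases "quat_conj b x") (simp add: quat_conj_one inner_quat)

lemma quat_rotation_apply: "quat_rotation b *v v = im_coords (quat_conj b (im_quat v))"
proof -
  have "linear (\<lambda>v. im_coords (quat_conj b (im_quat v)))"
    using linear_compose[OF linear_compose[OF linear_im(1) linear_quat_conj] linear_im(2)]
    by (simp add: o_def)
  then show ?thesis
    unfolding quat_rotation_def by (rule matrix_vector_mul(2)[THEN fun_cong])
qed

lemma im_quat_rotation:
  "norm b = 1 \<Longrightarrow> im_quat (quat_rotation b *v v) = quat_conj b (im_quat v)"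
  by (simp add: quat_rotation_apply im_quat_im_coords Re_quat_conj)

lemma quat_rotation_mult:
  assumes "norm a = 1" "norm b = 1"
  shows "quat_rotation (quat_mult a b) = quat_rotation a ** quat_rotation b"
  unfolding matrix_eq matrix_vector_mul_assoc[symmetric]
  by (simp add: quat_rotation_apply[of "quat_mult a b"] quat_conj_mult)
    (simp add: quat_rotation_apply im_quat_im_coords Re_quat_conj assms)

lemma orthogonal_quat_rotation:
  assumes "norm b = 1"
  shows "orthogonal_matrix (quat_rotation b)"
proof -
  have "norm (quat_rotation b *v v) = norm v" for v
    using norm_im_quat[of "quat_rotation b *v v"] assms
      orthogonal_transformation_norm[OF orthogonal_quat_conj]
    by (simp add: im_quat_rotation norm_im_quat)
  then have "orthogonal_transformation ((*v) (quat_rotation b))"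
    by (simp add: orthogonal_transformation matrix_vector_mul_linear)
  then show ?thesis
    by (simp add: orthogonal_transformation_matrix)
qed

text \<open>Every unit quaternion is a square, so its rotation has determinant \<open>1\<close>.\<close>

lemma quat_square_root:
  assumes b: "norm b = 1"
  obtains c where "norm c = 1" "quat_mult c c = b"
proof (cases "b = (- 1, 0)")
  case True
  show ?thesis by (rule that[of "(\<i>, 0)"]) (simp_all add: norm_Pair True)
next
  case False
  obtain b0 b1 where b01: "b = (b0, b1)" by (cases b)
  define r where "r = Re b0"
  have n: "(cmod b0)\<^sup>2 + (cmod b1)\<^sup>2 = 1"
    using b by (simp add: b01 norm_Pair real_sqrt_eq_1_iff)
  have n0: "r\<^sup>2 + (Im b0)\<^sup>2 + (cmod b1)\<^sup>2 = 1"
    using n by (simp add: cmod_power2 r_def)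
  have "r \<noteq> -1"
  proof
    assume "r = -1"
    then have "(Im b0)\<^sup>2 + (cmod b1)\<^sup>2 = 0" using n0 by simp
    then have "Im b0 = 0" "b1 = 0" by (simp_all add: sum_power2_eq_zero_iff)
    then show False using False \<open>r = -1\<close> by (simp add: b01 r_def complex_eq_iff)
  qed
  have "r\<^sup>2 \<le> 1" using n0 by (smt (verit) zero_le_power2)
  then have r: "r > -1" using \<open>r \<noteq> -1\<close> by (simp add: abs_square_le_1)
  define t where "t = 1 / sqrt (2 + 2 * r)"
  have t: "t\<^sup>2 * (2 + 2 * r) = 1"
    using r by (simp add: t_def power_divide)
  define c where "c = t *\<^sub>R (1 + b0, b1)"
  have e0: "(1 + b0) * (1 + b0) - b1 * cnj b1 = (2 + 2 * of_real r) * b0"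
  proof -
    have "b0 * cnj b0 + b1 * cnj b1 = 1"
      using n by (metis complex_norm_square of_real_1 of_real_add)
    moreover have "b0 + cnj b0 = 2 * of_real r"
      by (simp add: complex_add_cnj r_def)
    ultimately show ?thesis by algebra
  qed
  have e1: "(1 + b0) * b1 + b1 * cnj (1 + b0) = (2 + 2 * of_real r) * b1"
  proof -
    have "b0 + cnj b0 = 2 * of_real r"
      by (simp add: complex_add_cnj r_def)
    then show ?thesis by (simp del: of_real_mult) algebra
  qed
  have "quat_mult c c = (t\<^sup>2) *\<^sub>R quat_mult (1 + b0, b1) (1 + b0, b1)"
    by (simp add: c_def quat_mult_eq scaleR_conv_of_real power2_eq_square algebra_simps)
  also have "\<dots> = (t\<^sup>2 * (2 + 2 * r)) *\<^sub>R b"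
    unfolding quat_mult.simps e0 e1 by (simp add: b01 scaleR_conv_of_real algebra_simps)
  finally have cc: "quat_mult c c = b" by (simp add: t)
  have "norm c * norm c = 1"
    using norm_quat_mult[of c c] b cc by simp
  then have "norm c = 1"
    by (metis norm_ge_zero power2_eq_1_iff power2_eq_square neg_0_le_iff_le not_one_le_zero)
  with cc show ?thesis using that by blast
qed

lemma rotation_quat_rotation:
  assumes "norm b = 1"
  shows "rotation_matrix (quat_rotation b)"
proof -
  obtain c where c: "norm c = 1" "quat_mult c c = b" using quat_square_root[OF assms] .
  have "det (quat_rotation c) = 1 \<or> det (quat_rotation c) = -1"
    using det_orthogonal_matrix[OF orthogonal_quat_rotation[OF c(1)]] by simp
  then have "det (quat_rotation b) = 1"
    using quat_rotation_mult[OF c(1) c(1)] c(2) by (auto simp: det_mul)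
  then show ?thesis
    using orthogonal_quat_rotation[OF assms] by (simp add: rotation_matrix_def)
qed

text \<open>Extended by the identity on the real axis, \<open>A\<close> is a conjugation, possibly after quaternion conjugation;
  the latter acts by \<open>-1\<close> on imaginary quaternions and would make the determinant negative.\<close>

lemma quat_rotation_surj:
  assumes A: "rotation_matrix A"
  obtains b where "norm b = 1" "quat_rotation b = A"
proof -
  define T where "T x = (of_real (Re (fst x)), 0) + im_quat (A *v im_coords x)" for x
  have oA: "orthogonal_transformation ((*v) A)" and dA: "det A = 1"
    using A by (auto simp: rotation_matrix_def orthogonal_transformation_matrix)
  have "linear (\<lambda>x. im_quat (A *v im_coords x))"
    using linear_compose[OF linear_compose[OF linear_im(2) matrix_vector_mul_linear] linear_im(1)]
    by (simp add: o_def)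
  moreover have "linear (\<lambda>x::complex \<times> complex. (complex_of_real (Re (fst x)), 0::complex))"
    by (auto intro!: linearI simp: scaleR_conv_of_real)
  ultimately have linT: "linear T"
    unfolding T_def[abs_def] by (intro linear_compose_add)
  have n: "(norm ((complex_of_real r, 0) + im_quat v))\<^sup>2 = r\<^sup>2 + (norm v)\<^sup>2" for r v
    by (simp add: im_quat_def norm_Pair cmod_power2 norm_vec_def L2_set_def sum_3)
  have "norm (T x) = norm x" for x
  proof -
    have x: "x = (of_real (Re (fst x)), 0) + im_quat (im_coords x)"
      by (simp add: im_quat_def prod_eq_iff complex_eq_iff)
    have "(norm (T x))\<^sup>2 = (Re (fst x))\<^sup>2 + (norm (im_coords x))\<^sup>2"
      unfolding T_def n using orthogonal_transformation_norm[OF oA] by simp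
    also have "\<dots> = (norm x)\<^sup>2" using n[of "Re (fst x)" "im_coords x"] x by metis
    finally show ?thesis by simp
  qed
  then have T: "orthogonal_transformation T"
    using linT by (simp add: orthogonal_transformation)
  have "im_coords (1, 0) = 0" by (simp add: vec_eq_iff forall_3)
  then have "T (1, 0) = (1, 0)"
    by (simp add: T_def im_quat_def zero_complex.code)
  with T obtain b where b: "norm b = 1"
    "(\<forall>x. T x = quat_conj b x) \<or> (\<forall>x. T x = quat_conj b (quat_cnj x))"
    by (rule orthogonal_fixing_one)
  have imA: "A *v v = im_coords (T (im_quat v))" for v
    unfolding T_def im_coords_im_quat by (simp add: vec_eq_iff forall_3 im_quat_def)
  from b(2) show ?thesis
  proof
    assume "\<forall>x. T x = quat_conj b x"
    then have "T x = quat_conj b x" for x by blast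
    then have "quat_rotation b = A"
      unfolding matrix_eq by (simp add: imA quat_rotation_apply)
    then show ?thesis using that b(1) by blast
  next
    assume "\<forall>x. T x = quat_conj b (quat_cnj x)"
    then have *: "T x = quat_conj b (quat_cnj x)" for x by blast
    have "quat_cnj (im_quat v) = - im_quat v" for v
      by (simp add: quat_cnj_def im_quat_def complex_eq_iff)
    then have "A *v v = - (quat_rotation b *v v)" for v
      by (simp add: imA quat_rotation_apply * linear_neg[OF linear_quat_conj] linear_neg[OF linear_im(2)])
    moreover have "(- quat_rotation b) *v v = - (quat_rotation b *v v)" for v
      by (simp add: vec_eq_iff matrix_vector_mult_def sum_negf)
    ultimately have "A = - quat_rotation b"
      unfolding matrix_eq by simp
    then have "det A = - det (quat_rotation b)"
      by (simp add: det_3)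
    then show ?thesis
      using dA rotation_quat_rotation[OF b(1)] by (simp add: rotation_matrix_def)
  qed
qed

lemma quat_commute_real:
  assumes "norm b = 1" "quat_conj b (\<i>, 0) = (\<i>, 0)" "quat_conj b (0, 1) = (0, 1)"
  shows "b = (1, 0) \<or> b = (- 1, 0)"
proof -
  have c: "quat_mult b x = quat_mult x b" if "quat_conj b x = x" for x
    using arg_cong[OF that, of "\<lambda>y. quat_mult y b"] assms(1)
    by (simp add: quat_conj_def quat_mult_assoc quat_mult_cnj)
  obtain b0 b1 where b: "b = (b0, b1)" by (cases b)
  have "b1 = 0" using c[OF assms(2)] by (simp add: b complex_eq_iff)
  moreover have "Im b0 = 0" using c[OF assms(3)] by (simp add: b complex_eq_iff)
  moreover have "cmod b0 = 1" using assms(1) \<open>b1 = 0\<close> by (simp add: b norm_Pair)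
  ultimately show ?thesis
    by (auto simp: b complex_eq_iff cmod_def real_sqrt_eq_1_iff power2_eq_1_iff)
qed

lemma quat_rotation_eq_one_iff:
  assumes "norm b = 1"
  shows "quat_rotation b = mat 1 \<longleftrightarrow> b = (1, 0) \<or> b = (- 1, 0)"
proof
  assume 1: "quat_rotation b = mat 1"
  have "quat_conj b x = x" if "Re (fst x) = 0" for x
    using im_quat_rotation[OF assms, of "im_coords x"] that by (simp add: 1 im_quat_im_coords)
  then show "b = (1, 0) \<or> b = (- 1, 0)"
    using quat_commute_real[OF assms] by simp
qed (auto simp: matrix_eq quat_rotation_apply quat_conj_def quat_cnj_def quat_mult_eq
    vec_eq_iff forall_3 im_quat_def)

lemma continuous_on_quat_rotation: "continuous_on A quat_rotation"
proof -
  have "quat_rotation b $ i $ j = im_coords (quat_conj b (im_quat (axis j 1))) $ i" for b i j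
    by (simp add: quat_rotation_apply[symmetric] matrix_vector_mult_basis column_def)
  then have eq: "quat_rotation = (\<lambda>b. \<chi> i j. im_coords (quat_conj b (im_quat (axis j 1))) $ i)"
    by (simp add: fun_eq_iff vec_eq_iff)
  have "continuous_on A (\<lambda>b. im_coords (quat_conj b (im_quat v)))" for v
    unfolding quat_conj_def
    by (intro linear_continuous_on_compose[OF _ linear_im(2)] continuous_intros)
  then show ?thesis
    by (subst eq) (intro continuous_on_vec_lambda continuous_on_component)
qed

lemma quotient_hom_quat_rotation:
  "quotient_hom S3_group (special_orthogonal_group :: (real^3^3) topgroup) quat_rotation"
proof (rule quotient_hom_compact[OF compact_S3_group])
  show "quat_rotation \<in> hom S3_group special_orthogonal_group"
    by (rule homI) (simp_all add: special_orthogonal_group_def S3_iff_norm rotation_quat_rotation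
        quat_rotation_mult)
  show surj: "quat_rotation ` carrier S3_group = carrier special_orthogonal_group"
    using rotation_quat_rotation quat_rotation_surj
    by (force simp: special_orthogonal_group_def S3_iff_norm)
  show "continuous_map (gtopology S3_group) (gtopology special_orthogonal_group) quat_rotation"
    by (simp add: special_orthogonal_group_def continuous_map_in_subtopology
        continuous_on_quat_rotation S3_iff_norm rotation_quat_rotation image_subset_iff)
qed (auto simp: special_orthogonal_group_def Hausdorff_space_subtopology)

section \<open>Isometries of a lens space lift to orthogonal maps\<close>

text \<open>For every \<open>v\<close> the normalization of \<open>x0 + t v\<close> is close to \<open>x0\<close> when \<open>t\<close> is small.\<close>

lemma span_sphere_neighbourhood:
  fixes x0 :: "'a::real_normed_vector"
  assumes "norm x0 = 1" "e > 0"
  shows "span (sphere 0 1 \<inter> ball x0 e) = UNIV"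
proof -
  let ?S = "span (sphere 0 1 \<inter> ball x0 e)"
  have x0: "x0 \<in> ?S" using assms by (intro span_base) auto
  have "v \<in> ?S" for v
  proof -
    have "((\<lambda>t. (x0 + t *\<^sub>R v) /\<^sub>R norm (x0 + t *\<^sub>R v)) \<longlongrightarrow> (x0 + 0 *\<^sub>R v) /\<^sub>R norm (x0 + 0 *\<^sub>R v)) (at (0::real))"
      using assms by (intro tendsto_intros) auto
    then have "((\<lambda>t. (x0 + t *\<^sub>R v) /\<^sub>R norm (x0 + t *\<^sub>R v)) \<longlongrightarrow> x0) (at (0::real))"
      using assms by simp
    then have 1: "\<forall>\<^sub>F t in at (0::real). dist ((x0 + t *\<^sub>R v) /\<^sub>R norm (x0 + t *\<^sub>R v)) x0 < min e 1"
      using assms by (intro tendstoD) auto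
    have "\<forall>\<^sub>F t in at (0::real). t \<noteq> 0"
      by (rule eventually_neq_at_within)
    with 1 have "\<forall>\<^sub>F t in at (0::real). dist ((x0 + t *\<^sub>R v) /\<^sub>R norm (x0 + t *\<^sub>R v)) x0 < min e 1 \<and> t \<noteq> 0"
      by (rule eventually_conj)
    then obtain t :: real where t: "dist ((x0 + t *\<^sub>R v) /\<^sub>R norm (x0 + t *\<^sub>R v)) x0 < min e 1" "t \<noteq> 0"
      using eventually_happens[of _ "at (0::real)"] by auto
    define y where "y = x0 + t *\<^sub>R v"
    have "y \<noteq> 0" using t assms by (auto simp: y_def)
    then have "y /\<^sub>R norm y \<in> ?S"
      using t by (intro span_base) (auto simp: y_def dist_commute)
    then have "norm y *\<^sub>R (y /\<^sub>R norm y) \<in> ?S" by (rule span_mul)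
    then have "y \<in> ?S" using \<open>y \<noteq> 0\<close> by simp
    then have "inverse t *\<^sub>R (y - x0) \<in> ?S" using x0 by (intro span_mul span_diff)
    then show ?thesis using t by (simp add: y_def)
  qed
  then show ?thesis by auto
qed

lemma linear_eq_on_spanning:
  assumes "linear f" "linear g" "span S = UNIV" "\<And>x. x \<in> S \<Longrightarrow> f x = g x"
  shows "f x = g x"
  using linear_eq_on[OF assms(1,2), of x S] assms(3,4) by simp

lemma linear_inner: 
  assumes "linear T" shows "linear (\<lambda>x. T x \<bullet> c)" "linear (\<lambda>x. c \<bullet> T x)"
  by (auto intro!: linearI simp: linear_add[OF assms] linear_scale[OF assms] inner_simps)

text \<open>The linear extension from a basis inside \<open>S\<close> pairs with \<open>g s\<close> like the identity pairs with \<open>s\<close>, by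
  linearity; hence it preserves inner products and its distance from \<open>g\<close> on \<open>S\<close> is zero.\<close>

lemma inner_preserving_extends:
  fixes g :: "'a::real_inner \<Rightarrow> 'a"
  assumes S: "span S = UNIV" and g: "\<And>x y. x \<in> S \<Longrightarrow> y \<in> S \<Longrightarrow> g x \<bullet> g y = x \<bullet> y"
  obtains T where "orthogonal_transformation T" "\<And>x. x \<in> S \<Longrightarrow> T x = g x"
proof -
  obtain B where B: "B \<subseteq> S" "independent B" "S \<subseteq> span B"
    using maximal_independent_subset[of S] by blast
  have spanB: "span B = UNIV"
    using S span_mono[OF B(3)] by (simp add: span_span top.extremum_unique)
  obtain T where T: "linear T" "\<And>x. x \<in> B \<Longrightarrow> T x = g x"
    using linear_independent_extend[OF B(2), of g] by blast
  have id: "linear (\<lambda>x::'a. x)" by (simp add: linear_iff)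
  have 1: "T x \<bullet> g s = x \<bullet> s" if s: "s \<in> S" for x s
    by (rule linear_eq_on_spanning[OF linear_inner(1)[OF T(1)] linear_inner(1)[OF id] spanB])
      (use T g B s in auto)
  have 2: "T x \<bullet> T y = x \<bullet> y" for x y
    by (rule linear_eq_on_spanning[OF linear_inner(2)[OF T(1)] linear_inner(2)[OF id] spanB])
      (use T 1 B in auto)
  have "T s = g s" if "s \<in> S" for s
  proof -
    have "(T s - g s) \<bullet> (T s - g s) = 0"
      using 1[OF that, of s] 2[of s s] g[OF that that]
      by (simp add: inner_diff_left inner_diff_right inner_commute[of "g s" "T s"])
    then show ?thesis by simp
  qed
  moreover have "orthogonal_transformation T"
    using T 2 by (simp add: orthogonal_transformation_def)
  ultimately show ?thesis using that by blast
qed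

lemma dist_sphere_inner:
  fixes x y :: "'a::real_inner"
  assumes "norm x = 1" "norm y = 1"
  shows "(dist x y)\<^sup>2 = 2 - 2 * (x \<bullet> y)"
  using assms by (simp add: dist_norm power2_norm_eq_inner inner_diff_left inner_diff_right
      inner_commute[of y x] norm_eq_1)

definition lens_root :: "nat \<Rightarrow> complex" where
  "lens_root m = exp (2 * of_real pi * \<i> / of_nat m)"

lemma norm_lens_root [simp]: "cmod (lens_root m) = 1"
  by (simp add: lens_root_def norm_exp_eq_Re)

lemma lens_root_power: "lens_root m ^ k = exp (2 * of_real pi * \<i> * of_nat k / of_nat m)"
  by (simp add: lens_root_def exp_of_nat_mult[symmetric] mult_ac)

lemma lens_rotation_eq: "lens_rotation m q (z, w) = (lens_root m * z, lens_root m ^ q * w)"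
  by (simp add: lens_rotation_def lens_root_def Let_def)

lemma lens_rotation_funpow:
  "(lens_rotation m q ^^ k) (z, w) = (lens_root m ^ k * z, lens_root m ^ (q * k) * w)"
  by (induction k) (simp_all add: lens_rotation_eq power_add)

lemma linear_lens_rotation_funpow: "linear (lens_rotation m q ^^ k)"
  by (rule linearI) (auto simp: lens_rotation_funpow algebra_simps scaleR_conv_of_real)

lemma orthogonal_lens_rotation_funpow: "orthogonal_transformation (lens_rotation m q ^^ k)"
  by (simp add: orthogonal_transformation_def linear_lens_rotation_funpow lens_rotation_funpow_inner)

definition deck_map :: "nat \<Rightarrow> nat \<Rightarrow> (complex \<times> complex \<Rightarrow> complex \<times> complex) \<Rightarrow> bool" where
  "deck_map m q T \<longleftrightarrow> (\<exists>k. \<forall>x. T x = (lens_rotation m q ^^ k) x)"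

definition normalizes_deck :: "nat \<Rightarrow> nat \<Rightarrow> (complex \<times> complex \<Rightarrow> complex \<times> complex) \<Rightarrow> bool" where
  "normalizes_deck m q T \<longleftrightarrow> (\<exists>k. \<forall>x. T (lens_rotation m q x) = (lens_rotation m q ^^ k) (T x))"

lemma normalizes_funpow:
  assumes "\<And>x. T (r x) = (r ^^ k) (T x)"
  shows "T ((r ^^ j) x) = (r ^^ (k * j)) (T x)"
  by (induction j) (simp_all add: assms funpow_add)

lemma normalizes_deck_compose:
  assumes "normalizes_deck m q S" "normalizes_deck m q T"
  shows "normalizes_deck m q (S \<circ> T)"
proof -
  obtain k l where k: "\<And>x. S (lens_rotation m q x) = (lens_rotation m q ^^ k) (S x)"
    and l: "\<And>x. T (lens_rotation m q x) = (lens_rotation m q ^^ l) (T x)"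
    using assms by (auto simp: normalizes_deck_def)
  have "(S \<circ> T) (lens_rotation m q x) = (lens_rotation m q ^^ (k * l)) ((S \<circ> T) x)" for x
    using normalizes_funpow[of S, OF k, of l "T x"] by (simp add: l)
  then show ?thesis unfolding normalizes_deck_def by blast
qed

lemma normalizes_deck_funpow:
  assumes "normalizes_deck m q S"
  shows "normalizes_deck m q (S ^^ n)"
proof (induction n)
  case 0
  show ?case unfolding normalizes_deck_def by (rule exI[of _ 1]) simp
next
  case (Suc n)
  then show ?case using normalizes_deck_compose[OF assms] by (simp only: funpow.simps)
qed

locale lens =
  fixes m q :: nat
  assumes m: "m \<ge> 1" and coprime: "coprime m q"
begin

abbreviation "rot \<equiv> lens_rotation m q"
abbreviation "orb \<equiv> lens_orbit m q"
abbreviation "L \<equiv> lens_orbit m q ` S3"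

lemma lens_root_power_eq_1: "lens_root m ^ k = 1 \<longleftrightarrow> m dvd k"
  using complex_root_unity_eq_1[OF m] by (simp add: lens_root_power)

lemma lens_root_power_eq: "lens_root m ^ j = lens_root m ^ k \<longleftrightarrow> [j = k] (mod m)"
  using complex_root_unity_eq[OF m] by (simp add: lens_root_power cong_def)

lemma root_of_unity_iff: "z ^ m = 1 \<longleftrightarrow> (\<exists>k. z = lens_root m ^ k)"
proof
  assume "z ^ m = 1"
  then have "z \<in> {exp(2 * of_real pi * \<i> * of_nat j / of_nat m) | j. j < m}"
    using complex_roots_unity[OF m] by blast
  then show "\<exists>k. z = lens_root m ^ k"
    by (auto simp: lens_root_power)
next
  assume "\<exists>k. z = lens_root m ^ k"
  then obtain k where "z = lens_root m ^ k" ..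
  then show "z ^ m = 1"
    using lens_root_power_eq_1 by (simp add: power_mult[symmetric])
qed

lemma orb_iff: "y \<in> orb x \<longleftrightarrow> (\<exists>k. y = (rot ^^ k) x)"
  by (auto simp: lens_orbit_def)

lemma orb_eq_iff: "orb y = orb x \<longleftrightarrow> y \<in> orb x"
  using lens_orbit_eq[OF m] lens_orbit_self by blast

lemma orb_in_L: "x \<in> S3 \<Longrightarrow> orb x \<in> L" by blast

text \<open>Since \<open>q\<close> is prime to \<open>m\<close>, a nontrivial deck transformation multiplies both coordinates by roots of
  unity different from \<open>1\<close>, and there are finitely many of them.\<close>

lemma deck_gap_exists: "\<exists>\<delta>>0. \<forall>x\<in>S3. \<forall>y\<in>orb x. y \<noteq> x \<longrightarrow> \<delta> \<le> dist x y"
proof -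
  define F where "F = insert 1 ((\<lambda>k. min (cmod (lens_root m ^ k - 1)) (cmod (lens_root m ^ (q * k) - 1))) ` {0<..<m})"
  define \<delta> where "\<delta> = Min F"
  have F: "finite F" "F \<noteq> {}" by (auto simp: F_def)
  have ne: "lens_root m ^ k \<noteq> 1" "lens_root m ^ (q * k) \<noteq> 1" if "k \<in> {0<..<m}" for k
  proof -
    have "\<not> m dvd k" using that by (auto dest: dvd_imp_le)
    moreover from this have "\<not> m dvd q * k" using coprime by (simp add: coprime_dvd_mult_right_iff)
    ultimately show "lens_root m ^ k \<noteq> 1" "lens_root m ^ (q * k) \<noteq> 1"
      by (simp_all add: lens_root_power_eq_1)
  qed
  have "\<delta> > 0"
    unfolding \<delta>_def using F ne by (subst Min_gr_iff) (auto simp: F_def)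
  moreover have "\<delta> \<le> dist x y" if x: "x \<in> S3" and y: "y \<in> orb x" "y \<noteq> x" for x y
  proof -
    obtain k where k: "y = (rot ^^ k) x" using y by (auto simp: orb_iff)
    define j where "j = k mod m"
    have yj: "y = (rot ^^ j) x"
      unfolding k j_def by (rule funpow_periodic_mod) (rule lens_rotation_funpow_period[OF m])
    have "j \<noteq> 0" using y yj by (intro notI) simp
    then have j: "j \<in> {0<..<m}" using m by (simp add: j_def)
    obtain z w where zw: "x = (z, w)" by (cases x)
    have le: "\<delta> \<le> cmod (lens_root m ^ j - 1)" "\<delta> \<le> cmod (lens_root m ^ (q * j) - 1)"
      using Min_le[OF F(1), of "min (cmod (lens_root m ^ j - 1)) (cmod (lens_root m ^ (q * j) - 1))"] j
      by (auto simp: \<delta>_def F_def)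
    have "\<delta>\<^sup>2 = \<delta>\<^sup>2 * ((cmod z)\<^sup>2 + (cmod w)\<^sup>2)"
      using x by (simp add: zw S3_def)
    also have "\<dots> \<le> (cmod (lens_root m ^ j - 1))\<^sup>2 * (cmod z)\<^sup>2 + (cmod (lens_root m ^ (q * j) - 1))\<^sup>2 * (cmod w)\<^sup>2"
      unfolding distrib_left using le \<open>\<delta> > 0\<close> by (intro add_mono mult_right_mono power_mono) auto
    also have "\<dots> = (cmod ((lens_root m ^ j - 1) * z))\<^sup>2 + (cmod ((lens_root m ^ (q * j) - 1) * w))\<^sup>2"
      by (simp add: norm_mult power_mult_distrib)
    also have "\<dots> = (dist x y)\<^sup>2"
      unfolding dist_commute[of x] by (simp add: yj zw lens_rotation_funpow dist_norm norm_Pair algebra_simps)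
    finally show ?thesis by (rule power2_le_imp_le) simp
  qed
  ultimately show ?thesis by blast
qed

definition gap :: real where
  "gap = (SOME \<delta>. \<delta> > 0 \<and> (\<forall>x\<in>S3. \<forall>y\<in>orb x. y \<noteq> x \<longrightarrow> \<delta> \<le> dist x y))"

lemma gap_pos: "gap > 0" and gap: "x \<in> S3 \<Longrightarrow> y \<in> orb x \<Longrightarrow> dist x y < gap \<Longrightarrow> y = x"
proof -
  have "gap > 0 \<and> (\<forall>x\<in>S3. \<forall>y\<in>orb x. y \<noteq> x \<longrightarrow> gap \<le> dist x y)"
    unfolding gap_def by (rule someI_ex) (use deck_gap_exists in blast)
  then show "gap > 0" "x \<in> S3 \<Longrightarrow> y \<in> orb x \<Longrightarrow> dist x y < gap \<Longrightarrow> y = x" by force+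
qed

lemma inner_S3_abs: "x \<in> S3 \<Longrightarrow> y \<in> S3 \<Longrightarrow> \<bar>x \<bullet> y\<bar> \<le> 1"
  using Cauchy_Schwarz_ineq2[of x y] by (simp add: S3_iff_norm)

lemma arccos_inner_eq:
  assumes "x \<in> S3" "y \<in> S3" "x' \<in> S3" "y' \<in> S3" "arccos (x \<bullet> y) = arccos (x' \<bullet> y')"
  shows "x \<bullet> y = x' \<bullet> y'"
  using assms arccos_eq_iff[of "x \<bullet> y" "x' \<bullet> y'"] inner_S3_abs[of x y] inner_S3_abs[of x' y'] by simp

lemma orb_S3: "x \<in> S3 \<Longrightarrow> y \<in> orb x \<Longrightarrow> y \<in> S3"
  using lens_orbit_subset_S3 by blast

lemma L_member_S3: "A \<in> L \<Longrightarrow> x \<in> A \<Longrightarrow> x \<in> S3"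
  using orb_S3 by blast

lemma L_member_orb: "A \<in> L \<Longrightarrow> x \<in> A \<Longrightarrow> A = orb x"
  using orb_eq_iff by blast

text \<open>The nearest point of the second orbit can only be \<open>y\<close>: any other one is at distance at least the gap from \<open>y\<close>.\<close>

lemma lens_dist_near:
  assumes x: "x \<in> S3" and y: "y \<in> S3" and near: "dist x y < gap / 2"
  shows "lens_dist (orb x) (orb y) = arccos (x \<bullet> y)"
proof -
  obtain y' where y': "y' \<in> orb y" "lens_dist (orb x) (orb y) = arccos (x \<bullet> y')"
    using lens_dist_attained[OF m orb_in_L[OF x] orb_in_L[OF y] lens_orbit_self] .
  have yS: "y' \<in> S3" using y y' orb_S3 by blast
  have "arccos (x \<bullet> y') \<le> arccos (x \<bullet> y)"
    using lens_dist_le[OF m orb_in_L[OF x] orb_in_L[OF y] lens_orbit_self lens_orbit_self] y' by simp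
  then have "x \<bullet> y \<le> x \<bullet> y'"
    using arccos_le_mono inner_S3_abs x y yS by blast
  then have "(dist x y')\<^sup>2 \<le> (dist x y)\<^sup>2"
    using x y yS by (simp add: dist_sphere_inner S3_iff_norm)
  then have "dist x y' \<le> dist x y" by simp
  then have "dist y y' < gap"
    using near dist_triangle2[of y y' x] dist_commute[of y x] by (simp add: dist_commute)
  then have "y' = y" using gap[OF y y'(1)] by blast
  then show ?thesis using y' by simp
qed

lemma isom_group_carrier:
  "carrier (isom_group (lens_space m q)) =
     {f \<in> Bij L. \<forall>A\<in>L. \<forall>B\<in>L. lens_dist (f A) (f B) = lens_dist A B}"
proof -
  have "f A \<in> L" if "f \<in> Bij L" "A \<in> L" for f A
    using that Bij_imp_funcset by blast
  then show ?thesis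
    by (auto simp: isom_group_def Let_def mspace_lens_space[OF m] mdist_lens_space[OF m])
qed

lemma isom_closed:
  assumes "f \<in> carrier (isom_group (lens_space m q))" "A \<in> L"
  shows "f A \<in> L"
proof -
  have "f \<in> Bij L" using assms(1) unfolding isom_group_carrier by blast
  then show ?thesis using Bij_imp_funcset assms(2) by (metis funcset_mem)
qed

text \<open>Near \<open>x0\<close> the isometry is a distance preserving map between small balls of the sphere, and
  such a map preserves inner products.\<close>

lemma local_lift:
  assumes f: "f \<in> carrier (isom_group (lens_space m q))" and x0: "x0 \<in> S3" and y0: "y0 \<in> f (orb x0)"
  obtains T where "orthogonal_transformation T" "T x0 = y0"
    "\<And>x. x \<in> S3 \<Longrightarrow> dist x0 x < gap / 4 \<Longrightarrow> T x \<in> f (orb x)"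
proof -
  have fL: "f A \<in> L" if "A \<in> L" for A
    using isom_closed[OF f that] .
  have fd: "lens_dist (f A) (f B) = lens_dist A B" if "A \<in> L" "B \<in> L" for A B
    using that f unfolding isom_group_carrier by blast
  have y0S: "y0 \<in> S3" using L_member_S3[OF fL[OF orb_in_L[OF x0]] y0] .
  let ?S = "S3 \<inter> ball x0 (gap / 4)"
  have "\<exists>y. y \<in> f (orb x) \<and> y0 \<bullet> y = x0 \<bullet> x" if x: "x \<in> ?S" for x
  proof -
    have xS: "x \<in> S3" and d: "dist x0 x < gap / 4" using x by auto
    obtain y where y: "y \<in> f (orb x)" "lens_dist (f (orb x0)) (f (orb x)) = arccos (y0 \<bullet> y)"
      using lens_dist_attained[OF m fL[OF orb_in_L[OF x0]] fL[OF orb_in_L[OF xS]] y0] .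
    have "lens_dist (orb x0) (orb x) = arccos (x0 \<bullet> x)"
      using lens_dist_near[OF x0 xS] d gap_pos by simp
    then have "arccos (y0 \<bullet> y) = arccos (x0 \<bullet> x)"
      using y(2) fd[OF orb_in_L[OF x0] orb_in_L[OF xS]] by simp
    then have "y0 \<bullet> y = x0 \<bullet> x"
      using arccos_inner_eq[OF y0S L_member_S3[OF fL[OF orb_in_L[OF xS]] y(1)] x0 xS] by blast
    then show ?thesis using y by blast
  qed
  then obtain g where g: "\<And>x. x \<in> ?S \<Longrightarrow> g x \<in> f (orb x)" "\<And>x. x \<in> ?S \<Longrightarrow> y0 \<bullet> g x = x0 \<bullet> x"
    by metis
  have gS: "g x \<in> S3" if "x \<in> ?S" for x
    using L_member_S3[OF fL[OF orb_in_L] g(1)[OF that]] that by simp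
  have dg: "dist y0 (g x) < gap / 4" if x: "x \<in> ?S" for x
  proof -
    have "(dist y0 (g x))\<^sup>2 = (dist x0 x)\<^sup>2"
      using g(2)[OF x] gS[OF x] y0S x0 x by (simp add: dist_sphere_inner S3_iff_norm)
    then show ?thesis using x by simp
  qed
  have inner: "g x \<bullet> g y = x \<bullet> y" if x: "x \<in> ?S" and y: "y \<in> ?S" for x y
  proof -
    have "dist x y < gap / 2"
      using x y dist_triangle3[of x y x0] by (auto)
    then have 1: "lens_dist (orb x) (orb y) = arccos (x \<bullet> y)"
      using lens_dist_near[of x y] x y by simp
    have "dist (g x) (g y) < gap / 2"
      using dg[OF x] dg[OF y] dist_triangle3[of "g x" "g y" y0] by auto
    then have "lens_dist (orb (g x)) (orb (g y)) = arccos (g x \<bullet> g y)"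
      using lens_dist_near[OF gS[OF x] gS[OF y]] by blast
    moreover have "orb (g x) = f (orb x)" "orb (g y) = f (orb y)"
      using L_member_orb[OF fL[OF orb_in_L] g(1)[OF x]] L_member_orb[OF fL[OF orb_in_L] g(1)[OF y]] x y
      by simp_all
    ultimately have "arccos (g x \<bullet> g y) = arccos (x \<bullet> y)"
      using fd[OF orb_in_L orb_in_L, of x y] x y 1 by simp
    then show ?thesis
      using arccos_inner_eq[OF gS[OF x] gS[OF y]] x y by simp
  qed
  have "span ?S = UNIV"
    using span_sphere_neighbourhood[of x0 "gap / 4"] x0 gap_pos by (simp add: S3_iff_norm S3_eq_sphere)
  then obtain T where T: "orthogonal_transformation T" "\<And>x. x \<in> ?S \<Longrightarrow> T x = g x"
    by (rule inner_preserving_extends[OF _ inner]) (assumption | rule that)+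
  have x0S: "x0 \<in> ?S" using x0 gap_pos by simp
  have "(dist y0 (g x0))\<^sup>2 = 0"
    using g(2)[OF x0S] gS[OF x0S] y0S x0 by (simp add: dist_sphere_inner S3_iff_norm norm_eq_1)
  then have Tx0: "T x0 = y0" using T(2)[OF x0S] by simp
  have Tf: "T x \<in> f (orb x)" if "x \<in> S3" "dist x0 x < gap / 4" for x
    using T(2)[of x] g(1)[of x] that by simp
  show ?thesis using T(1) Tx0 Tf by (rule that)
qed

text \<open>Distinct points of one orbit are a definite distance apart, so two orthogonal maps that agree
  at a point and up to deck transformations nearby agree near that point, hence everywhere.\<close>

lemma same_orbit_eq:
  assumes T: "orthogonal_transformation T" and T': "orthogonal_transformation T'"
    and x0: "x0 \<in> S3" and eq: "T x0 = T' x0" and e: "e > 0"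
    and orb: "\<And>x. x \<in> S3 \<Longrightarrow> dist x0 x < e \<Longrightarrow> T' x \<in> orb (T x)"
  shows "T = T'"
proof
  fix v
  let ?S = "S3 \<inter> ball x0 (min e (gap / 2))"
  have eqS: "T x = T' x" if "x \<in> ?S" for x
  proof -
    have x: "x \<in> S3" "dist x0 x < e" "dist x0 x < gap / 2" using that by auto
    have "dist (T x0) (T x) = dist x0 x" "dist (T' x0) (T' x) = dist x0 x"
      using orthogonal_transformation_isometry T T' by blast+
    then have "dist (T x) (T' x) < gap"
      using x dist_triangle3[of "T x" "T' x" "T x0"] eq by simp
    moreover have "T x \<in> S3"
      using x orthogonal_transformation_norm[OF T] by (simp add: S3_iff_norm)
    ultimately show ?thesis using gap[OF _ orb[OF x(1,2)]] by simp
  qed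
  have span: "span ?S = UNIV"
    using span_sphere_neighbourhood[of x0 "min e (gap / 2)"] x0 e gap_pos
    by (simp add: S3_iff_norm S3_eq_sphere)
  show "T v = T' v"
    by (rule linear_eq_on_spanning[where f = T and g = T', OF orthogonal_transformation_linear[OF T]
        orthogonal_transformation_linear[OF T'] span]) (rule eqS)
qed

lemma same_orbit_deck:
  assumes T: "orthogonal_transformation T" and T': "orthogonal_transformation T'"
    and orb: "\<And>x. x \<in> S3 \<Longrightarrow> T' x \<in> orb (T x)"
  shows "\<exists>k. \<forall>x. T' x = (rot ^^ k) (T x)"
proof -
  have x0: "(1, 0) \<in> S3" by (simp add: S3_def)
  obtain k where k: "T' (1, 0) = (rot ^^ k) (T (1, 0))"
    using orb[OF x0] by (auto simp: orb_iff)
  have "rot ^^ k \<circ> T = T'"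
  proof (rule same_orbit_eq[OF _ T' x0 _ zero_less_one])
    show "orthogonal_transformation (rot ^^ k \<circ> T)"
      by (intro orthogonal_transformation_compose orthogonal_lens_rotation_funpow T)
    show "T' x \<in> orb ((rot ^^ k \<circ> T) x)" if "x \<in> S3" for x
    proof -
      have "orb ((rot ^^ k \<circ> T) x) = orb (T x)"
        by (subst orb_eq_iff) (auto simp: orb_iff)
      then show ?thesis using orb[OF that] by simp
    qed
  qed (use k in simp)
  then have "\<forall>x. T' x = (rot ^^ k) (T x)" by auto
  then show ?thesis by (rule exI)
qed

text \<open>The points near which the orthogonal map \<open>T\<close> lifts \<open>f\<close> form an open and closed subset of the connected
  sphere. Once \<open>T\<close> lifts \<open>f\<close> everywhere, so does its composition with a deck transformation, and two
  lifts differ by a deck transformation.\<close>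

lemma isometry_lift:
  assumes f: "f \<in> carrier (isom_group (lens_space m q))"
  obtains T where "orthogonal_transformation T" "normalizes_deck m q T"
    "\<And>x. x \<in> S3 \<Longrightarrow> f (orb x) = orb (T x)"
proof -
  have fL: "f A \<in> L" if "A \<in> L" for A
    using isom_closed[OF f that] .
  have x0: "(1, 0) \<in> S3" by (simp add: S3_def)
  obtain y0 where y0': "f (orb (1, 0)) = orb y0"
    using fL[OF orb_in_L[OF x0]] by (rule imageE)
  have y0: "y0 \<in> f (orb (1, 0))"
    unfolding y0' by (rule lens_orbit_self)
  obtain T where T: "orthogonal_transformation T"
    and near: "\<And>x. x \<in> S3 \<Longrightarrow> dist (1, 0) x < gap / 4 \<Longrightarrow> T x \<in> f (orb x)"
    by (rule local_lift[OF f x0 y0], rule that)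
  define P where "P x \<longleftrightarrow> (\<forall>z\<in>S3. dist x z < gap / 4 \<longrightarrow> T z \<in> f (orb z))" for x
  \<comment> \<open>The local lift at \<open>x\<close> has a radius independent of \<open>x\<close>, and it agrees with \<open>T\<close>.\<close>
  have grow: "P x" if x: "x \<in> S3" and e: "e > 0" and
    loc: "\<And>z. z \<in> S3 \<Longrightarrow> dist x z < e \<Longrightarrow> T z \<in> f (orb z)" for x e
  proof -
    have Tx: "T x \<in> f (orb x)" using loc x e by simp
    obtain T' where T': "orthogonal_transformation T'" "T' x = T x"
      "\<And>z. z \<in> S3 \<Longrightarrow> dist x z < gap / 4 \<Longrightarrow> T' z \<in> f (orb z)"
      by (rule local_lift[OF f x Tx], rule that)
    have "T = T'"
    proof (rule same_orbit_eq[OF T T'(1) x])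
      show "min e (gap / 4) > 0" using e gap_pos by simp
      fix z assume z: "z \<in> S3" "dist x z < min e (gap / 4)"
      then have "T z \<in> f (orb z)" "T' z \<in> f (orb z)" using loc T'(3) by auto
      then show "T' z \<in> orb (T z)" using L_member_orb[OF fL[OF orb_in_L[OF z(1)]], of "T z"] by simp
    qed (use T' in simp)
    then show ?thesis using T'(3) by (simp add: P_def)
  qed
  have "P x" if "x \<in> S3" for x
  proof (rule connected_induction_simple[of S3 "(1, 0)" x P])
    show "connected S3" by (simp add: S3_eq_sphere connected_sphere)
    show "P (1, 0)" using near by (simp add: P_def)
    fix a assume a: "a \<in> S3"
    have step: "P y" if "x \<in> S3 \<inter> ball a (gap / 16)" "y \<in> S3 \<inter> ball a (gap / 16)" "P x" for x y
    proof (rule grow)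
      show "y \<in> S3" using that by simp
      show "gap / 16 > 0" using gap_pos by simp
      fix z assume z: "z \<in> S3" "dist y z < gap / 16"
      have "dist x z \<le> dist a x + dist a y + dist y z"
        using dist_triangle3[of x z a] dist_triangle[of a z y] by linarith
      then have "dist x z < gap / 4" using z that gap_pos by auto
      then show "T z \<in> f (orb z)" using \<open>P x\<close> z by (simp add: P_def)
    qed
    have "openin (top_of_set S3) (S3 \<inter> ball a (gap / 16))" by (rule openin_open_Int) simp
    moreover have "a \<in> S3 \<inter> ball a (gap / 16)" using a gap_pos by simp
    moreover have "\<forall>x \<in> S3 \<inter> ball a (gap / 16). \<forall>y \<in> S3 \<inter> ball a (gap / 16). P x \<longrightarrow> P y"
      using step by blast
    ultimately show "\<exists>U. openin (top_of_set S3) U \<and> a \<in> U \<and> (\<forall>x\<in>U. \<forall>y\<in>U. P x \<longrightarrow> P y)"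
      by blast
  qed (use that x0 in simp_all)
  then have "T x \<in> f (orb x)" if "x \<in> S3" for x
    using that gap_pos by (auto simp: P_def)
  then have eq: "f (orb x) = orb (T x)" if "x \<in> S3" for x
    using that L_member_orb[OF fL[OF orb_in_L[OF that]]] by simp
  have rS: "rot x \<in> S3" if "x \<in> S3" for x
    using orthogonal_transformation_norm[OF orthogonal_lens_rotation_funpow[where m = m and q = q and k = 1], of x] that
    by (simp add: S3_iff_norm)
  have tr: "(T \<circ> rot) x \<in> orb (T x)" if x: "x \<in> S3" for x
  proof -
    have "rot x = (rot ^^ 1) x" by simp
    then have "orb (rot x) = orb x"
      unfolding orb_eq_iff orb_iff by (rule exI)
    then have "orb (T (rot x)) = orb (T x)" using eq[OF x] eq[OF rS[OF x]] by simp
    then show ?thesis using lens_orbit_self[of "T (rot x)" m q] by simp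
  qed
  have "orthogonal_transformation (T \<circ> rot)"
    using orthogonal_transformation_compose[OF T orthogonal_lens_rotation_funpow[where m = m and q = q and k = 1]] by simp
  from same_orbit_deck[OF T this tr] have "normalizes_deck m q T"
    by (simp add: normalizes_deck_def)
  with T show ?thesis using eq by (rule that)
qed

end

subsection \<open>The isometry group as a quotient of a group of orthogonal maps\<close>

text \<open>A compact group that maps onto the normalizer of the deck group. The isometry group is the quotient of
  \<open>K\<close> by the elements that act as deck transformations.\<close>

locale lens_action = lens +
  fixes K :: "'k topgroup" and act :: "'k \<Rightarrow> complex \<times> complex \<Rightarrow> complex \<times> complex"
  assumes K: "compact_topgroup K"
    and orthogonal: "\<And>k. k \<in> carrier K \<Longrightarrow> orthogonal_transformation (act k)"
    and act_mult: "\<And>k l. k \<in> carrier K \<Longrightarrow> l \<in> carrier K \<Longrightarrow> act (k \<otimes>\<^bsub>K\<^esub> l) = act k \<circ> act l"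
    and normalizes: "\<And>k. k \<in> carrier K \<Longrightarrow> normalizes_deck m q (act k)"
    and continuous: "\<And>x. continuous_map (gtopology K) euclidean (\<lambda>k. act k x)"
    and complete: "\<And>T. orthogonal_transformation T \<Longrightarrow> normalizes_deck m q T \<Longrightarrow> \<exists>k \<in> carrier K. T = act k"
begin

abbreviation "G \<equiv> isom_group (lens_space m q)"

definition induced :: "'k \<Rightarrow> (complex \<times> complex) set \<Rightarrow> (complex \<times> complex) set" where
  "induced k = (\<lambda>A\<in>L. \<Union>x\<in>A. orb (act k x))"

lemma group_K: "group K" using K by (simp add: compact_topgroup_def)

lemma act_one: "act \<one>\<^bsub>K\<^esub> x = x"
proof -
  interpret group K by (rule group_K)
  have "act \<one>\<^bsub>K\<^esub> \<circ> act \<one>\<^bsub>K\<^esub> = act \<one>\<^bsub>K\<^esub>"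
    using act_mult[of "\<one>\<^bsub>K\<^esub>" "\<one>\<^bsub>K\<^esub>"] by simp
  then have "act \<one>\<^bsub>K\<^esub> (act \<one>\<^bsub>K\<^esub> x) = act \<one>\<^bsub>K\<^esub> x" by (metis comp_apply)
  moreover have "inj (act \<one>\<^bsub>K\<^esub>)"
    using orthogonal_transformation_inj orthogonal one_closed by blast
  ultimately show ?thesis by (simp add: inj_eq)
qed

lemma act_S3: "k \<in> carrier K \<Longrightarrow> x \<in> S3 \<Longrightarrow> act k x \<in> S3"
  using orthogonal_transformation_norm[OF orthogonal] by (simp add: S3_iff_norm)

lemma act_orb:
  assumes k: "k \<in> carrier K" and y: "y \<in> orb x"
  shows "orb (act k y) = orb (act k x)"
proof -
  obtain j where j: "\<And>x. act k (rot x) = (rot ^^ j) (act k x)"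
    using normalizes[OF k] by (auto simp: normalizes_deck_def)
  obtain i where i: "y = (rot ^^ i) x" using y by (auto simp: orb_iff)
  have "act k y = (rot ^^ (j * i)) (act k x)"
    unfolding i by (rule normalizes_funpow) (rule j)
  then show ?thesis unfolding orb_eq_iff orb_iff by (rule exI)
qed

lemma induced_orb:
  assumes "k \<in> carrier K" "x \<in> S3"
  shows "induced k (orb x) = orb (act k x)"
proof -
  have "induced k (orb x) = (\<Union>y\<in>orb x. orb (act k y))"
    using assms by (simp add: induced_def)
  also have "\<dots> = (\<Union>y\<in>orb x. orb (act k x))"
    using act_orb[OF assms(1)] by (intro SUP_cong) auto
  also have "\<dots> = orb (act k x)" using lens_orbit_self[of x m q] by auto
  finally show ?thesis .
qed

lemma induced_dist_le:
  assumes k: "k \<in> carrier K" and x: "x \<in> S3" and y: "y \<in> S3"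
  shows "lens_dist (orb (act k x)) (orb (act k y)) \<le> lens_dist (orb x) (orb y)"
proof -
  obtain y' where y': "y' \<in> orb y" "lens_dist (orb x) (orb y) = arccos (x \<bullet> y')"
    using lens_dist_attained[OF m orb_in_L[OF x] orb_in_L[OF y] lens_orbit_self] .
  have "act k y' \<in> orb (act k y)"
    using act_orb[OF k y'(1)] lens_orbit_self[of "act k y'" m q] by simp
  from lens_dist_le[OF m orb_in_L[OF act_S3[OF k x]] orb_in_L[OF act_S3[OF k y]] lens_orbit_self this]
  show ?thesis by (simp add: y'(2) orthogonal_transformation_inner[OF orthogonal[OF k]])
qed

lemma act_inverse:
  assumes k: "k \<in> carrier K"
  shows "act (inv\<^bsub>K\<^esub> k) (act k x) = x" "act k (act (inv\<^bsub>K\<^esub> k) x) = x"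
proof -
  interpret group K by (rule group_K)
  show "act (inv\<^bsub>K\<^esub> k) (act k x) = x"
    using fun_cong[OF act_mult[of "inv\<^bsub>K\<^esub> k" k], of x] k act_one[of x] by simp
  show "act k (act (inv\<^bsub>K\<^esub> k) x) = x"
    using fun_cong[OF act_mult[of k "inv\<^bsub>K\<^esub> k"], of x] k act_one[of x] by simp
qed

lemma inv_K: "k \<in> carrier K \<Longrightarrow> inv\<^bsub>K\<^esub> k \<in> carrier K"
  using group.inv_closed[OF group_K] .

lemma induced_closed:
  assumes k: "k \<in> carrier K"
  shows "induced k \<in> carrier G"
proof -
  note k' = inv_K[OF k]
  have maps: "induced l A \<in> L" if "l \<in> carrier K" "A \<in> L" for l A
    using that(2) induced_orb[OF that(1)] act_S3[OF that(1)] by auto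
  have inv1: "induced (inv\<^bsub>K\<^esub> k) (induced k A) = A" if "A \<in> L" for A
    using that by (auto simp: induced_orb k k' act_S3 act_inverse)
  have inv2: "induced k (induced (inv\<^bsub>K\<^esub> k) A) = A" if "A \<in> L" for A
    using that by (auto simp: induced_orb k k' act_S3 act_inverse)
  have "bij_betw (induced k) L L"
    by (rule bij_betw_byWitness[of _ "induced (inv\<^bsub>K\<^esub> k)"])
      (use inv1 inv2 maps[OF k] maps[OF k'] in \<open>simp_all add: image_subset_iff\<close>)
  then have "induced k \<in> Bij L"
    by (simp add: Bij_def induced_def)
  moreover have "lens_dist (induced k A) (induced k B) = lens_dist A B" if AB: "A \<in> L" "B \<in> L" for A B
  proof -
    obtain x y where xy: "x \<in> S3" "A = orb x" "y \<in> S3" "B = orb y"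
      using AB by auto
    show ?thesis
      using induced_dist_le[OF k xy(1,3)] induced_dist_le[OF k' act_S3[OF k xy(1)] act_S3[OF k xy(3)]]
      by (simp add: xy induced_orb k act_inverse)
  qed
  ultimately show ?thesis unfolding isom_group_carrier by blast
qed

lemma isom_mult: "f \<otimes>\<^bsub>G\<^esub> g = compose L f g"
  by (simp add: isom_group_def Let_def mspace_lens_space[OF m])

lemma isom_extensional: "f \<in> carrier G \<Longrightarrow> f \<in> extensional L"
  unfolding isom_group_carrier using Bij_imp_extensional by blast

lemma isom_eqI:
  assumes "f \<in> carrier G" "g \<in> carrier G" "\<And>x. x \<in> S3 \<Longrightarrow> f (orb x) = g (orb x)"
  shows "f = g"
  by (rule extensionalityI[OF isom_extensional[OF assms(1)] isom_extensional[OF assms(2)]])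
    (use assms(3) in auto)

lemma induced_hom: "induced \<in> hom K G"
proof (rule homI)
  fix k l assume kl: "k \<in> carrier K" "l \<in> carrier K"
  have klc: "k \<otimes>\<^bsub>K\<^esub> l \<in> carrier K"
    using monoid.m_closed[OF group.is_monoid[OF group_K] kl] .
  have "compose L (induced k) (induced l) \<in> carrier G"
    using monoid.m_closed[OF group.is_monoid[OF group_isom_group] induced_closed[OF kl(1)] induced_closed[OF kl(2)]]
    by (simp add: isom_mult)
  then show "induced (k \<otimes>\<^bsub>K\<^esub> l) = induced k \<otimes>\<^bsub>G\<^esub> induced l"
    unfolding isom_mult
    by (rule isom_eqI[OF induced_closed[OF klc]])
      (simp add: compose_def induced_orb kl klc act_S3 act_mult)
qed (rule induced_closed)

lemma induced_surj: "induced ` carrier K = carrier G"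
proof (intro equalityI subsetI)
  fix f assume f: "f \<in> carrier G"
  obtain T where T: "orthogonal_transformation T" "normalizes_deck m q T"
    "\<And>x. x \<in> S3 \<Longrightarrow> f (orb x) = orb (T x)"
    by (rule isometry_lift[OF f], rule that)
  obtain k where k: "k \<in> carrier K" "T = act k" using complete[OF T(1,2)] by blast
  have "f = induced k"
    by (rule isom_eqI[OF f induced_closed[OF k(1)]]) (simp add: T(3) induced_orb k)
  then show "f \<in> induced ` carrier K" using k by blast
qed (use induced_closed in blast)

lemma induced_kernel:
  assumes k: "k \<in> carrier K"
  shows "induced k = induced \<one>\<^bsub>K\<^esub> \<longleftrightarrow> deck_map m q (act k)"
proof -
  have one: "\<one>\<^bsub>K\<^esub> \<in> carrier K"
    using monoid.one_closed[OF group.is_monoid[OF group_K]] .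
  have "induced k = induced \<one>\<^bsub>K\<^esub> \<longleftrightarrow> (\<forall>x\<in>S3. orb (act k x) = orb x)"
  proof
    assume "induced k = induced \<one>\<^bsub>K\<^esub>"
    then show "\<forall>x\<in>S3. orb (act k x) = orb x"
      using induced_orb[OF k] induced_orb[OF one] by (simp add: act_one)
  next
    assume "\<forall>x\<in>S3. orb (act k x) = orb x"
    then show "induced k = induced \<one>\<^bsub>K\<^esub>"
      by (intro isom_eqI[OF induced_closed[OF k] induced_closed[OF one]])
        (simp add: induced_orb k one act_one)
  qed
  also have "\<dots> \<longleftrightarrow> deck_map m q (act k)"
  proof
    assume *: "\<forall>x\<in>S3. orb (act k x) = orb x"
    have "act k x \<in> orb (id x)" if "x \<in> S3" for x
      using * that by (simp add: orb_eq_iff)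
    from same_orbit_deck[OF orthogonal_transformation_id[folded id_def] orthogonal[OF k] this]
    show "deck_map m q (act k)" by (simp add: deck_map_def)
  next
    assume "deck_map m q (act k)"
    then obtain j where j: "\<And>x. act k x = (rot ^^ j) x" by (auto simp: deck_map_def)
    show "\<forall>x\<in>S3. orb (act k x) = orb x"
      unfolding orb_eq_iff orb_iff j by blast
  qed
  finally show ?thesis .
qed

lemma mspace_L: "mspace (lens_space m q) = L"
  by (rule mspace_lens_space[OF m])

lemma lens_dist_le_pi:
  assumes "A \<in> L" "B \<in> L"
  shows "lens_dist A B \<le> pi"
proof -
  obtain x y where xy: "x \<in> S3" "A = orb x" "y \<in> S3" "B = orb y"
    using assms by auto
  have "lens_dist A B \<le> arccos (x \<bullet> y)"
    using lens_dist_le[OF m assms] xy lens_orbit_self by simp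
  also have "\<dots> \<le> pi"
    using inner_S3_abs[OF xy(1,3)] by (intro arccos_ubound) auto
  finally show ?thesis .
qed

lemma isom_in_cfunspace:
  assumes f: "f \<in> carrier G"
  shows "f \<in> mspace (cfunspace (mtopology_of (lens_space m q)) (lens_space m q))"
proof -
  let ?M = "lens_space m q"
  have fL: "f A \<in> L" if "A \<in> L" for A using isom_closed[OF f that] .
  have fd: "lens_dist (f A) (f B) = lens_dist A B" if "A \<in> L" "B \<in> L" for A B
    using that f unfolding isom_group_carrier by blast
  have md: "mdist ?M A B = lens_dist A B" if "A \<in> L" "B \<in> L" for A B
    using mdist_lens_space[OF m that] .
  have "Lipschitz_continuous_map ?M ?M f"
    unfolding Lipschitz_continuous_map_def mspace_L
    by (intro conjI exI[of _ 1] ballI) (simp_all add: fL md fd)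
  then have "continuous_map (mtopology_of ?M) (mtopology_of ?M) f"
    by (rule Lipschitz_continuous_imp_continuous_map)
  moreover have "Metric_space.mbounded (mspace ?M) (mdist ?M) (f ` L)"
    unfolding Metric_space.mbounded_alt[OF Metric_space_mspace_mdist]
    unfolding mspace_L
    by (intro conjI exI[of _ pi] ballI) (auto simp: fL md lens_dist_le_pi)
  ultimately show ?thesis
    using isom_extensional[OF f] fL by (simp add: mspace_L)
qed

lemma gtopology_isom:
  "gtopology G = subtopology (mtopology_of (cfunspace (mtopology_of (lens_space m q)) (lens_space m q))) (carrier G)"
  by (simp add: isom_group_def Let_def)

lemma topspace_isom: "topspace (gtopology G) = carrier G"
  unfolding gtopology_isom using isom_in_cfunspace by auto

lemma Hausdorff_isom: "Hausdorff_space (gtopology G)"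
  unfolding gtopology_isom mtopology_of_def
  by (intro Hausdorff_space_subtopology Metric_space.Hausdorff_space_mtopology Metric_space_mspace_mdist)

text \<open>Makes closeness at the finitely many basis vectors imply uniform closeness on the sphere, which is what
  the topology of the isometry group measures.\<close>

lemma linear_dist_le_Basis:
  fixes S T :: "complex \<times> complex \<Rightarrow> complex \<times> complex"
  assumes S: "linear S" and T: "linear T" and x: "norm x = 1"
  shows "dist (S x) (T x) \<le> (\<Sum>b\<in>Basis. norm (S b - T b))"
proof -
  have "S x - T x = S (\<Sum>b\<in>Basis. (x \<bullet> b) *\<^sub>R b) - T (\<Sum>b\<in>Basis. (x \<bullet> b) *\<^sub>R b)"
    by (simp only: euclidean_representation)
  also have "\<dots> = (\<Sum>b\<in>Basis. (x \<bullet> b) *\<^sub>R (S b - T b))"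
    unfolding linear_sum[OF S] linear_sum[OF T]
    by (simp only: linear_scale[OF S] linear_scale[OF T] scaleR_diff_right sum_subtractf)
  finally have "dist (S x) (T x) = norm (\<Sum>b\<in>Basis. (x \<bullet> b) *\<^sub>R (S b - T b))"
    by (simp only: dist_norm)
  also have "\<dots> \<le> (\<Sum>b\<in>Basis. norm (S b - T b))"
  proof (rule sum_norm_le)
    fix b :: "complex \<times> complex" assume "b \<in> Basis"
    then have "\<bar>x \<bullet> b\<bar> \<le> 1" using Basis_le_norm[of b x] x by simp
    then show "norm ((x \<bullet> b) *\<^sub>R (S b - T b)) \<le> norm (S b - T b)"
      by (simp add: mult_left_le_one_le)
  qed
  finally show ?thesis .
qed

lemma induced_continuous: "continuous_map (gtopology K) (gtopology G) induced"
proof -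
  let ?M = "lens_space m q"
  let ?C = "cfunspace (mtopology_of ?M) ?M"
  have top: "topspace (gtopology K) = carrier K" using K by (simp add: compact_topgroup_def)
  have eq: "mtopology_of ?C = Metric_space.mtopology (mspace ?C) (mdist ?C)"
    by (simp only: mtopology_of_def)
  have "continuous_map (gtopology K) (mtopology_of ?C) induced"
    unfolding eq Metric_space.continuous_map_to_metric[OF Metric_space_mspace_mdist] top
  proof (intro ballI allI impI)
    fix k and \<epsilon> :: real assume k: "k \<in> carrier K" and "\<epsilon> > 0"
    define e where "e = min (\<epsilon> / 2) (pi / 2)"
    have e: "0 < e" "e < \<epsilon>" "e < pi" "e \<le> pi" using \<open>\<epsilon> > 0\<close> pi_gt_zero by (auto simp: e_def min_def)
    define d where "d = sqrt (2 * (1 - cos e))"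
    have "cos e < cos 0" using e by (intro cos_monotone_0_pi) auto
    then have d: "d > 0" "d\<^sup>2 = 2 - 2 * cos e" by (auto simp: d_def)
    define h where "h l = (\<Sum>b\<in>Basis. norm (act l b - act k b))" for l
    have "continuous_map (gtopology K) euclidean h"
      unfolding h_def[abs_def]
      by (intro continuous_map_sum continuous_map_norm continuous_map_diff continuous) auto
    from openin_continuous_map_preimage[OF this, of "{..<d}"]
    have U: "openin (gtopology K) {l \<in> carrier K. h l < d}" by (simp add: top)
    have kU: "k \<in> {l \<in> carrier K. h l < d}" using k d by (simp add: h_def)
    have "induced l \<in> Metric_space.mball (mspace ?C) (mdist ?C) (induced k) \<epsilon>"
      if l: "l \<in> {l \<in> carrier K. h l < d}" for l
    proof -
      have lK: "l \<in> carrier K" and hl: "h l < d" using l by auto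
      have "mdist ?M (induced k A) (induced l A) \<le> e" if "A \<in> L" for A
      proof -
        obtain x where x: "x \<in> S3" "A = orb x" using \<open>A \<in> L\<close> by auto
        have "dist (act l x) (act k x) \<le> h l"
          unfolding h_def using orthogonal[OF lK] orthogonal[OF k] x
          by (intro linear_dist_le_Basis) (auto simp: orthogonal_transformation_linear S3_iff_norm)
        then have "(dist (act k x) (act l x))\<^sup>2 \<le> d\<^sup>2"
          using hl by (intro power_mono) (auto simp: dist_commute)
        then have "cos e \<le> act k x \<bullet> act l x"
          using dist_sphere_inner[of "act k x" "act l x"] act_S3[OF k x(1)] act_S3[OF lK x(1)] d
          by (simp add: S3_iff_norm)
        moreover have "\<bar>act k x \<bullet> act l x\<bar> \<le> 1"
          using inner_S3_abs act_S3[OF k x(1)] act_S3[OF lK x(1)] by blast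
        ultimately have "arccos (act k x \<bullet> act l x) \<le> arccos (cos e)"
          by (intro arccos_le_arccos) auto
        also have "\<dots> = e" using e by (intro arccos_cos) auto
        finally have "arccos (act k x \<bullet> act l x) \<le> e" .
        moreover have "lens_dist (orb (act k x)) (orb (act l x)) \<le> arccos (act k x \<bullet> act l x)"
          by (rule lens_dist_le[OF m orb_in_L[OF act_S3[OF k x(1)]] orb_in_L[OF act_S3[OF lK x(1)]]
                lens_orbit_self lens_orbit_self])
        ultimately show ?thesis
          using mdist_lens_space[OF m orb_in_L[OF act_S3[OF k x(1)]] orb_in_L[OF act_S3[OF lK x(1)]]]
          by (simp add: x induced_orb k lK)
      qed
      then have "mdist ?C (induced k) (induced l) \<le> e"
        using e by (intro mdist_cfunspace_le) (auto simp: mspace_L)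
      then show ?thesis
        unfolding Metric_space.in_mball[OF Metric_space_mspace_mdist]
        using isom_in_cfunspace[OF induced_closed[OF k]] isom_in_cfunspace[OF induced_closed[OF lK]] e
        by (simp del: mspace_cfunspace)
    qed
    then show "\<exists>U. openin (gtopology K) U \<and> k \<in> U \<and>
        (\<forall>l\<in>U. induced l \<in> Metric_space.mball (mspace ?C) (mdist ?C) (induced k) \<epsilon>)"
      using U kU by blast
  qed
  then show ?thesis
    unfolding gtopology_isom continuous_map_in_subtopology
    using induced_closed by (auto simp: top)
qed

theorem isom_group_iso:
  assumes "quotient_hom K H p"
    and "\<And>k. k \<in> carrier K \<Longrightarrow> p k = p \<one>\<^bsub>K\<^esub> \<longleftrightarrow> deck_map m q (act k)"
  shows "topgroup_iso (isom_group (lens_space m q)) H"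
  by (rule topgroup_iso_common_cover[OF K assms(1) induced_hom induced_continuous induced_surj
        topspace_isom Hausdorff_isom]) (simp add: assms(2) induced_kernel)

theorem isom_pi0_iso:
  fixes D :: "'d monoid"
  assumes "c \<in> hom K D" "c ` carrier K = carrier D"
    "continuous_map (gtopology K) (discrete_topology (carrier D)) c"
    "\<And>d. d \<in> carrier D \<Longrightarrow> path_connectedin (gtopology K) {k \<in> carrier K. c k = d}"
    and "\<And>k. k \<in> carrier K \<Longrightarrow> deck_map m q (act k) \<Longrightarrow> c k = c \<one>\<^bsub>K\<^esub>"
  shows "isom_pi0 (lens_space m q) \<cong> D"
  unfolding isom_pi0_def
  by (rule pi0_group_labelling[OF K induced_hom induced_continuous induced_surj
        topspace_isom Hausdorff_isom assms(1-4)]) (simp_all add: assms(5) induced_kernel)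

end

section \<open>Actions of products\<close>

lemma orthogonal_transformation_funpow:
  fixes T :: "'a::real_inner \<Rightarrow> 'a"
  assumes "orthogonal_transformation T"
  shows "orthogonal_transformation (T ^^ n)"
proof (induction n)
  case 0
  show ?case by (simp only: funpow.simps id_def orthogonal_transformation_id)
next
  case (Suc n)
  then show ?case using orthogonal_transformation_compose[OF assms] by (simp only: funpow.simps)
qed

lemma continuous_map_Times_euclidean:
  assumes "continuous_on (A \<times> B) f"
  shows "continuous_map (prod_topology (top_of_set A) (top_of_set B)) euclidean f"
  using assms by simp

context lens
begin

lemma lens_action_semidirect:
  assumes N: "compact_topgroup N" and \<phi>: "cyclic_action N k \<phi>"
    and act: "\<And>x y. x \<in> carrier N \<Longrightarrow> y \<in> carrier N \<Longrightarrow> act (x \<otimes>\<^bsub>N\<^esub> y) = act x \<circ> act y"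
    and \<sigma>: "\<And>x. x \<in> carrier N \<Longrightarrow> \<sigma> \<circ> act x = act (\<phi> x) \<circ> \<sigma>"
    and per: "\<And>z. (\<sigma> ^^ k) z = z"
    and orth: "\<And>x. x \<in> carrier N \<Longrightarrow> orthogonal_transformation (act x)" "orthogonal_transformation \<sigma>"
    and norm: "\<And>x. x \<in> carrier N \<Longrightarrow> normalizes_deck m q (act x)" "normalizes_deck m q \<sigma>"
    and cont: "\<And>z. continuous_map (gtopology N) euclidean (\<lambda>x. act x z)"
    and complete: "\<And>T. orthogonal_transformation T \<Longrightarrow> normalizes_deck m q T \<Longrightarrow>
        \<exists>x \<in> carrier N. \<exists>j < k. T = act x \<circ> \<sigma> ^^ j"
  shows "lens_action m q (semidirect_cyclic N k \<phi>) (\<lambda>(x, n). act x \<circ> \<sigma> ^^ nat n)"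
proof
  have k: "k > 0" and cl: "\<And>x. x \<in> carrier N \<Longrightarrow> \<phi> x \<in> carrier N"
    using \<phi> by (auto simp: cyclic_action_def hom_def)
  show "compact_topgroup (semidirect_cyclic N k \<phi>)"
    using N \<phi> by (rule compact_topgroup_semidirect)
  show "(case g \<otimes>\<^bsub>semidirect_cyclic N k \<phi>\<^esub> h of (x, n) \<Rightarrow> act x \<circ> \<sigma> ^^ nat n) =
      (case g of (x, n) \<Rightarrow> act x \<circ> \<sigma> ^^ nat n) \<circ> (case h of (x, n) \<Rightarrow> act x \<circ> \<sigma> ^^ nat n)"
    if g: "g \<in> carrier (semidirect_cyclic N k \<phi>)" and h: "h \<in> carrier (semidirect_cyclic N k \<phi>)" for g h
    using semidirect_action[where act = act and \<sigma> = \<sigma>, OF act \<sigma> per k cl g h] by simp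
  fix g assume g: "g \<in> carrier (semidirect_cyclic N k \<phi>)"
  obtain x n where xn: "g = (x, n)" "x \<in> carrier N" using g by auto
  show "orthogonal_transformation (case g of (x, n) \<Rightarrow> act x \<circ> \<sigma> ^^ nat n)"
    unfolding xn prod.case
    by (intro orthogonal_transformation_compose orthogonal_transformation_funpow orth xn)
  show "normalizes_deck m q (case g of (x, n) \<Rightarrow> act x \<circ> \<sigma> ^^ nat n)"
    unfolding xn prod.case
    by (intro normalizes_deck_compose normalizes_deck_funpow norm xn)
next
  fix z
  show "continuous_map (gtopology (semidirect_cyclic N k \<phi>)) euclidean
          (\<lambda>g. (case g of (x, n) \<Rightarrow> act x \<circ> \<sigma> ^^ nat n) z)"
    unfolding semidirect_cyclic_simps by (rule continuous_map_prod_discrete) (simp add: cont)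
next
  fix T assume "orthogonal_transformation T" "normalizes_deck m q T"
  then obtain x j where "x \<in> carrier N" "j < k" "T = act x \<circ> \<sigma> ^^ j"
    using complete by blast
  then show "\<exists>g \<in> carrier (semidirect_cyclic N k \<phi>). T = (case g of (x, n) \<Rightarrow> act x \<circ> \<sigma> ^^ nat n)"
    by (intro bexI[of _ "(x, int j)"]) (auto simp: carrier_integer_mod_group)
qed

lemma lens_action_prod:
  assumes N: "compact_topgroup N" and M: "compact_topgroup M"
    and act: "\<And>x y. x \<in> carrier N \<Longrightarrow> y \<in> carrier N \<Longrightarrow> a (x \<otimes>\<^bsub>N\<^esub> y) = a x \<circ> a y"
      "\<And>x y. x \<in> carrier M \<Longrightarrow> y \<in> carrier M \<Longrightarrow> b (x \<otimes>\<^bsub>M\<^esub> y) = b x \<circ> b y"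
    and comm: "\<And>x y. b y \<circ> a x = a x \<circ> b y"
    and orth: "\<And>x. x \<in> carrier N \<Longrightarrow> orthogonal_transformation (a x)"
      "\<And>y. y \<in> carrier M \<Longrightarrow> orthogonal_transformation (b y)"
    and norm: "\<And>x. x \<in> carrier N \<Longrightarrow> normalizes_deck m q (a x)"
       "\<And>y. y \<in> carrier M \<Longrightarrow> normalizes_deck m q (b y)"
    and cont: "\<And>z. continuous_map (prod_topology (gtopology N) (gtopology M)) euclidean (\<lambda>(x, y). a x (b y z))"
    and complete: "\<And>T. orthogonal_transformation T \<Longrightarrow> normalizes_deck m q T \<Longrightarrow>
        \<exists>x \<in> carrier N. \<exists>y \<in> carrier M. T = a x \<circ> b y"
  shows "lens_action m q (topgroup_prod N M) (\<lambda>(x, y). a x \<circ> b y)"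
proof
  show "compact_topgroup (topgroup_prod N M)" using N M by (rule compact_topgroup_prod)
  show "(case g \<otimes>\<^bsub>topgroup_prod N M\<^esub> h of (x, y) \<Rightarrow> a x \<circ> b y) =
      (case g of (x, y) \<Rightarrow> a x \<circ> b y) \<circ> (case h of (x, y) \<Rightarrow> a x \<circ> b y)"
    if g: "g \<in> carrier (topgroup_prod N M)" and h: "h \<in> carrier (topgroup_prod N M)" for g h
  proof -
    obtain x y x' y' where gh: "g = (x, y)" "h = (x', y')" "x \<in> carrier N" "y \<in> carrier M"
      "x' \<in> carrier N" "y' \<in> carrier M" using g h by auto
    have "a x \<circ> a x' \<circ> (b y \<circ> b y') = a x \<circ> (b y \<circ> a x') \<circ> b y'"
      unfolding comm by (simp only: comp_assoc)
    then show ?thesis using gh by (simp add: act comp_assoc)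
  qed
  fix g assume "g \<in> carrier (topgroup_prod N M)"
  then obtain x y where xy: "g = (x, y)" "x \<in> carrier N" "y \<in> carrier M" by auto
  show "orthogonal_transformation (case g of (x, y) \<Rightarrow> a x \<circ> b y)"
    unfolding xy prod.case by (intro orthogonal_transformation_compose orth xy)
  show "normalizes_deck m q (case g of (x, y) \<Rightarrow> a x \<circ> b y)"
    unfolding xy prod.case by (intro normalizes_deck_compose norm xy)
next
  fix z
  have "(\<lambda>g. (case g of (x, y) \<Rightarrow> a x \<circ> b y) z) = (\<lambda>(x, y). a x (b y z))" by auto
  then show "continuous_map (gtopology (topgroup_prod N M)) euclidean
          (\<lambda>g. (case g of (x, y) \<Rightarrow> a x \<circ> b y) z)"
    using cont by simp
next
  fix T assume "orthogonal_transformation T" "normalizes_deck m q T"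
  then show "\<exists>g \<in> carrier (topgroup_prod N M). T = (case g of (x, y) \<Rightarrow> a x \<circ> b y)"
    using complete by force
qed

end

lemma quotient_hom_prod:
  assumes K: "compact_topgroup K" "compact_topgroup K'"
    and p: "quotient_hom K H p" "quotient_hom K' H' p'"
    and H: "Hausdorff_space (gtopology H)" "Hausdorff_space (gtopology H')"
  shows "quotient_hom (topgroup_prod K K') (topgroup_prod H H') (\<lambda>(x, y). (p x, p' y))"
proof (rule quotient_hom_compact)
  have hom: "p \<in> hom K H" "p' \<in> hom K' H'"
    and q: "quotient_map (gtopology K) (gtopology H) p" "quotient_map (gtopology K') (gtopology H') p'"
    and top: "topspace (gtopology H) = carrier H" "topspace (gtopology H') = carrier H'"
    using p by (auto simp: quotient_hom_def)
  show "compact_topgroup (topgroup_prod K K')" using K by (rule compact_topgroup_prod)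
  show "(\<lambda>(x, y). (p x, p' y)) \<in> hom (topgroup_prod K K') (topgroup_prod H H')"
    using hom by (auto simp: hom_def)
  show "continuous_map (gtopology (topgroup_prod K K')) (gtopology (topgroup_prod H H')) (\<lambda>(x, y). (p x, p' y))"
    using q by (simp add: continuous_map_prod_top quotient_imp_continuous_map)
  show "(\<lambda>(x, y). (p x, p' y)) ` carrier (topgroup_prod K K') = carrier (topgroup_prod H H')"
    unfolding topgroup_prod_simps quotient_hom_surj[OF p(1), symmetric] quotient_hom_surj[OF p(2), symmetric]
    by auto
  show "topspace (gtopology (topgroup_prod H H')) = carrier (topgroup_prod H H')"
    using top by simp
  show "Hausdorff_space (gtopology (topgroup_prod H H'))"
    using H by (simp add: Hausdorff_space_prod_topology)
qed

lemma mem_C2_iff: "n \<in> carrier (integer_mod_group 2) \<longleftrightarrow> n = 0 \<or> n = 1"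
  by (auto simp: carrier_integer_mod_group)

section \<open>The sphere and projective space\<close>

definition quat_action :: "(complex \<times> complex) \<times> (complex \<times> complex) \<Rightarrow> complex \<times> complex \<Rightarrow> complex \<times> complex" where
  "quat_action = (\<lambda>(a, b) x. quat_mult (quat_mult a x) (quat_cnj b))"

abbreviation S3_squared :: "((complex \<times> complex) \<times> (complex \<times> complex)) topgroup" where
  "S3_squared \<equiv> topgroup_prod S3_group S3_group"

abbreviation S3_wreath :: "(((complex \<times> complex) \<times> (complex \<times> complex)) \<times> int) topgroup" where
  "S3_wreath \<equiv> semidirect_cyclic S3_squared 2 (\<lambda>(a, b). (b, a))"

abbreviation wreath_action ::
  "((complex \<times> complex) \<times> (complex \<times> complex)) \<times> int \<Rightarrow> complex \<times> complex \<Rightarrow> complex \<times> complex" where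
  "wreath_action \<equiv> \<lambda>(x, n). quat_action x \<circ> quat_cnj ^^ nat n"

lemma compact_S3_squared: "compact_topgroup S3_squared"
  using compact_S3_group by (simp add: compact_topgroup_prod)

lemma path_connected_S3: "path_connected_space (top_of_set S3)"
  using path_connected_sphere[of "0 :: complex \<times> complex" 1]
  by (simp add: S3_eq_sphere path_connectedin_topspace[symmetric] path_connectedin_subtopology)

lemma quat_conj_distrib:
  "norm b = 1 \<Longrightarrow> quat_conj b (quat_mult x y) = quat_mult (quat_conj b x) (quat_conj b y)"
  using quat_mult_cnj_cancel[of b] by (simp add: quat_conj_def quat_mult_assoc)

text \<open>The value at \<open>1\<close> gives \<open>a = s b\<close>, so conjugation by \<open>b\<close>, possibly after quaternion conjugation, is the
  identity. The latter is impossible because quaternion conjugation reverses products.\<close>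

lemma quat_action_scalar:
  assumes "norm a = 1" "norm b = 1" "n = 0 \<or> n = 1" "s = 1 \<or> s = -1"
    and act: "\<And>x. wreath_action ((a, b), n) x = s *\<^sub>R x"
  shows "n = 0 \<and> (a = (1, 0) \<or> a = (- 1, 0)) \<and> (b = (1, 0) \<or> b = (- 1, 0))"
proof -
  have cnj1: "quat_cnj (1, 0) = (1, 0)" by (simp add: quat_cnj_def)
  have "quat_mult a (quat_cnj b) = s *\<^sub>R (1, 0)"
    using act[of "(1, 0)"] assms(3) by (auto simp: quat_action_def cnj1)
  then have "quat_mult (quat_mult a (quat_cnj b)) b = s *\<^sub>R b"
    using linear_scale[OF linear_quat_mult(2)[of b], of s "(1, 0)"] by simp
  then have a: "a = s *\<^sub>R b"
    using assms(2) by (simp add: quat_mult_assoc quat_mult_cnj)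
  have conj: "quat_conj b ((quat_cnj ^^ nat n) x) = x" for x
  proof -
    have "s *\<^sub>R quat_conj b ((quat_cnj ^^ nat n) x) = s *\<^sub>R x"
      using act[of x]
      by (simp add: quat_action_def quat_conj_def a linear_scale[OF linear_quat_mult(2)]
          quat_mult_eq algebra_simps)
    then show ?thesis using assms(4) by auto
  qed
  have "n \<noteq> 1"
  proof
    assume "n = 1"
    then have c: "quat_conj b (quat_cnj x) = x" for x using conj by simp
    have neg: "quat_conj b x = - x" if "quat_cnj x = - x" for x
      using c[of "- x"] that linear_neg[OF linear_quat_mult(3)] by simp
    have "quat_conj b (quat_mult (\<i>, 0) (0, 1)) = quat_mult (\<i>, 0) (0, 1)"
      unfolding quat_conj_distrib[OF assms(2)] by (subst (1 2) neg) (simp_all add: quat_cnj_def)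
    moreover have "quat_conj b (0, \<i>) = - (0, \<i>)"
      by (rule neg) (simp add: quat_cnj_def)
    ultimately show False by (simp add: complex_eq_iff)
  qed
  then have "n = 0" using assms(3) by simp
  then have "b = (1, 0) \<or> b = (- 1, 0)"
    using quat_commute_real[OF assms(2)] conj by simp
  with a assms(4) \<open>n = 0\<close> show ?thesis by auto
qed

context lens
begin

text \<open>For \<open>m \<le> 2\<close> the deck transformations are the scalars \<open>\<plusminus>1\<close> or just \<open>1\<close>, so every orthogonal
  map normalizes them.\<close>

lemma lens_action_wreath:
  assumes scalar: "\<And>x. rot x = s *\<^sub>R x"
  shows "lens_action m q S3_wreath wreath_action"
proof (rule lens_action_semidirect[OF compact_S3_squared])
  have norm: "normalizes_deck m q T" if "orthogonal_transformation T" for T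
    unfolding normalizes_deck_def
    using linear_scale[OF orthogonal_transformation_linear[OF that]] by (intro exI[of _ 1]) (simp add: scalar)
  have orth: "orthogonal_transformation (quat_action x)" if x: "x \<in> carrier S3_squared" for x
  proof -
    obtain a b where ab: "x = (a, b)" "norm a = 1" "norm b = 1"
      using x by (cases x) (simp add: S3_iff_norm)
    then show ?thesis using orthogonal_quat_mult[of a "quat_cnj b"] by (simp add: quat_action_def)
  qed
  show "cyclic_action S3_squared 2 (\<lambda>(a, b). (b, a))"
    by (auto simp: cyclic_action_def hom_def numeral_2_eq_2)
  show "quat_action (x \<otimes>\<^bsub>S3_squared\<^esub> y) = quat_action x \<circ> quat_action y" for x y
    by (cases x; cases y) (simp add: quat_action_def fun_eq_iff quat_mult_assoc quat_cnj_mult del: quat_mult.simps)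
  show "quat_cnj \<circ> quat_action x = quat_action (case x of (a, b) \<Rightarrow> (b, a)) \<circ> quat_cnj" for x
    by (cases x) (simp add: quat_action_def fun_eq_iff quat_mult_assoc quat_cnj_mult del: quat_mult.simps)
  show "(quat_cnj ^^ 2) z = z" for z by (simp add: numeral_2_eq_2)
  show "orthogonal_transformation (quat_action x)" "normalizes_deck m q (quat_action x)"
    if "x \<in> carrier S3_squared" for x
    using orth[OF that] norm by blast+
  show "orthogonal_transformation quat_cnj" "normalizes_deck m q quat_cnj"
    using orthogonal_quat_cnj norm by blast+
  show "continuous_map (gtopology S3_squared) euclidean (\<lambda>x. quat_action x z)" for z
    unfolding topgroup_prod_simps S3_group_simps quat_action_def case_prod_beta
    by (intro continuous_map_Times_euclidean continuous_intros)
  fix T :: "complex \<times> complex \<Rightarrow> complex \<times> complex" assume "orthogonal_transformation T"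
  then obtain a b where ab: "norm a = 1" "norm b = 1"
    "(\<forall>x. T x = quat_mult (quat_mult a x) (quat_cnj b)) \<or>
     (\<forall>x. T x = quat_mult (quat_mult a (quat_cnj x)) (quat_cnj b))"
    by (rule orthogonal_quaternion_form)
  from ab(3) have "T = quat_action (a, b) \<circ> quat_cnj ^^ 0 \<or> T = quat_action (a, b) \<circ> quat_cnj ^^ 1"
    by (auto simp: fun_eq_iff quat_action_def simp del: split_paired_All)
  then have "\<exists>j<2. T = quat_action (a, b) \<circ> quat_cnj ^^ j"
    by (metis one_less_numeral_iff pos2 semiring_norm(76))
  then show "\<exists>x\<in>carrier S3_squared. \<exists>j<2. T = quat_action x \<circ> quat_cnj ^^ j"
    using ab by (intro bexI[of _ "(a, b)"]) (auto simp: S3_iff_norm)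
qed

lemma isom_pi0_wreath:
  assumes scalar: "\<And>x. rot x = s *\<^sub>R x" and s: "s = 1 \<or> s = -1"
  shows "isom_pi0 (lens_space m q) \<cong> integer_mod_group 2"
proof -
  interpret lens_action m q S3_wreath wreath_action
    using scalar by (rule lens_action_wreath)
  have pc: "path_connected_space (gtopology S3_squared)"
    using path_connected_S3 by (simp only: topgroup_prod_simps S3_group_simps path_connected_space_prod_topology) simp
  note label = semidirect_label[OF _ compact_S3_squared pc, where k = 2 and \<phi> = "\<lambda>(a, b). (b, a)"]
  show ?thesis
  proof (rule isom_pi0_iso[of snd])
    show "snd \<in> hom S3_wreath (integer_mod_group 2)" "snd ` carrier S3_wreath = carrier (integer_mod_group 2)"
      "continuous_map (gtopology S3_wreath) (discrete_topology (carrier (integer_mod_group 2))) snd"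
      by (rule label; simp)+
    show "path_connectedin (gtopology S3_wreath) {k \<in> carrier S3_wreath. snd k = d}"
      if "d \<in> carrier (integer_mod_group 2)" for d
      using that by (intro label) auto
    fix k assume k: "k \<in> carrier S3_wreath" "deck_map m q (wreath_action k)"
    obtain a b n where abn: "k = ((a, b), n)" "norm a = 1" "norm b = 1" "n = 0 \<or> n = 1"
      using k(1) by (auto simp: S3_iff_norm mem_C2_iff)
    obtain j where j: "\<And>x. wreath_action k x = (rot ^^ j) x" using k(2) by (auto simp: deck_map_def)
    have "(rot ^^ j) x = (s ^ j) *\<^sub>R x" for x
      by (induction j) (simp_all add: scalar)
    then have "wreath_action ((a, b), n) x = (s ^ j) *\<^sub>R x" for x
      using j unfolding abn(1) by simp
    moreover have "s ^ j = 1 \<or> s ^ j = -1" using s by (cases "even j") auto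
    ultimately have "n = 0" using quat_action_scalar[OF abn(2-4)] by blast
    then show "snd k = snd \<one>\<^bsub>S3_wreath\<^esub>" by (simp add: abn)
  qed
qed

end

lemma lens_sphere:
  "topgroup_iso (isom_group (lens_space 1 0)) (orthogonal_group :: (real^4^4) topgroup) \<and>
   isom_pi0 (lens_space 1 0) \<cong> integer_mod_group 2"
proof -
  interpret lens 1 0 by unfold_locales auto
  have scalar: "lens_rotation 1 0 x = 1 *\<^sub>R x" for x
    by (cases x) (simp add: lens_rotation_eq lens_root_def)
  interpret lens_action 1 0 S3_wreath wreath_action
    using scalar by (rule lens_action_wreath)
  obtain f :: "real^4 \<Rightarrow> complex \<times> complex" and g where fg: "linear f" "linear g"
      "\<And>x. norm (f x) = norm x" "\<And>y. norm (g y) = norm y" "\<And>x. g (f x) = x" "\<And>y. f (g y) = y"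
    by (rule isomorphisms_UNIV_UNIV[where 'M = "real^4" and 'N = "complex \<times> complex"]) auto
  define p where "p k = matrix (\<lambda>v. g (wreath_action k (f v)))" for k
  have lin: "linear (\<lambda>v. g (wreath_action k (f v)))" if "k \<in> carrier S3_wreath" for k
    using linear_compose[OF linear_compose[OF fg(1) orthogonal_transformation_linear[OF orthogonal[OF that]]] fg(2)]
    by (simp add: o_def)
  have app: "p k *v v = g (wreath_action k (f v))" if "k \<in> carrier S3_wreath" for k v
    unfolding p_def by (rule matrix_vector_mul(2)[OF lin[OF that], THEN fun_cong])
  have nrm: "norm (wreath_action k x) = norm x" if "k \<in> carrier S3_wreath" for k x
    by (rule orthogonal_transformation_norm[OF orthogonal[OF that]])
  have orthp: "orthogonal_matrix (p k)" if "k \<in> carrier S3_wreath" for k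
  proof -
    have "orthogonal_transformation ((*v) (p k))"
      unfolding orthogonal_transformation by (simp add: matrix_vector_mul_linear app[OF that] fg nrm[OF that])
    then show ?thesis by (simp add: orthogonal_transformation_matrix)
  qed
  have grp: "group S3_wreath" by (rule group_K)
  have "quotient_hom S3_wreath (orthogonal_group :: (real^4^4) topgroup) p"
  proof (rule quotient_hom_compact[OF K])
    show "p \<in> hom S3_wreath orthogonal_group"
    proof (rule homI)
      fix k l assume kl: "k \<in> carrier S3_wreath" "l \<in> carrier S3_wreath"
      have klc: "k \<otimes>\<^bsub>S3_wreath\<^esub> l \<in> carrier S3_wreath"
        using monoid.m_closed[OF group.is_monoid[OF grp] kl] .
      have "p (k \<otimes>\<^bsub>S3_wreath\<^esub> l) = p k ** p l"
        unfolding matrix_eq matrix_vector_mul_assoc[symmetric] app[OF klc] app[OF kl(1)] app[OF kl(2)]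
          act_mult[OF kl] by (simp only: comp_apply fg simp_thms)
      then show "p (k \<otimes>\<^bsub>S3_wreath\<^esub> l) = p k \<otimes>\<^bsub>orthogonal_group\<^esub> p l"
        by (simp add: orthogonal_group_def)
    qed (simp only: orthogonal_group_def partial_object.simps mem_Collect_eq orthp)
    have entry: "p k = (\<chi> i j. g (wreath_action k (f (axis j 1))) $ i)" if "k \<in> carrier S3_wreath" for k
      using app[OF that, symmetric] by (simp add: vec_eq_iff matrix_vector_mult_basis column_def)
    have "continuous_map (gtopology S3_wreath) euclidean (\<lambda>k. \<chi> i j. g (wreath_action k (f (axis j 1))) $ i)"
      unfolding semidirect_cyclic_simps
    proof (rule continuous_map_prod_discrete)
      fix d
      have "continuous_on (S3 \<times> S3) (\<lambda>x. \<chi> i j. g (wreath_action (x, d) (f (axis j 1))) $ i)"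
        unfolding prod.case comp_apply quat_action_def case_prod_beta fst_conv snd_conv
        by (intro continuous_on_vec_lambda continuous_on_component
            linear_continuous_on_compose[OF _ fg(2)] continuous_intros)
      then show "continuous_map (gtopology S3_squared) euclidean
           (\<lambda>x. \<chi> i j. g (wreath_action (x, d) (f (axis j 1))) $ i)"
        unfolding topgroup_prod_simps S3_group_simps by (rule continuous_map_Times_euclidean)
    qed
    then have "continuous_map (gtopology S3_wreath) euclidean p"
      by (rule continuous_map_eq) (use K in \<open>simp add: compact_topgroup_def entry del: semidirect_cyclic_simps\<close>)
    then show "continuous_map (gtopology S3_wreath) (gtopology orthogonal_group) p"
      using K by (auto simp: orthogonal_group_def continuous_map_in_subtopology compact_topgroup_def orthp
          simp del: semidirect_cyclic_simps)
    show "p ` carrier S3_wreath = carrier orthogonal_group"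
    proof (intro equalityI subsetI)
      fix A :: "real^4^4" assume "A \<in> carrier orthogonal_group"
      then have A: "orthogonal_transformation ((*v) A)"
        by (simp add: orthogonal_group_def orthogonal_transformation_matrix)
      define T where "T x = f (A *v g x)" for x
      have "linear T"
        using linear_compose[OF linear_compose[OF fg(2) orthogonal_transformation_linear[OF A]] fg(1)]
        by (simp add: T_def[abs_def] o_def)
      then have T: "orthogonal_transformation T"
        unfolding orthogonal_transformation using orthogonal_transformation_norm[OF A] by (simp add: T_def fg)
      have "normalizes_deck 1 0 T"
        unfolding normalizes_deck_def by (intro exI[of _ 0]) (simp add: scalar del: One_nat_def)
      with T obtain k where k: "k \<in> carrier S3_wreath" "T = wreath_action k" using complete by blast
      have "p k = A"
        unfolding matrix_eq by (simp only: app[OF k(1)] k(2)[symmetric] T_def fg simp_thms)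
      then show "A \<in> p ` carrier S3_wreath" using k(1) by blast
    qed (use orthp in \<open>auto simp: orthogonal_group_def simp del: semidirect_cyclic_simps\<close>)
  qed (auto simp: orthogonal_group_def Hausdorff_space_subtopology)
  moreover have "p k = p \<one>\<^bsub>S3_wreath\<^esub> \<longleftrightarrow> deck_map 1 0 (wreath_action k)" if k: "k \<in> carrier S3_wreath" for k
  proof -
    have one: "\<one>\<^bsub>S3_wreath\<^esub> \<in> carrier S3_wreath"
      using monoid.one_closed[OF group.is_monoid[OF grp]] .
    have "(lens_rotation 1 0 ^^ j) x = x" for j x
      by (induction j) (simp_all add: scalar del: One_nat_def)
    then have "deck_map 1 0 (wreath_action k) \<longleftrightarrow> (\<forall>x. wreath_action k x = x)"
      by (simp add: deck_map_def)
    also have "\<dots> \<longleftrightarrow> (\<forall>v. g (wreath_action k (f v)) = v)"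
      using fg(5,6) by metis
    also have "\<dots> \<longleftrightarrow> p k = p \<one>\<^bsub>S3_wreath\<^esub>"
      unfolding matrix_eq app[OF k] app[OF one] act_one fg(5) by simp
    finally show ?thesis by simp
  qed
  ultimately have "topgroup_iso (isom_group (lens_space 1 0)) (orthogonal_group :: (real^4^4) topgroup)"
    by (rule isom_group_iso)
  moreover have "isom_pi0 (lens_space 1 0) \<cong> integer_mod_group 2"
    by (rule isom_pi0_wreath[OF scalar]) simp
  ultimately show ?thesis ..
qed

lemma lens_projective_space:
  "topgroup_iso (isom_group (lens_space 2 1))
     (semidirect_cyclic
        (topgroup_prod (special_orthogonal_group :: (real^3^3) topgroup)
                       (special_orthogonal_group :: (real^3^3) topgroup))
        2 (\<lambda>(A, B). (B, A))) \<and>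
   isom_pi0 (lens_space 2 1) \<cong> integer_mod_group 2"
proof -
  interpret lens 2 1 by unfold_locales auto
  have "lens_root 2 = -1"
    using exp_pi_i by (simp add: lens_root_def)
  then have scalar: "lens_rotation 2 1 x = (-1) *\<^sub>R x" for x
    by (cases x) (simp add: lens_rotation_eq)
  interpret lens_action 2 1 S3_wreath wreath_action
    using scalar by (rule lens_action_wreath)
  let ?SO = "special_orthogonal_group :: (real^3^3) topgroup"
  let ?p = "\<lambda>(x, n::int). ((\<lambda>(a, b). (quat_rotation a, quat_rotation b)) x, n)"
  have H: "Hausdorff_space (gtopology ?SO)"
    by (simp add: special_orthogonal_group_def Hausdorff_space_subtopology)
  have q: "quotient_hom S3_wreath (semidirect_cyclic (topgroup_prod ?SO ?SO) 2 (\<lambda>(A, B). (B, A))) ?p"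
    by (rule quotient_hom_semidirect[OF quotient_hom_prod[OF compact_S3_group compact_S3_group
            quotient_hom_quat_rotation quotient_hom_quat_rotation H H]]) auto
  have "?p k = ?p \<one>\<^bsub>S3_wreath\<^esub> \<longleftrightarrow> deck_map 2 1 (wreath_action k)" if k: "k \<in> carrier S3_wreath" for k
  proof -
    obtain a b n where abn: "k = ((a, b), n)" "norm a = 1" "norm b = 1" "n = 0 \<or> n = 1"
      using k by (auto simp: S3_iff_norm mem_C2_iff)
    have r1: "quat_rotation (1, 0) = mat 1" by (simp add: quat_rotation_eq_one_iff norm_Pair)
    have "?p k = ?p \<one>\<^bsub>S3_wreath\<^esub> \<longleftrightarrow>
        n = 0 \<and> (a = (1, 0) \<or> a = (- 1, 0)) \<and> (b = (1, 0) \<or> b = (- 1, 0))"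
      using abn by (auto simp: r1 quat_rotation_eq_one_iff)
    also have "\<dots> \<longleftrightarrow> deck_map 2 1 (wreath_action k)"
    proof
      assume "n = 0 \<and> (a = (1, 0) \<or> a = (- 1, 0)) \<and> (b = (1, 0) \<or> b = (- 1, 0))"
      then have "(\<forall>x. wreath_action k x = x) \<or> (\<forall>x. wreath_action k x = - x)"
        by (auto simp: abn quat_action_def quat_cnj_def quat_mult_eq)
      then have "(\<forall>x. wreath_action k x = (lens_rotation 2 1 ^^ 0) x) \<or>
         (\<forall>x. wreath_action k x = (lens_rotation 2 1 ^^ 1) x)"
        using scalar by simp
      then show "deck_map 2 1 (wreath_action k)" unfolding deck_map_def by blast
    next
      assume "deck_map 2 1 (wreath_action k)"
      then obtain j where j: "\<And>x. wreath_action k x = (lens_rotation 2 1 ^^ j) x"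
        by (auto simp: deck_map_def)
      have "(lens_rotation 2 1 ^^ j) x = ((-1) ^ j) *\<^sub>R x" for x
        by (induction j) (simp_all add: scalar del: One_nat_def)
      then have "wreath_action ((a, b), n) x = ((-1) ^ j) *\<^sub>R x" for x
        using j unfolding abn(1) by simp
      moreover have "(-1) ^ j = (1::real) \<or> (-1) ^ j = (-1::real)" by (simp add: minus_one_power_iff)
      ultimately show "n = 0 \<and> (a = (1, 0) \<or> a = (- 1, 0)) \<and> (b = (1, 0) \<or> b = (- 1, 0))"
        using quat_action_scalar[OF abn(2-4)] by blast
    qed
    finally show ?thesis .
  qed
  with q have "topgroup_iso (isom_group (lens_space 2 1))
     (semidirect_cyclic (topgroup_prod ?SO ?SO) 2 (\<lambda>(A, B). (B, A)))"
    by (rule isom_group_iso)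
  moreover have "isom_pi0 (lens_space 2 1) \<cong> integer_mod_group 2"
    by (rule isom_pi0_wreath[OF scalar]) simp
  ultimately show ?thesis ..
qed

section \<open>The lens spaces with \<open>q = 1\<close>\<close>

definition pair_power :: "nat \<Rightarrow> complex \<times> complex \<Rightarrow> complex \<times> complex" where
  "pair_power n x = (fst x ^ n, snd x ^ n)"

text \<open>The square of a reflection \<open>w j\<close> in \<open>O(2)\<^sup>*\<close> is \<open>-1\<close>, whose power is \<open>-1\<close> or \<open>1\<close> depending on parity; this
  decides whether the image is \<open>O(2)\<^sup>*\<close> again or \<open>O(2)\<close>.\<close>

lemma pair_power_hom:
  assumes "n > 0"
  shows "pair_power n \<in> hom O2 O2"
    and "odd n \<Longrightarrow> pair_power n \<in> hom O2_star O2_star"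
    and "even n \<Longrightarrow> pair_power n \<in> hom O2_star O2"
  using assms
  by (auto intro!: homI elim!: two_circles_cases
      simp: pair_power_def norm_power norm_mult power_mult_distrib zero_power)

lemma pair_power_surj:
  assumes "n > 0"
  shows "pair_power n ` two_circles = two_circles"
proof (intro equalityI subsetI)
  fix x assume "x \<in> two_circles"
  then show "x \<in> pair_power n ` two_circles"
  proof (cases rule: two_circles_cases)
    case (fst z)
    then obtain w where "cmod w = 1" "w ^ n = z" using circle_root assms by blast
    then show ?thesis using assms fst by (intro image_eqI[of _ _ "(w, 0)"]) (auto simp: pair_power_def)
  next
    case (snd z)
    then obtain w where "cmod w = 1" "w ^ n = z" using circle_root assms by blast
    then show ?thesis using assms snd by (intro image_eqI[of _ _ "(0, w)"]) (auto simp: pair_power_def)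
  qed
qed (use assms in \<open>auto elim!: two_circles_cases simp: pair_power_def norm_power zero_power\<close>)

lemma quotient_hom_pair_power:
  assumes "compact_topgroup K" "carrier K = two_circles" "gtopology K = top_of_set two_circles"
    "carrier H = two_circles" "gtopology H = top_of_set two_circles"
    "pair_power n \<in> hom K H" "n > 0"
  shows "quotient_hom K H (pair_power n)"
proof (rule quotient_hom_compact[OF assms(1,6)])
  show "continuous_map (gtopology K) (gtopology H) (pair_power n)"
    unfolding assms(3,5) continuous_map_top_of_set_iff pair_power_surj[OF assms(7)]
    by (auto simp: pair_power_def[abs_def] intro!: continuous_intros)
qed (use assms pair_power_surj in \<open>auto simp: Hausdorff_space_subtopology\<close>)

lemma quotient_hom_id:
  assumes "topspace (gtopology K) = carrier K"
  shows "quotient_hom K K (\<lambda>x. x)"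
proof -
  have "{x \<in> topspace X. x \<in> U} = U" if "U \<subseteq> topspace X" for X :: "'a topology" and U
    using that by auto
  then have "quotient_map (gtopology K) (gtopology K) (\<lambda>x. x)"
    by (simp add: quotient_map_def)
  then show ?thesis using assms by (simp add: quotient_hom_def hom_def)
qed

lemma eq_of_sum_unit:
  fixes a b :: complex
  assumes "a * cnj a + b * cnj b = 1" "x * cnj a + y * cnj b = 0"
  shows "x = - cnj b * (a * y - b * x)" "y = cnj a * (a * y - b * x)"
  using assms by algebra+

text \<open>A complex linear isometry of the plane is determined by the images of \<open>1\<close> and \<open>j\<close>. The second
  is a multiple \<open>u\<close> of the vector orthogonal to the first, and \<open>u\<close> is absorbed by a square root
  multiplying from the left and its inverse multiplying from the right.\<close>

lemma complex_linear_form: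
  assumes T: "orthogonal_transformation T"
    and J: "\<And>x. T (quat_mult (\<i>, 0) x) = quat_mult (\<i>, 0) (T x)"
  obtains \<alpha> \<beta> where "cmod \<alpha> = 1" "norm \<beta> = 1" "\<And>x. T x = quat_mult (quat_mult (\<alpha>, 0) x) \<beta>"
proof -
  have lin: "linear T" using T by (rule orthogonal_transformation_linear)
  obtain a0 a1 where a: "T (1, 0) = (a0, a1)" by force
  obtain b0 b1 where b: "T (0, 1) = (b0, b1)" by force
  have na: "norm (a0, a1) = 1" and nb: "norm (b0, b1) = 1"
    using orthogonal_transformation_norm[OF T, of "(1, 0)"] orthogonal_transformation_norm[OF T, of "(0, 1)"]
    by (simp_all add: a b norm_Pair)
  have aa: "a0 * cnj a0 + a1 * cnj a1 = 1"
    using quat_mult_cnj(1)[OF na] by (simp add: quat_cnj_def)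
  have Ta: "T (z, 0) = (z * a0, z * a1)" for z
  proof -
    have z: "(z, 0) = Re z *\<^sub>R (1, 0) + Im z *\<^sub>R quat_mult (\<i>, 0) (1, 0)"
      by (simp add: complex_eq_iff)
    have "T (z, 0) = Re z *\<^sub>R T (1, 0) + Im z *\<^sub>R T (quat_mult (\<i>, 0) (1, 0))"
      by (subst z) (simp only: linear_add[OF lin] linear_scale[OF lin])
    then show ?thesis unfolding J a by (simp add: complex_eq_iff)
  qed
  have Tb: "T (0, z) = (z * b0, z * b1)" for z
  proof -
    have z: "(0, z) = Re z *\<^sub>R (0, 1) + Im z *\<^sub>R quat_mult (\<i>, 0) (0, 1)"
      by (simp add: complex_eq_iff)
    have "T (0, z) = Re z *\<^sub>R T (0, 1) + Im z *\<^sub>R T (quat_mult (\<i>, 0) (0, 1))"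
      by (subst z) (simp only: linear_add[OF lin] linear_scale[OF lin])
    then show ?thesis unfolding J b by (simp add: complex_eq_iff)
  qed
  have Tx: "T (z, w) = (z * a0 + w * b0, z * a1 + w * b1)" for z w
    using linear_add[OF lin, of "(z, 0)" "(0, w)"] by (simp add: Ta Tb)
  have "b0 * cnj a0 + b1 * cnj a1 = 0"
    using orthogonal_transformation_inner[OF T, of "(0, 1)" "(1, 0)"]
      orthogonal_transformation_inner[OF T, of "(0, 1)" "(\<i>, 0)"]
    by (simp add: Tx inner_complex_def complex_eq_iff algebra_simps)
  define u where "u = a0 * b1 - a1 * b0"
  note ub = eq_of_sum_unit[OF aa \<open>b0 * cnj a0 + b1 * cnj a1 = 0\<close>, folded u_def]
  have "cmod b0 = cmod a1 * cmod u" "cmod b1 = cmod a0 * cmod u"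
    using arg_cong[OF ub(1), of cmod] arg_cong[OF ub(2), of cmod] by (simp_all add: norm_mult)
  then have "(norm (b0, b1))\<^sup>2 = (cmod u)\<^sup>2 * (norm (a0, a1))\<^sup>2"
    by (simp add: norm_Pair power_mult_distrib algebra_simps)
  then have "(cmod u)\<^sup>2 = 1" using na nb by simp
  then have "cmod u = 1" using power2_eq_imp_eq[of "cmod u" 1] by simp
  then obtain \<alpha> where \<alpha>: "cmod \<alpha> = 1" "\<alpha>\<^sup>2 = u"
    using circle_root[of u 2] by auto
  have \<alpha>\<alpha>: "\<alpha> * cnj \<alpha> = 1" using \<alpha>(1) by (rule unit_mult_cnj)
  have "T x = quat_mult (quat_mult (\<alpha>, 0) x) (quat_mult (cnj \<alpha>, 0) (a0, a1))" for x
  proof -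
    obtain z w where x: "x = (z, w)" by force
    have "z * a0 + w * b0 = \<alpha> * z * (cnj \<alpha> * a0) - \<alpha> * w * (\<alpha> * cnj a1)"
      using \<alpha>\<alpha> ub(1) \<alpha>(2) by algebra
    moreover have "z * a1 + w * b1 = \<alpha> * z * (cnj \<alpha> * a1) + \<alpha> * w * (\<alpha> * cnj a0)"
      using \<alpha>\<alpha> ub(2) \<alpha>(2) by algebra
    ultimately show ?thesis by (simp add: x Tx)
  qed
  moreover have "norm (quat_mult (cnj \<alpha>, 0) (a0, a1)) = 1"
    unfolding norm_quat_mult using \<alpha> na by (simp add: norm_Pair)
  ultimately show ?thesis using that \<alpha>(1) by blast
qed

locale lens_one = lens m 1 for m :: nat +
  assumes m_gt_2: "m > 2"
begin

lemma rot_eq: "rot x = quat_mult (lens_root m, 0) x"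
  by (cases x) (simp add: lens_rotation_eq)

lemma rot_funpow: "(rot ^^ k) x = quat_mult (lens_root m ^ k, 0) x"
  by (cases x) (simp add: lens_rotation_funpow)

lemma Im_lens_root: "Im (lens_root m) \<noteq> 0"
proof
  assume "Im (lens_root m) = 0"
  then have "lens_root m ^ 2 = lens_root m * cnj (lens_root m)"
    by (simp add: complex_eq_iff power2_eq_square)
  then have "lens_root m ^ 2 = 1" by (simp add: unit_mult_cnj)
  then have "m dvd 2" by (simp only: lens_root_power_eq_1)
  then show False using m_gt_2 by (auto dest: dvd_imp_le)
qed

text \<open>Comparing real parts in \<open>T (\<xi> x) = \<xi>^k T x\<close> shows that \<open>T\<close> commutes or anticommutes with \<open>\<i>\<close>.\<close>

lemma normalizer_complex:
  assumes T: "orthogonal_transformation T" and nrm: "normalizes_deck m 1 T"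
  shows "(\<forall>x. T (quat_mult (\<i>, 0) x) = quat_mult (\<i>, 0) (T x)) \<or>
         (\<forall>x. T (quat_mult (\<i>, 0) x) = - quat_mult (\<i>, 0) (T x))"
proof -
  have lin: "linear T" using T by (rule orthogonal_transformation_linear)
  obtain k where k: "\<And>x. T (rot x) = (rot ^^ k) (T x)"
    using nrm by (auto simp: normalizes_deck_def)
  define c d where "c = Re (lens_root m)" and "d = Im (lens_root m)"
  define c' d' where "c' = Re (lens_root m ^ k)" and "d' = Im (lens_root m ^ k)"
  let ?J = "quat_mult (\<i>, 0)"
  have cx: "quat_mult (z, 0) x = Re z *\<^sub>R x + Im z *\<^sub>R ?J x" for z x
    by (cases x) (simp add: complex_eq_iff)
  have eq: "c *\<^sub>R T x + d *\<^sub>R T (?J x) = c' *\<^sub>R T x + d' *\<^sub>R ?J (T x)" for x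
    using k[of x] unfolding rot_eq rot_funpow cx[of "lens_root m"] cx[of "lens_root m ^ k"]
    by (simp only: linear_add[OF lin] linear_scale[OF lin] c_def d_def c'_def d'_def)
  have J0: "?J x \<bullet> x = 0" for x
    by (cases x) (simp add: inner_complex_def algebra_simps)
  have "(c *\<^sub>R T (1, 0) + d *\<^sub>R T (?J (1, 0))) \<bullet> T (1, 0) = (c' *\<^sub>R T (1, 0) + d' *\<^sub>R ?J (T (1, 0))) \<bullet> T (1, 0)"
    by (simp only: eq)
  then have "c = c'"
    by (simp add: inner_add_left J0 orthogonal_transformation_inner[OF T] del: quat_mult.simps)
  then have dd: "d *\<^sub>R T (?J x) = d' *\<^sub>R ?J (T x)" for x
    using eq[of x] by simp
  have "c\<^sup>2 + d\<^sup>2 = 1" "c'\<^sup>2 + d'\<^sup>2 = 1"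
    unfolding c_def d_def c'_def d'_def cmod_power2[symmetric] by (simp_all add: norm_power)
  then have "d'\<^sup>2 = d\<^sup>2" using \<open>c = c'\<close> by simp
  then have "d' = d \<or> d' = - d" by (simp add: power2_eq_iff)
  moreover have "d \<noteq> 0" using Im_lens_root by (simp add: d_def)
  ultimately show ?thesis
  proof (elim disjE)
    assume "d' = d"
    then have "d *\<^sub>R T (?J x) = d *\<^sub>R ?J (T x)" for x using dd by simp
    then show ?thesis using \<open>d \<noteq> 0\<close> by (metis scaleR_cancel_left)
  next
    assume "d' = - d"
    then have "d *\<^sub>R T (?J x) = d *\<^sub>R - ?J (T x)" for x using dd by simp
    then show ?thesis using \<open>d \<noteq> 0\<close> by (metis scaleR_cancel_left)
  qed
qed

lemma normalizer_form:
  assumes T: "orthogonal_transformation T" and nrm: "normalizes_deck m 1 T"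
  shows "\<exists>a \<in> two_circles. \<exists>b \<in> S3. T = quat_mult a \<circ> (\<lambda>x. quat_mult x (quat_cnj b))"
  using normalizer_complex[OF T nrm]
proof
  assume *: "\<forall>x. T (quat_mult (\<i>, 0) x) = quat_mult (\<i>, 0) (T x)"
  obtain \<alpha> \<beta> where ab: "cmod \<alpha> = 1" "norm \<beta> = 1" "\<And>x. T x = quat_mult (quat_mult (\<alpha>, 0) x) \<beta>"
    by (rule complex_linear_form[OF T *[rule_format]], rule that)
  have "T = quat_mult (\<alpha>, 0) \<circ> (\<lambda>x. quat_mult x (quat_cnj (quat_cnj \<beta>)))"
    by (rule ext) (simp only: ab(3) comp_apply quat_mult_assoc quat_cnj_cnj)
  then show ?thesis using ab(1,2)
    by (intro bexI[of _ "(\<alpha>, 0)"] bexI[of _ "quat_cnj \<beta>"]) (simp_all add: S3_iff_norm)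
next
  assume *: "\<forall>x. T (quat_mult (\<i>, 0) x) = - quat_mult (\<i>, 0) (T x)"
  define S where "S x = T (quat_mult (0, 1) x)" for x
  have S: "orthogonal_transformation S"
    using orthogonal_transformation_compose[OF T orthogonal_quat_mult[of "(0, 1)" "(1, 0)"]]
    by (simp add: S_def[abs_def] o_def norm_Pair)
  have J: "S (quat_mult (\<i>, 0) x) = quat_mult (\<i>, 0) (S x)" for x
  proof -
    have "quat_mult (0, 1) (quat_mult (\<i>, 0) x) = quat_mult (\<i>, 0) (- quat_mult (0, 1) x)"
      by (cases x) simp
    then have "S (quat_mult (\<i>, 0) x) = - quat_mult (\<i>, 0) (T (- quat_mult (0, 1) x))"
      using *[rule_format, of "- quat_mult (0, 1) x"] by (simp only: S_def)
    then show ?thesis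
      unfolding linear_neg[OF orthogonal_transformation_linear[OF T]] linear_neg[OF linear_quat_mult(1)] S_def
      by (simp only: minus_minus)
  qed
  obtain \<alpha> \<beta> where ab: "cmod \<alpha> = 1" "norm \<beta> = 1" "\<And>x. S x = quat_mult (quat_mult (\<alpha>, 0) x) \<beta>"
    by (rule complex_linear_form[OF S J], rule that)
  have "T x = quat_mult (0, - \<alpha>) (quat_mult x (quat_cnj (quat_cnj \<beta>)))" for x
  proof -
    have "quat_mult (0, 1) (quat_mult (0, -1) x) = x" by (cases x) simp
    then have "T x = S (quat_mult (0, -1) x)" by (simp only: S_def)
    also have "\<dots> = quat_mult (quat_mult (\<alpha>, 0) (0, -1)) (quat_mult x \<beta>)"
      by (simp only: ab(3) quat_mult_assoc)
    finally show ?thesis by simp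
  qed
  then have "T = quat_mult (0, - \<alpha>) \<circ> (\<lambda>x. quat_mult x (quat_cnj (quat_cnj \<beta>)))" by (simp add: fun_eq_iff)
  then show ?thesis using ab(1,2)
    by (intro bexI[of _ "(0, - \<alpha>)"] bexI[of _ "quat_cnj \<beta>"]) (simp_all add: S3_iff_norm)
qed

abbreviation "two_sided_group \<equiv> topgroup_prod O2_star S3_group"
abbreviation "two_sided \<equiv> \<lambda>(a, b). quat_mult a \<circ> (\<lambda>x. quat_mult x (quat_cnj b))"

lemma lens_action_two_sided: "lens_action m 1 two_sided_group two_sided"
proof (rule lens_action_prod[where a = quat_mult and b = "\<lambda>y z. quat_mult z (quat_cnj y)",
      OF compact_O2_star compact_S3_group])
  show "\<exists>x \<in> carrier O2_star. \<exists>y \<in> carrier S3_group. T = quat_mult x \<circ> (\<lambda>z. quat_mult z (quat_cnj y))"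
    if "orthogonal_transformation T" "normalizes_deck m 1 T" for T
    using normalizer_form[OF that] by (simp only: O2_star_simps S3_group_simps)
  show "quat_mult (x \<otimes>\<^bsub>O2_star\<^esub> y) = quat_mult x \<circ> quat_mult y" for x y
    by (simp only: O2_star_simps) (simp only: fun_eq_iff comp_apply quat_mult_assoc simp_thms)
  show "(\<lambda>z. quat_mult z (quat_cnj (x \<otimes>\<^bsub>S3_group\<^esub> y))) =
     (\<lambda>z. quat_mult z (quat_cnj x)) \<circ> (\<lambda>z. quat_mult z (quat_cnj y))" for x y
    by (simp only: S3_group_simps) (simp only: fun_eq_iff comp_apply quat_mult_assoc quat_cnj_mult simp_thms)
  show "(\<lambda>z. quat_mult z (quat_cnj y)) \<circ> quat_mult x = quat_mult x \<circ> (\<lambda>z. quat_mult z (quat_cnj y))" for x y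
    by (simp only: fun_eq_iff comp_apply quat_mult_assoc simp_thms)
  show "orthogonal_transformation (quat_mult x)" if "x \<in> carrier O2_star" for x
    using orthogonal_quat_mult[of x "(1, 0)"] that two_circles_subset_S3
    by (auto simp: S3_iff_norm norm_Pair)
  show "orthogonal_transformation (\<lambda>z. quat_mult z (quat_cnj y))" if "y \<in> carrier S3_group" for y
    using orthogonal_quat_mult[of "(1, 0)" "quat_cnj y"] that by (simp add: S3_iff_norm norm_Pair)
  show "normalizes_deck m 1 (\<lambda>z. quat_mult z (quat_cnj y))" for y
    unfolding normalizes_deck_def rot_funpow unfolding rot_eq
    by (intro exI[of _ 1]) (simp only: quat_mult_assoc power_one_right simp_thms)
  show "normalizes_deck m 1 (quat_mult x)" if "x \<in> carrier O2_star" for x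
  proof -
    have "x \<in> two_circles" using that by simp
    then show ?thesis
    proof (cases rule: two_circles_cases)
      case (fst z)
      then show ?thesis unfolding normalizes_deck_def rot_funpow unfolding rot_eq
        by (intro exI[of _ 1]) (simp add: quat_mult_eq algebra_simps)
    next
      case (snd z)
      have inv: "lens_root m ^ (m - 1) * lens_root m = 1"
        using lens_root_power_eq_1[of m] m_gt_2 by (metis dvd_refl power_minus_mult zero_less_iff_neq_zero not_less_zero)
      have "lens_root m ^ (m - 1) = lens_root m ^ (m - 1) * (lens_root m * cnj (lens_root m))"
        by (simp add: unit_mult_cnj)
      also have "\<dots> = cnj (lens_root m)"
        unfolding mult.assoc[symmetric] inv by simp
      finally have "lens_root m ^ (m - 1) = cnj (lens_root m)" .
      then show ?thesis unfolding normalizes_deck_def rot_funpow unfolding rot_eq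
        by (intro exI[of _ "m - 1"]) (simp add: snd quat_mult_eq algebra_simps)
    qed
  qed
  show "continuous_map (prod_topology (gtopology O2_star) (gtopology S3_group)) euclidean
         (\<lambda>(x, y). quat_mult x (quat_mult z (quat_cnj y)))" for z
    unfolding O2_star_simps S3_group_simps case_prod_beta
    by (intro continuous_map_Times_euclidean continuous_intros)
qed

sublocale lens_action m 1 two_sided_group two_sided
  by (rule lens_action_two_sided)

lemma deck_two_sided:
  assumes k: "(a, b) \<in> carrier two_sided_group"
  shows "deck_map m 1 (two_sided (a, b)) \<longleftrightarrow>
    snd a = 0 \<and> (b = (1, 0) \<and> fst a ^ m = 1 \<or> b = (-1, 0) \<and> (- fst a) ^ m = 1)"
proof
  have b: "norm b = 1" using k by (simp add: S3_iff_norm)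
  assume "deck_map m 1 (two_sided (a, b))"
  then obtain j where "\<And>x. two_sided (a, b) x = quat_mult (lens_root m ^ j, 0) x"
    unfolding deck_map_def rot_funpow by blast
  then have j: "quat_mult a (quat_mult x (quat_cnj b)) = quat_mult (lens_root m ^ j, 0) x" for x
    unfolding prod.case comp_apply .
  have "quat_mult (quat_mult a (quat_cnj b)) b = quat_mult (lens_root m ^ j, 0) b"
    using j[of "(1, 0)"] by (simp del: quat_mult.simps)
  then have a: "a = quat_mult (lens_root m ^ j, 0) b"
    by (simp add: quat_mult_assoc quat_mult_cnj[OF b] del: quat_mult.simps)
  have "quat_conj b x = x" for x
  proof -
    have n: "norm (lens_root m ^ j, 0 :: complex) = 1" by (simp add: norm_Pair norm_power)
    have "quat_mult (lens_root m ^ j, 0) (quat_conj b x) = quat_mult (lens_root m ^ j, 0) x"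
      using j[of x] by (simp add: a quat_conj_def quat_mult_assoc del: quat_mult.simps)
    then show ?thesis using quat_mult_cnj_cancel(1)[OF n] by metis
  qed
  then have "b = (1, 0) \<or> b = (-1, 0)" using quat_commute_real[OF b] by blast
  then show "snd a = 0 \<and> (b = (1, 0) \<and> fst a ^ m = 1 \<or> b = (-1, 0) \<and> (- fst a) ^ m = 1)"
    using root_of_unity_iff[of "lens_root m ^ j"] by (auto simp: a)
next
  assume *: "snd a = 0 \<and> (b = (1, 0) \<and> fst a ^ m = 1 \<or> b = (-1, 0) \<and> (- fst a) ^ m = 1)"
  then obtain s where s: "s = 1 \<or> s = -1" "b = (s, 0)" "(s * fst a) ^ m = 1" by force
  then obtain j where j: "s * fst a = lens_root m ^ j" using root_of_unity_iff by blast
  have "two_sided (a, b) x = (rot ^^ j) x" for x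
    using s(1) * unfolding rot_funpow j[symmetric] s(2)
    by (auto simp: quat_mult_eq quat_cnj_def algebra_simps)
  then show "deck_map m 1 (two_sided (a, b))" unfolding deck_map_def by blast
qed

lemma isom_pi0_two_sided: "isom_pi0 (lens_space m 1) \<cong> integer_mod_group 2"
proof -
  note lab = circle_label
  define c where "c k = circle_label (fst k)" for k :: "(complex \<times> complex) \<times> (complex \<times> complex)"
  have S3ne: "(1, 0) \<in> S3" by (simp add: S3_def)
  show ?thesis
  proof (rule isom_pi0_iso[of c])
    show "c \<in> hom two_sided_group (integer_mod_group 2)"
      using lab(2) by (auto simp: c_def hom_def)
    show "c ` carrier two_sided_group = carrier (integer_mod_group 2)"
    proof -
      have "c ` carrier two_sided_group \<subseteq> circle_label ` two_circles" by (auto simp: c_def)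
      moreover have "circle_label x \<in> c ` carrier two_sided_group" if "x \<in> two_circles" for x
        using that S3ne by (intro image_eqI[of _ _ "(x, (1, 0))"]) (auto simp: c_def)
      ultimately show ?thesis unfolding lab(3)[symmetric] by blast
    qed
    show "continuous_map (gtopology two_sided_group) (discrete_topology (carrier (integer_mod_group 2))) c"
      using continuous_map_compose[OF continuous_map_fst lab(4), of "gtopology S3_group"]
      by (simp only: c_def[abs_def] topgroup_prod_simps O2_star_simps o_def)
    fix d assume d: "d \<in> carrier (integer_mod_group 2)"
    have "{k \<in> carrier two_sided_group. c k = d} = {x \<in> two_circles. circle_label x = d} \<times> S3"
      by (auto simp: c_def)
    moreover have "path_connectedin (top_of_set two_circles) {x \<in> two_circles. circle_label x = d}"
      using lab(5)[OF d] by (auto simp: path_connectedin_subtopology)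
    moreover have "path_connectedin (top_of_set S3) S3"
      using path_connected_S3 path_connectedin_topspace[of "top_of_set S3"] by simp
    ultimately show "path_connectedin (gtopology two_sided_group) {k \<in> carrier two_sided_group. c k = d}"
      by (simp only: topgroup_prod_simps O2_star_simps S3_group_simps path_connectedin_Times) simp
  next
    fix k assume k: "k \<in> carrier two_sided_group" "deck_map m 1 (two_sided k)"
    then have "snd (fst k) = 0" using deck_two_sided[of "fst k" "snd k"] by (cases k) simp
    then show "c k = c \<one>\<^bsub>two_sided_group\<^esub>" by (simp add: c_def circle_label_def)
  qed
qed

lemma isom_group_odd:
  assumes "odd m"
  shows "topgroup_iso (isom_group (lens_space m 1)) (O2_star \<times>\<^sub>~ S3_group)"
proof -
  define N where "N = {(\<one>\<^bsub>O2_star\<^esub>, \<one>\<^bsub>S3_group\<^esub>), (- \<one>\<^bsub>O2_star\<^esub>, - \<one>\<^bsub>S3_group\<^esub>)}"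
  note tw = quotient_hom_twisted[OF compact_O2_star has_minus_one(3) compact_S3_group has_minus_one(1), folded N_def]
  have top: "topspace (gtopology S3_group) = carrier S3_group" by simp
  have m0: "m > 0" using m_gt_2 by simp
  have q: "quotient_hom O2_star O2_star (pair_power m)"
    by (rule quotient_hom_pair_power[OF compact_O2_star]) (use assms m0 pair_power_hom in auto)
  have p: "quotient_hom two_sided_group two_sided_group (\<lambda>(x, y). (pair_power m x, y))"
    by (rule quotient_hom_prod[OF compact_O2_star compact_S3_group q quotient_hom_id[OF top]])
      (auto simp: Hausdorff_space_subtopology)
  show ?thesis
  proof (rule isom_group_iso[OF quotient_hom_compose[OF p tw(1)]])
    fix k assume k: "k \<in> carrier two_sided_group"
    obtain a b where ab: "k = (a, b)" by (cases k)
    have aC: "a \<in> two_circles" using k ab by simp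
    have pk: "(pair_power m a, b) \<in> carrier two_sided_group"
      using k ab pair_power_surj[OF m0] by auto
    have one: "pair_power m (1, 0) = (1, 0)" using m0 by (simp add: pair_power_def)
    have "(r_coset two_sided_group N \<circ> (\<lambda>(x, y). (pair_power m x, y))) k =
        (r_coset two_sided_group N \<circ> (\<lambda>(x, y). (pair_power m x, y))) \<one>\<^bsub>two_sided_group\<^esub> \<longleftrightarrow> (pair_power m a, b) \<in> N"
      using tw(2)[OF pk] by (simp add: ab one)
    also have "\<dots> \<longleftrightarrow> deck_map m 1 (two_sided (a, b))"
    proof -
      have "(- z) ^ m = 1 \<longleftrightarrow> z ^ m = - 1" for z :: complex
        using assms by (metis minus_minus power_minus_odd)
      then show ?thesis
        unfolding deck_two_sided[OF k[unfolded ab]] using aC m0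
        by (auto simp: N_def pair_power_def zero_power elim!: two_circles_cases)
    qed
    finally show "(r_coset two_sided_group N \<circ> (\<lambda>(x, y). (pair_power m x, y))) k =
        (r_coset two_sided_group N \<circ> (\<lambda>(x, y). (pair_power m x, y))) \<one>\<^bsub>two_sided_group\<^esub> \<longleftrightarrow> deck_map m 1 (two_sided k)"
      unfolding ab .
  qed
qed

lemma isom_group_even:
  assumes "even m"
  shows "topgroup_iso (isom_group (lens_space m 1))
           (topgroup_prod O2 (special_orthogonal_group :: (real^3^3) topgroup))"
proof -
  have m0: "m > 0" using m_gt_2 by simp
  have q: "quotient_hom O2_star O2 (pair_power m)"
    by (rule quotient_hom_pair_power[OF compact_O2_star]) (use assms m0 pair_power_hom in auto)
  have p: "quotient_hom two_sided_group (topgroup_prod O2 (special_orthogonal_group :: (real^3^3) topgroup))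
       (\<lambda>(x, y). (pair_power m x, quat_rotation y))"
    by (rule quotient_hom_prod[OF compact_O2_star compact_S3_group q quotient_hom_quat_rotation])
      (auto simp: Hausdorff_space_subtopology special_orthogonal_group_def)
  show ?thesis
  proof (rule isom_group_iso[OF p])
    fix k assume k: "k \<in> carrier two_sided_group"
    obtain a b where ab: "k = (a, b)" by (cases k)
    have aC: "a \<in> two_circles" "norm b = 1" using k ab by (simp_all add: S3_iff_norm)
    have one: "pair_power m (1, 0) = (1, 0)" "quat_rotation (1, 0) = mat 1"
      using m0 by (simp_all add: pair_power_def quat_rotation_eq_one_iff norm_Pair)
    show "(case k of (x, y) \<Rightarrow> (pair_power m x, quat_rotation y)) =
        (case \<one>\<^bsub>two_sided_group\<^esub> of (x, y) \<Rightarrow> (pair_power m x, quat_rotation y)) \<longleftrightarrow> deck_map m 1 (two_sided k)"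
      unfolding ab deck_two_sided[OF k[unfolded ab]] using aC m0 assms
      by (auto simp: one quat_rotation_eq_one_iff) (auto simp: pair_power_def elim!: two_circles_cases)
  qed
qed

end

section \<open>The lens spaces with \<open>1 < q < m / 2\<close>\<close>

abbreviation torus :: "(complex \<times> complex) topgroup" where
  "torus \<equiv> topgroup_prod circle_group circle_group"

definition diag_map :: "complex \<times> complex \<Rightarrow> complex \<times> complex \<Rightarrow> complex \<times> complex" where
  "diag_map = (\<lambda>(u, v) (z, w). (u * z, v * w))"

lemma diag_map_apply [simp]: "diag_map (u, v) (z, w) = (u * z, v * w)"
  by (simp add: diag_map_def)

lemma compact_torus: "compact_topgroup torus"
  using compact_circle_group by (simp add: compact_topgroup_prod)

lemma continuous_map_torus:
  assumes "continuous_on (sphere 0 1 \<times> sphere 0 1) f"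
    and "\<And>x. x \<in> sphere 0 1 \<times> sphere 0 1 \<Longrightarrow> f x \<in> sphere 0 1 \<times> sphere 0 1"
  shows "continuous_map (gtopology torus) (gtopology torus) f"
proof -
  have "gtopology torus = top_of_set (sphere 0 1 \<times> sphere 0 1)" by simp
  then show ?thesis using assms by (simp only: continuous_map_top_of_set_iff) blast
qed

lemma path_connected_torus: "path_connected_space (gtopology torus)"
proof -
  have "path_connected_space (top_of_set (sphere 0 1 :: complex set))"
    using path_connected_sphere[of "0 :: complex" 1]
    by (simp add: path_connectedin_topspace[symmetric] path_connectedin_subtopology)
  then show ?thesis
    by (simp only: topgroup_prod_simps circle_group_simps path_connected_space_prod_topology) simp
qed

lemma orthogonal_transformation_pairI:
  assumes "linear T" "\<And>z w. norm (T (z, w)) = norm (z, w)"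
  shows "orthogonal_transformation T"
  using assms by (auto simp: orthogonal_transformation)

lemma orthogonal_diag_map:
  assumes "cmod u = 1" "cmod v = 1"
  shows "orthogonal_transformation (diag_map (u, v))"
proof (rule orthogonal_transformation_pairI)
  show "linear (diag_map (u, v))"
    by (rule linearI) (auto simp: algebra_simps)
  show "norm (diag_map (u, v) (z, w)) = norm (z, w)" for z w
    using assms by (simp add: norm_Pair norm_mult)
qed

lemma orthogonal_transformation_coordinate:
  fixes T :: "complex \<times> complex \<Rightarrow> complex \<times> complex"
  assumes T: "orthogonal_transformation T" and emb: "linear e" "linear p" "\<And>z. norm (e z) = norm z"
    and TA: "\<And>z. T (e z) = f (A z)" and f: "\<And>z. p (f z) = z" "\<And>z. norm (f z) = norm z"
  shows "orthogonal_transformation (A :: complex \<Rightarrow> complex)"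
proof -
  have "A = p \<circ> (T \<circ> e)" using TA f by (simp add: fun_eq_iff)
  moreover have "linear (p \<circ> (T \<circ> e))"
    using linear_compose linear_compose[OF emb(1) orthogonal_transformation_linear[OF T]] emb(2) by blast
  moreover have "norm (A z) = norm z" for z
    using orthogonal_transformation_norm[OF T, of "e z"] TA[of z] f(2)[of "A z"] emb(3)[of z] by simp
  ultimately show ?thesis by (simp add: orthogonal_transformation)
qed

lemma linear_axes:
  "linear (\<lambda>z::complex. (z, 0::complex))" "linear (\<lambda>z::complex. (0::complex, z))"
  "linear (fst :: complex \<times> complex \<Rightarrow> complex)" "linear (snd :: complex \<times> complex \<Rightarrow> complex)"
  by (auto intro!: linearI)

lemma unit_inverse_unique:
  assumes "y * x = 1" "cmod x = 1"
  shows "y = cnj x"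
proof -
  have "y = y * (x * cnj x)" using unit_mult_cnj(1)[OF assms(2)] by simp
  also have "\<dots> = cnj x" using assms(1) by (simp add: mult.assoc[symmetric])
  finally show ?thesis .
qed

context lens
begin

lemma deck_diag_iff: "(\<exists>j. \<forall>z w. diag_map (u, v) (z, w) = (rot ^^ j) (z, w)) \<longleftrightarrow> u ^ m = 1 \<and> v = u ^ q"
proof
  assume "\<exists>j. \<forall>z w. diag_map (u, v) (z, w) = (rot ^^ j) (z, w)"
  then obtain j where "diag_map (u, v) (1, 1) = (rot ^^ j) (1, 1)" by blast
  then have "u = lens_root m ^ j" "v = lens_root m ^ (q * j)" by (simp_all add: lens_rotation_funpow)
  then have "u ^ m = 1" using root_of_unity_iff by blast
  moreover have "v = u ^ q"
    using \<open>u = lens_root m ^ j\<close> \<open>v = lens_root m ^ (q * j)\<close> by (simp add: power_mult[symmetric] mult.commute)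
  ultimately show "u ^ m = 1 \<and> v = u ^ q" ..
next
  assume *: "u ^ m = 1 \<and> v = u ^ q"
  then obtain j where "u = lens_root m ^ j" using root_of_unity_iff by blast
  with * have "\<forall>z w. diag_map (u, v) (z, w) = (rot ^^ j) (z, w)"
    by (simp add: lens_rotation_funpow power_mult[symmetric] mult.commute)
  then show "\<exists>j. \<forall>z w. diag_map (u, v) (z, w) = (rot ^^ j) (z, w)" ..
qed

lemma deck_map_iff: "deck_map m q T \<longleftrightarrow> (\<exists>j. \<forall>z w. T (z, w) = (rot ^^ j) (z, w))"
  by (simp add: deck_map_def)

lemma deck_map_axis:
  assumes "deck_map m q T"
  shows "snd (T (z, 0)) = 0" "fst (T (\<i>, 0)) = \<i> * fst (T (1, 0))" "fst (T (1, 0)) \<noteq> 0"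
proof -
  obtain j where "\<And>x. T x = (rot ^^ j) x" using assms by (auto simp: deck_map_def)
  then show "snd (T (z, 0)) = 0" "fst (T (\<i>, 0)) = \<i> * fst (T (1, 0))" "fst (T (1, 0)) \<noteq> 0"
    by (auto simp: lens_rotation_funpow lens_root_def)
qed

lemma normalizes_diag: "normalizes_deck m q (diag_map (u, v))"
  unfolding normalizes_deck_def
  by (rule exI[of _ 1]) (auto simp: diag_map_def lens_rotation_eq)

lemma lens_root_inverse: "lens_root m ^ (j * (m - 1)) = cnj (lens_root m ^ j)"
proof -
  let ?x = "lens_root m ^ j"
  have "j * (m - 1) + j = j * m" using m by (simp add: algebra_simps)
  then have "lens_root m ^ (j * (m - 1)) * ?x = 1"
    unfolding power_add[symmetric] by (simp add: lens_root_power_eq_1)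
  then show ?thesis by (rule unit_inverse_unique) (simp add: norm_power)
qed

end

locale lens_general = lens +
  assumes q: "1 < q" "2 * q < m"
begin

lemma root_eq_or_cnj:
  assumes "cmod x = 1" "cmod y = 1" "Re x = Re y"
  shows "x = y \<or> x = cnj y"
proof -
  have "(Im x)\<^sup>2 = (Im y)\<^sup>2"
    using cmod_power2[of x] cmod_power2[of y] assms by simp
  then show ?thesis using assms(3) by (auto simp: power2_eq_iff complex_eq_iff)
qed

text \<open>The condition \<open>1 < q < m / 2\<close> makes the four numbers \<open>\<xi>\<close>, \<open>\<xi>\<^sup>q\<close> and their inverses distinct.\<close>

lemma root_q_facts:
  "lens_root m ^ q \<noteq> cnj (lens_root m ^ q)" "lens_root m \<noteq> cnj (lens_root m)"
  "Re (lens_root m) \<noteq> Re (lens_root m ^ q)"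
proof -
  have inv: "x * cnj x = 1" if "cmod x = 1" for x using unit_mult_cnj that by blast
  have no: "\<not> m dvd d" if "0 < d" "d < m" for d using that by (auto dest: dvd_imp_le)
  show "lens_root m ^ q \<noteq> cnj (lens_root m ^ q)"
  proof
    assume "lens_root m ^ q = cnj (lens_root m ^ q)"
    then have "lens_root m ^ q * lens_root m ^ q = 1" using inv[of "lens_root m ^ q"] by (simp add: norm_power)
    then have "m dvd q + q" by (simp only: power_add[symmetric] lens_root_power_eq_1)
    then show False using no[of "q + q"] q by simp
  qed
  show "lens_root m \<noteq> cnj (lens_root m)"
  proof
    assume "lens_root m = cnj (lens_root m)"
    then have "lens_root m ^ 1 * lens_root m ^ 1 = 1" using inv[of "lens_root m"] by simp
    then have "m dvd 1 + 1" by (simp only: power_add[symmetric] lens_root_power_eq_1)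
    then show False using no[of "1 + 1"] q by simp
  qed
  show "Re (lens_root m) \<noteq> Re (lens_root m ^ q)"
  proof
    assume "Re (lens_root m) = Re (lens_root m ^ q)"
    then have "lens_root m ^ q = lens_root m \<or> lens_root m ^ q = cnj (lens_root m)"
      using root_eq_or_cnj[of "lens_root m ^ q" "lens_root m"] by (simp add: norm_power)
    then show False
    proof
      assume "lens_root m ^ q = lens_root m"
      then have "lens_root m * lens_root m ^ (q - 1) = lens_root m * 1"
        using q by (simp add: power_Suc[symmetric] del: power_Suc)
      then have "lens_root m ^ (q - 1) = 1"
        unfolding mult_cancel_left using norm_lens_root[of m] by (auto simp del: norm_lens_root)
      then have "m dvd q - 1" by (simp only: lens_root_power_eq_1)
      moreover have "\<not> m dvd q - 1" by (rule no) (use q in auto)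
      ultimately show False by contradiction
    next
      assume "lens_root m ^ q = cnj (lens_root m)"
      then have "lens_root m ^ (q + 1) = 1" using inv[of "lens_root m"] by (simp add: mult.commute)
      then have "m dvd q + 1" by (simp only: lens_root_power_eq_1)
      moreover have "\<not> m dvd q + 1" by (rule no) (use q in auto)
      ultimately show False by contradiction
    qed
  qed
qed

lemma square_one: "lens_root m ^ (q * q) = lens_root m \<longleftrightarrow> [(int q)\<^sup>2 = 1] (mod int m)"
proof -
  have "lens_root m ^ (q * q) = lens_root m \<longleftrightarrow> [q * q = 1] (mod m)"
    using lens_root_power_eq[of "q * q" 1] by simp
  also have "\<dots> \<longleftrightarrow> [int (q * q) = int 1] (mod int m)" by (simp only: cong_int_iff)
  finally show ?thesis by (simp add: power2_eq_square)
qed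

lemma square_minus_one: "lens_root m ^ (q * q) = cnj (lens_root m) \<longleftrightarrow> [(int q)\<^sup>2 = - 1] (mod int m)"
proof -
  have "lens_root m ^ (q * q) = cnj (lens_root m) \<longleftrightarrow> lens_root m ^ (q * q) * lens_root m = 1"
    using unit_inverse_unique[of "lens_root m ^ (q * q)" "lens_root m"] unit_mult_cnj(2)[of "lens_root m"]
    by auto
  also have "\<dots> \<longleftrightarrow> m dvd q * q + 1"
    using lens_root_power_eq_1[of "q * q + 1"] by (simp add: mult.commute)
  also have "\<dots> \<longleftrightarrow> int m dvd int (q * q + 1)" by (simp only: int_dvd_int_iff)
  finally show ?thesis by (simp add: cong_iff_dvd_diff power2_eq_square add.commute)
qed

text \<open>The symmetrization \<open>\<rho> + \<rho>\<^sup>-\<^sup>1\<close> of the generator acts by distinct real scalars on the two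
  coordinate axes, and \<open>T\<close> conjugates it to \<open>\<rho>\<^sup>k + \<rho>\<^sup>-\<^sup>k\<close>; hence \<open>T\<close> preserves or exchanges the axes.\<close>

lemma normalizer_axes:
  assumes T: "orthogonal_transformation T" and k: "\<And>x. T (rot x) = (rot ^^ k) (T x)"
  obtains A B where "orthogonal_transformation A" "orthogonal_transformation B"
    "(\<forall>z w. T (z, w) = (A z, B w)) \<or> (\<forall>z w. T (z, w) = (B w, A z))"
proof -
  have lin: "linear T" using T by (rule orthogonal_transformation_linear)
  have split: "T (z, w) = T (z, 0) + T (0, w)" for z w
    using linear_add[OF lin, of "(z, 0)" "(0, w)"] by simp
  have nT: "norm (T x) = norm x" for x using T by (rule orthogonal_transformation_norm)
  define c1 where "c1 = Re (lens_root m)"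
  define c2 where "c2 = Re (lens_root m ^ q)"
  define d1 where "d1 = Re (lens_root m ^ k)"
  define d2 where "d2 = Re (lens_root m ^ (q * k))"
  have c12: "c1 \<noteq> c2" using root_q_facts by (simp add: c1_def c2_def)
  have k': "T ((rot ^^ (m - 1)) x) = (rot ^^ (k * (m - 1))) (T x)" for x
    by (rule normalizes_funpow) (rule k)
  have sum: "(rot ^^ j) (z, w) + (rot ^^ (j * (m - 1))) (z, w)
      = ((2 * Re (lens_root m ^ j)) *\<^sub>R z, (2 * Re (lens_root m ^ (q * j))) *\<^sub>R w)" for j z w
    using lens_root_inverse[of j] lens_root_inverse[of "q * j"] 
    by (simp add: lens_rotation_funpow mult.assoc[symmetric] distrib_right[symmetric] complex_add_cnj
        scaleR_conv_of_real del: complex_cnj_power)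
  have main: "T ((2 * c1) *\<^sub>R z, (2 * c2) *\<^sub>R w) =
      ((2 * d1) *\<^sub>R fst (T (z, w)), (2 * d2) *\<^sub>R snd (T (z, w)))" for z w
  proof -
    have "T ((2 * c1) *\<^sub>R z, (2 * c2) *\<^sub>R w) = T (rot (z, w) + (rot ^^ (m - 1)) (z, w))"
      using sum[of 1 z w] by (simp add: c1_def c2_def)
    also have "\<dots> = (rot ^^ k) (T (z, w)) + (rot ^^ (k * (m - 1))) (T (z, w))"
      unfolding linear_add[OF lin] k k' ..
    also have "\<dots> = ((2 * d1) *\<^sub>R fst (T (z, w)), (2 * d2) *\<^sub>R snd (T (z, w)))"
      using sum[of k "fst (T (z, w))" "snd (T (z, w))"] by (simp add: d1_def d2_def)
    finally show ?thesis .
  qed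
  have E: "c1 *\<^sub>R fst (T (z, 0)) = d1 *\<^sub>R fst (T (z, 0))" "c1 *\<^sub>R snd (T (z, 0)) = d2 *\<^sub>R snd (T (z, 0))"
    "c2 *\<^sub>R fst (T (0, z)) = d1 *\<^sub>R fst (T (0, z))" "c2 *\<^sub>R snd (T (0, z)) = d2 *\<^sub>R snd (T (0, z))" for z
  proof -
    have "T ((2 * c1) *\<^sub>R (z, 0)) = ((2 * d1) *\<^sub>R fst (T (z, 0)), (2 * d2) *\<^sub>R snd (T (z, 0)))"
      using main[of z 0] by simp
    then show "c1 *\<^sub>R fst (T (z, 0)) = d1 *\<^sub>R fst (T (z, 0))" "c1 *\<^sub>R snd (T (z, 0)) = d2 *\<^sub>R snd (T (z, 0))"
      unfolding linear_scale[OF lin] by (auto simp: prod_eq_iff)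
    have "T ((2 * c2) *\<^sub>R (0, z)) = ((2 * d1) *\<^sub>R fst (T (0, z)), (2 * d2) *\<^sub>R snd (T (0, z)))"
      using main[of 0 z] by simp
    then show "c2 *\<^sub>R fst (T (0, z)) = d1 *\<^sub>R fst (T (0, z))" "c2 *\<^sub>R snd (T (0, z)) = d2 *\<^sub>R snd (T (0, z))"
      unfolding linear_scale[OF lin] by (auto simp: prod_eq_iff)
  qed
  have n1: "norm (T (1, 0)) = 1" "norm (T (0, 1)) = 1" using nT by (simp_all add: norm_Pair)
  show ?thesis
  proof (cases "d1 = c1")
    case True
    have f0: "fst (T (0, z)) = 0" for z using E(3)[of z] True c12 by simp
    then have "snd (T (0, 1)) \<noteq> 0" using n1(2) f0[of 1] by (cases "T (0, 1)") (auto simp: norm_Pair)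
    then have "d2 = c2" using E(4)[of 1] by simp
    then have s0: "snd (T (z, 0)) = 0" for z using E(2)[of z] c12 by simp
    define A where "A z = fst (T (z, 0))" for z
    define B where "B z = snd (T (0, z))" for z
    have TA: "T (z, 0) = (A z, 0)" and TB: "T (0, z) = (0, B z)" for z
      using s0[of z] f0[of z] by (simp_all add: A_def B_def prod_eq_iff)
    have "orthogonal_transformation A"
      by (rule orthogonal_transformation_coordinate[where T = T and A = A and e = "\<lambda>z. (z, 0)" and p = fst and f = "\<lambda>z. (z, 0)", OF T])
        (simp_all add: linear_axes norm_Pair TA)
    moreover have "orthogonal_transformation B"
      by (rule orthogonal_transformation_coordinate[where T = T and A = B and e = "\<lambda>z. (0, z)" and p = snd and f = "\<lambda>z. (0, z)", OF T])
        (simp_all add: linear_axes norm_Pair TB)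
    moreover have "\<forall>z w. T (z, w) = (A z, B w)" using split TA TB by simp
    ultimately show ?thesis using that by blast
  next
    case False
    have f0: "fst (T (z, 0)) = 0" for z using E(1)[of z] False by simp
    then have "snd (T (1, 0)) \<noteq> 0" using n1(1) f0[of 1] by (cases "T (1, 0)") (auto simp: norm_Pair)
    then have "d2 = c1" using E(2)[of 1] by simp
    then have s0: "snd (T (0, z)) = 0" for z using E(4)[of z] c12 by simp
    define A where "A z = snd (T (z, 0))" for z
    define B where "B z = fst (T (0, z))" for z
    have TA: "T (z, 0) = (0, A z)" and TB: "T (0, z) = (B z, 0)" for z
      using s0[of z] f0[of z] by (simp_all add: A_def B_def prod_eq_iff)
    have "orthogonal_transformation A"
      by (rule orthogonal_transformation_coordinate[where T = T and A = A and e = "\<lambda>z. (z, 0)" and p = snd and f = "\<lambda>z. (0, z)", OF T])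
        (simp_all add: linear_axes norm_Pair TA)
    moreover have "orthogonal_transformation B"
      by (rule orthogonal_transformation_coordinate[where T = T and A = B and e = "\<lambda>z. (0, z)" and p = fst and f = "\<lambda>z. (z, 0)", OF T])
        (simp_all add: linear_axes norm_Pair TB)
    moreover have "\<forall>z w. T (z, w) = (B w, A z)" using split TA TB by simp
    ultimately show ?thesis using that by blast
  qed
qed

text \<open>One axis determines the exponent \<open>k\<close> in the normalizing relation and the other axis restricts it. A map
  that preserves the axes has \<open>k = \<plusminus>1\<close>, and it is complex linear on both or on neither because \<open>\<xi>\<^sup>q\<close> is not
  real; for a map that exchanges them \<open>k = \<plusminus>q\<close>, and \<open>q\<^sup>2\<close> is \<open>1\<close> or \<open>-1\<close> according to whether it is of the
  same kind on both axes.\<close>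

lemma normalizer_monomial:
  assumes T: "orthogonal_transformation T" and nrm: "normalizes_deck m q T"
  obtains u v where "cmod u = 1" "cmod v = 1"
    "(\<forall>z w. T (z, w) = (u * z, v * w)) \<or> (\<forall>z w. T (z, w) = (u * cnj z, v * cnj w)) \<or>
     [(int q)\<^sup>2 = 1] (mod int m) \<and>
       ((\<forall>z w. T (z, w) = (u * w, v * z)) \<or> (\<forall>z w. T (z, w) = (u * cnj w, v * cnj z))) \<or>
     [(int q)\<^sup>2 = - 1] (mod int m) \<and>
       ((\<forall>z w. T (z, w) = (u * w, v * cnj z)) \<or> (\<forall>z w. T (z, w) = (u * cnj w, v * z)))"
proof -
  obtain k where k: "\<And>x. T (rot x) = (rot ^^ k) (T x)" using nrm by (auto simp: normalizes_deck_def)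
  obtain A B where AB: "orthogonal_transformation A" "orthogonal_transformation B"
    "(\<forall>z w. T (z, w) = (A z, B w)) \<or> (\<forall>z w. T (z, w) = (B w, A z))"
    by (rule normalizer_axes[OF T k], rule that)
  let ?\<xi> = "lens_root m"
  obtain a where a: "cmod a = 1" "A = (\<lambda>z. a * z) \<or> A = (\<lambda>z. a * cnj z)"
    by (rule orthogonal_transformation_complex[OF AB(1)])
  obtain b where b: "cmod b = 1" "B = (\<lambda>z. b * z) \<or> B = (\<lambda>z. b * cnj z)"
    by (rule orthogonal_transformation_complex[OF AB(2)])
  have ne: "a \<noteq> 0" "b \<noteq> 0" using a(1) b(1) by auto
  have k1: "T (?\<xi>, ?\<xi> ^ q) = (rot ^^ k) (T (1, 1))" using k[of "(1, 1)"] by (simp add: lens_rotation_eq)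
  have pk: "?\<xi> ^ (q * k) = (?\<xi> ^ k) ^ q" by (simp add: power_mult[symmetric] mult.commute)
  from AB(3) show ?thesis
  proof
    assume T': "\<forall>z w. T (z, w) = (A z, B w)"
    have eA: "A ?\<xi> = ?\<xi> ^ k * A 1" and eB: "B (?\<xi> ^ q) = (?\<xi> ^ k) ^ q * B 1"
      using k1 by (simp_all add: T' lens_rotation_funpow pk)
    from a(2) b(2) show ?thesis
    proof (elim disjE)
      assume *: "A = (\<lambda>z. a * z)" "B = (\<lambda>z. b * z)"
      show ?thesis by (rule that[OF a(1) b(1)]) (use T' * in simp)
    next
      assume *: "A = (\<lambda>z. a * cnj z)" "B = (\<lambda>z. b * cnj z)"
      show ?thesis by (rule that[OF a(1) b(1)]) (use T' * in simp)
    next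
      assume *: "A = (\<lambda>z. a * z)" "B = (\<lambda>z. b * cnj z)"
      have "?\<xi> ^ k = ?\<xi>" using eA ne by (simp add: *)
      then have "?\<xi> ^ q = cnj (?\<xi> ^ q)" using eB ne by (simp add: *)
      then show ?thesis using root_q_facts(1) by blast
    next
      assume *: "A = (\<lambda>z. a * cnj z)" "B = (\<lambda>z. b * z)"
      have "?\<xi> ^ k = cnj ?\<xi>" using eA ne by (simp add: *)
      then have "?\<xi> ^ q = cnj (?\<xi> ^ q)" using eB ne by (simp add: *)
      then show ?thesis using root_q_facts(1) by blast
    qed
  next
    assume T': "\<forall>z w. T (z, w) = (B w, A z)"
    have eA: "A ?\<xi> = (?\<xi> ^ k) ^ q * A 1" and eB: "B (?\<xi> ^ q) = ?\<xi> ^ k * B 1"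
      using k1 by (simp_all add: T' lens_rotation_funpow pk)
    have qq: "(?\<xi> ^ q) ^ q = ?\<xi> ^ (q * q)" by (simp add: power_mult[symmetric])
    have cc: "x = cnj y \<longleftrightarrow> cnj x = y" for x y by auto
    from a(2) b(2) show ?thesis
    proof (elim disjE)
      assume *: "A = (\<lambda>z. a * z)" "B = (\<lambda>z. b * z)"
      have "?\<xi> ^ k = ?\<xi> ^ q" "?\<xi> = (?\<xi> ^ k) ^ q" using eA eB ne by (simp_all add: *)
      then have "?\<xi> ^ (q * q) = ?\<xi>" using qq by metis
      then show ?thesis unfolding square_one by (intro that[OF b(1) a(1)]) (use T' * in simp)
    next
      assume *: "A = (\<lambda>z. a * cnj z)" "B = (\<lambda>z. b * cnj z)"
      have "?\<xi> ^ k = cnj (?\<xi> ^ q)" "cnj ?\<xi> = (?\<xi> ^ k) ^ q" using eA eB ne by (simp_all add: *)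
      then have "cnj ?\<xi> = cnj (?\<xi> ^ (q * q))" using qq by (metis complex_cnj_power)
      then have "?\<xi> ^ (q * q) = ?\<xi>" by (metis complex_cnj_cancel_iff)
      then show ?thesis unfolding square_one by (intro that[OF b(1) a(1)]) (use T' * in simp)
    next
      assume *: "A = (\<lambda>z. a * z)" "B = (\<lambda>z. b * cnj z)"
      have "?\<xi> ^ k = cnj (?\<xi> ^ q)" "?\<xi> = (?\<xi> ^ k) ^ q" using eA eB ne by (simp_all add: *)
      then have "?\<xi> = cnj (?\<xi> ^ (q * q))" using qq by (metis complex_cnj_power)
      then have "?\<xi> ^ (q * q) = cnj ?\<xi>" unfolding cc[of "?\<xi>"] by simp
      then show ?thesis unfolding square_minus_one by (intro that[OF b(1) a(1)]) (use T' * in simp)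
    next
      assume *: "A = (\<lambda>z. a * cnj z)" "B = (\<lambda>z. b * z)"
      have "?\<xi> ^ k = ?\<xi> ^ q" "cnj ?\<xi> = (?\<xi> ^ k) ^ q" using eA eB ne by (simp_all add: *)
      then have "?\<xi> ^ (q * q) = cnj ?\<xi>" using qq by metis
      then show ?thesis unfolding square_minus_one by (intro that[OF b(1) a(1)]) (use T' * in simp)
    qed
  qed
qed

end

subsection \<open>The generic case\<close>

definition conj_both :: "complex \<times> complex \<Rightarrow> complex \<times> complex" where
  "conj_both = (\<lambda>(z, w). (cnj z, cnj w))"

context lens_general
begin

lemma normalizes_conj_both: "normalizes_deck m q conj_both"
  unfolding normalizes_deck_def
proof (rule exI[of _ "m - 1"], rule allI)
  fix x :: "complex \<times> complex"
  obtain z w where x: "x = (z, w)" by (cases x)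
  show "conj_both (rot x) = (rot ^^ (m - 1)) (conj_both x)"
  proof -
    have "lens_root m ^ (m - 1) = cnj (lens_root m)" "lens_root m ^ (q * (m - 1)) = cnj (lens_root m) ^ q"
      using lens_root_inverse[of 1] lens_root_inverse[of q] by simp_all
    then show ?thesis unfolding x lens_rotation_eq conj_both_def prod.case lens_rotation_funpow by simp
  qed
qed

lemma orthogonal_conj_both: "orthogonal_transformation conj_both"
  by (rule orthogonal_transformation_pairI) (auto intro!: linearI simp: conj_both_def norm_Pair)

lemma isom_generic:
  assumes "\<not> [(int q)\<^sup>2 = 1] (mod int m)" "\<not> [(int q)\<^sup>2 = - 1] (mod int m)"
  shows "topgroup_iso (isom_group (lens_space m q)) Dih_torus \<and>
         isom_pi0 (lens_space m q) \<cong> integer_mod_group 2"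
proof -
  let ?act = "\<lambda>(x, n::int). diag_map x \<circ> conj_both ^^ nat n"
  have KD: "Dih_torus = semidirect_cyclic torus 2 conj_both"
    by (simp add: Dih_torus_def conj_both_def)
  have "lens_action m q (semidirect_cyclic torus 2 conj_both) ?act"
  proof (rule lens_action_semidirect[OF compact_torus])
    show "cyclic_action torus 2 conj_both"
      by (auto simp: cyclic_action_def hom_def numeral_2_eq_2 conj_both_def)
    show "diag_map (x \<otimes>\<^bsub>torus\<^esub> y) = diag_map x \<circ> diag_map y" for x y
      by (cases x; cases y) (simp add: fun_eq_iff mult.assoc)
    show "conj_both \<circ> diag_map x = diag_map (conj_both x) \<circ> conj_both" for x
      by (cases x) (simp add: fun_eq_iff conj_both_def)
    show "(conj_both ^^ 2) z = z" for z by (cases z) (simp add: numeral_2_eq_2 conj_both_def)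
    show "orthogonal_transformation (diag_map x)" if "x \<in> carrier torus" for x
      using that orthogonal_diag_map by auto
    show "normalizes_deck m q (diag_map x)" for x using normalizes_diag by (cases x) simp
    show "continuous_map (gtopology torus) euclidean (\<lambda>x. diag_map x z)" for z
      unfolding topgroup_prod_simps circle_group_simps diag_map_def case_prod_beta
      by (intro continuous_map_Times_euclidean continuous_intros)
    fix T :: "complex \<times> complex \<Rightarrow> complex \<times> complex"
    assume T: "orthogonal_transformation T" "normalizes_deck m q T"
    obtain u v where uv: "cmod u = 1" "cmod v = 1"
      "(\<forall>z w. T (z, w) = (u * z, v * w)) \<or> (\<forall>z w. T (z, w) = (u * cnj z, v * cnj w))"
      by (rule normalizer_monomial[OF T]) (use assms in blast)
    then have "T = diag_map (u, v) \<circ> conj_both ^^ 0 \<or> T = diag_map (u, v) \<circ> conj_both ^^ 1"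
      by (auto simp: fun_eq_iff conj_both_def)
    then have "\<exists>j<2. T = diag_map (u, v) \<circ> conj_both ^^ j"
      by (metis one_less_numeral_iff pos2 semiring_norm(76))
    then show "\<exists>x\<in>carrier torus. \<exists>j<2. T = diag_map x \<circ> conj_both ^^ j"
      using uv by (intro bexI[of _ "(u, v)"]) auto
  qed (rule orthogonal_conj_both normalizes_conj_both)+
  then interpret lens_action m q Dih_torus ?act unfolding KD .
  have deck: "deck_map m q (?act ((u, v), n)) \<longleftrightarrow> n = 0 \<and> u ^ m = 1 \<and> v = u ^ q"
    if "n = 0 \<or> n = 1" "cmod u = 1" for u v n
  proof (cases "n = 0")
    case True
    then show ?thesis using deck_diag_iff[of u v] by (simp add: deck_map_iff)
  next
    case False
    then have "n = 1" "u \<noteq> 0" using that by auto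
    have "\<not> deck_map m q (?act ((u, v), n))"
    proof
      assume "deck_map m q (?act ((u, v), n))"
      from deck_map_axis(2)[OF this] \<open>u \<noteq> 0\<close> show False
        by (simp add: \<open>n = 1\<close> conj_both_def complex_eq_iff)
    qed
    then show ?thesis using False by simp
  qed
  \<comment> \<open>The kernel is the deck group \<open>{(u, u\<^sup>q) | u\<^sup>m = 1}\<close>.\<close>
  define p0 where "p0 = (\<lambda>(u, v). (u ^ m, v * cnj u ^ q) :: complex \<times> complex)"
  have m0: "m > 0" using m by simp
  have qh: "quotient_hom torus torus p0"
  proof (rule quotient_hom_compact[OF compact_torus])
    show "p0 \<in> hom torus torus"
      by (rule homI) (auto simp: p0_def norm_mult norm_power power_mult_distrib algebra_simps)
    show "continuous_map (gtopology torus) (gtopology torus) p0"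
    proof (rule continuous_map_torus)
      show "continuous_on (sphere 0 1 \<times> sphere 0 1) p0"
        unfolding p0_def case_prod_beta by (intro continuous_intros)
    qed (auto simp: p0_def norm_mult norm_power)
    show "p0 ` carrier torus = carrier torus"
    proof (intro equalityI subsetI)
      fix x assume "x \<in> carrier torus"
      then obtain u v where x: "x = (u, v)" "cmod u = 1" "cmod v = 1" by auto
      obtain r where r: "cmod r = 1" "r ^ m = u" using circle_root[OF x(2) m0] by blast
      have "r ^ q * cnj r ^ q = 1"
        using unit_mult_cnj(1)[OF r(1)] by (simp add: power_mult_distrib[symmetric])
      then have "p0 (r, v * r ^ q) = x" by (simp add: p0_def x r mult.assoc)
      moreover have "(r, v * r ^ q) \<in> carrier torus" using r x by (simp add: norm_mult norm_power)
      ultimately show "x \<in> p0 ` carrier torus" by blast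
    qed (auto simp: p0_def norm_mult norm_power)
  qed (auto simp: Hausdorff_space_subtopology)
  have "quotient_hom Dih_torus Dih_torus (\<lambda>(x, n). (p0 x, n))"
    unfolding KD by (rule quotient_hom_semidirect[OF qh]) (auto simp: conj_both_def p0_def)
  then have "topgroup_iso (isom_group (lens_space m q)) Dih_torus"
  proof (rule isom_group_iso)
    fix k assume "k \<in> carrier Dih_torus"
    then obtain u v n where k: "k = ((u, v), n)" "cmod u = 1" "cmod v = 1" "n = 0 \<or> n = 1"
      unfolding KD by (auto simp: mem_C2_iff)
    have "v * cnj u ^ q = 1 \<longleftrightarrow> v = u ^ q"
    proof -
      have "u ^ q * cnj u ^ q = 1"
        using unit_mult_cnj(1)[OF k(2)] by (simp add: power_mult_distrib[symmetric])
      then show ?thesis by (metis mult.commute mult.left_commute mult.right_neutral)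
    qed
    then show "(case k of (x, n) \<Rightarrow> (p0 x, n)) = (case \<one>\<^bsub>Dih_torus\<^esub> of (x, n) \<Rightarrow> (p0 x, n)) \<longleftrightarrow>
        deck_map m q (?act k)"
      unfolding k(1) deck[OF k(4,2)] unfolding KD by (auto simp: p0_def)
  qed
  moreover have "isom_pi0 (lens_space m q) \<cong> integer_mod_group 2"
  proof (rule isom_pi0_iso[of snd])
    note label = semidirect_label[OF _ compact_torus path_connected_torus, where k = 2 and \<phi> = conj_both, folded KD]
    show "snd \<in> hom Dih_torus (integer_mod_group 2)" "snd ` carrier Dih_torus = carrier (integer_mod_group 2)"
      "continuous_map (gtopology Dih_torus) (discrete_topology (carrier (integer_mod_group 2))) snd"
      by (rule label; simp)+
    show "path_connectedin (gtopology Dih_torus) {k \<in> carrier Dih_torus. snd k = d}"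
      if "d \<in> carrier (integer_mod_group 2)" for d
      using that by (intro label) auto
    fix k assume k: "k \<in> carrier Dih_torus" "deck_map m q (?act k)"
    obtain u v n where k': "k = ((u, v), n)" "cmod u = 1" "cmod v = 1" "n = 0 \<or> n = 1"
      using k(1) unfolding KD by (auto simp: mem_C2_iff)
    have "n = 0" using k(2) unfolding k'(1) deck[OF k'(4,2)] by blast
    then show "snd k = snd \<one>\<^bsub>Dih_torus\<^esub>" unfolding KD by (simp add: k')
  qed
  ultimately show ?thesis ..
qed

end

subsection \<open>The case \<open>q\<^sup>2 \<equiv> -1\<close>\<close>

text \<open>The numbers come from a factorization \<open>r + \<i> = (a + b\<i>)(c + d\<i>)\<close> in the Gaussian integers with first
  factor of norm \<open>m\<close>, for some \<open>r \<equiv> q\<close>; the last equation compares imaginary parts. If \<open>r\<close> is reduced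
  modulo \<open>m\<close>, then \<open>n = (r\<^sup>2 + 1) / m\<close> is smaller than \<open>m\<close>, the descent provides the factor \<open>c + d\<i>\<close> of norm
  \<open>n\<close>, and \<open>a + b\<i>\<close> is the quotient.\<close>

lemma gaussian_factor:
  fixes m q :: int
  assumes "m > 0" "m dvd q\<^sup>2 + 1"
  shows "\<exists>a b c d. a\<^sup>2 + b\<^sup>2 = m \<and> m dvd a - q * b \<and> a * d + b * c = 1"
  using assms
proof (induction "nat m" arbitrary: m q rule: less_induct)
  case less
  show ?case
  proof (cases "m = 1")
    case True
    show ?thesis by (rule exI[of _ 1], rule exI[of _ 0], rule exI[of _ 0], rule exI[of _ 1]) (simp add: True)
  next
    case False
    then have m2: "m \<ge> 2" using less.prems by simp
    \<comment> \<open>The representative of \<open>q\<close> of least absolute value makes the cofactor smaller than \<open>m\<close>.\<close>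
    define r where "r = (q + m div 2) mod m - m div 2"
    have qr: "m dvd q - r"
    proof -
      have "q - r = q + m div 2 - (q + m div 2) mod m" by (simp add: r_def)
      then show ?thesis by (simp add: minus_mod_eq_mult_div)
    qed
    have bnd: "0 \<le> (q + m div 2) mod m" "(q + m div 2) mod m < m" using m2 by auto
    have "2 * (m div 2) \<le> m" "m \<le> 2 * (m div 2) + 1" by auto
    then have "2 * r \<le> m" "- m \<le> 2 * r" using bnd by (auto simp: r_def)
    then have "\<bar>2 * r\<bar> \<le> m" by linarith
    then have "(2 * r)\<^sup>2 \<le> m\<^sup>2" by (meson abs_le_square_iff abs_of_pos less.prems(1) order_trans abs_ge_self)
    then have r4: "4 * r\<^sup>2 \<le> m * m" by (simp add: power2_eq_square)
    have "m dvd r\<^sup>2 + 1"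
    proof -
      have "q\<^sup>2 + 1 - (r\<^sup>2 + 1) = (q - r) * (q + r)" by (simp add: power2_eq_square algebra_simps)
      then have "m dvd q\<^sup>2 + 1 - (r\<^sup>2 + 1)" using qr by simp
      then show ?thesis using less.prems(2) dvd_diff_left_iff dvd_diff_commute by blast
    qed
    then obtain n where n: "r\<^sup>2 + 1 = m * n" by (auto simp: dvd_def)
    have n0: "n > 0"
    proof (rule ccontr)
      assume "\<not> n > 0"
      then have "m * n \<le> 0" using m2 by (simp add: mult_nonneg_nonpos)
      then show False using n zero_le_power2[of r] by linarith
    qed
    have "n < m"
    proof (rule ccontr)
      assume "\<not> n < m"
      then have "m * m \<le> m * n" using m2 by simp
      moreover have "4 \<le> m * m" using mult_mono[OF m2 m2] m2 by simp
      ultimately show False using r4 n by linarith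
    qed
    then have "nat n < nat m" using m2 by simp
    moreover have "n dvd r\<^sup>2 + 1" unfolding n by simp
    ultimately obtain c d e f where IH: "c\<^sup>2 + d\<^sup>2 = n" "n dvd c - r * d" "c * f + d * e = 1"
      using less.hyps[of n r] n0 by blast
    have "n dvd r * c + d"
    proof -
      have "r * (c - r * d) + d * (r\<^sup>2 + 1) = r * c + d" by (simp add: power2_eq_square algebra_simps)
      moreover have "n dvd r * (c - r * d) + d * (r\<^sup>2 + 1)" using IH(2) n by simp
      ultimately show ?thesis by simp
    qed
    then obtain a where a: "r * c + d = n * a" by (auto simp: dvd_def)
    obtain b where b: "c - r * d = n * b" using IH(2) by (auto simp: dvd_def)
    have "n * n * (a\<^sup>2 + b\<^sup>2) = (n * a)\<^sup>2 + (n * b)\<^sup>2" by (simp add: power2_eq_square algebra_simps)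
    also have "\<dots> = (c\<^sup>2 + d\<^sup>2) * (r\<^sup>2 + 1)"
      unfolding a[symmetric] b[symmetric] by (simp add: power2_eq_square algebra_simps)
    also have "\<dots> = n * n * m" using IH(1) n by (simp add: algebra_simps)
    finally have 1: "a\<^sup>2 + b\<^sup>2 = m" using n0 by simp
    have "n * (a - r * b) = d * (r\<^sup>2 + 1)"
      unfolding right_diff_distrib a[symmetric] mult.left_commute[of n r b] b[symmetric]
      by (simp add: power2_eq_square algebra_simps)
    also have "\<dots> = n * (m * d)" using n by (simp add: algebra_simps)
    finally have "a - r * b = m * d" using n0 by simp
    then have "a - q * b = m * d - (q - r) * b" by (simp add: algebra_simps)
    then have 2: "m dvd a - q * b" using qr by simp
    have "n * (a * d + b * c) = (r * c + d) * d + (c - r * d) * c"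
      unfolding a b by (simp add: algebra_simps)
    also have "\<dots> = n * 1" using IH(1) by (simp add: power2_eq_square algebra_simps)
    finally have 3: "a * d + b * c = 1" using n0 by simp
    from 1 2 3 show ?thesis by blast
  qed
qed

text \<open>Multiplication by \<open>a + b\<i>\<close> on \<open>\<complex> / \<int>[\<i>]\<close>, where the class of \<open>y + x\<i>\<close> is the pair
  \<open>(exp (2\<pi>\<i>x), exp (2\<pi>\<i>y))\<close>.\<close>

definition gauss_mult :: "int \<Rightarrow> int \<Rightarrow> complex \<times> complex \<Rightarrow> complex \<times> complex" where
  "gauss_mult a b = (\<lambda>(u, v). (u powi a * v powi b, v powi a * u powi (- b)))"

definition quarter_turn :: "complex \<times> complex \<Rightarrow> complex \<times> complex" where
  "quarter_turn = (\<lambda>(z, w). (w, cnj z))"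

lemma cnj_unit: "cmod u = 1 \<Longrightarrow> cnj u = inverse u"
  using unit_mult_cnj(2)[of u] by (metis inverse_unique mult.commute)

lemmas unit_power_simps = power_int_mult_distrib power_int_inverse power_int_minus cnj_unit norm_inverse
  norm_mult norm_power_int

lemma gauss_mult_comp:
  assumes "cmod u = 1" "cmod v = 1"
  shows "gauss_mult a b (gauss_mult c d (u, v)) = gauss_mult (a * c - b * d) (a * d + b * c) (u, v)"
proof -
  have nz: "u \<noteq> 0" "v \<noteq> 0" using assms by auto
  have "gauss_mult a b (gauss_mult c d (u, v)) =
     (u powi (c * a + (- d) * b) * v powi (d * a + c * b), v powi (c * a + d * (- b)) * u powi ((- d) * a + c * (- b)))"
    by (simp only: gauss_mult_def prod.case power_int_mult_distrib power_int_add[OF disjI1[OF nz(1)]]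
        power_int_add[OF disjI1[OF nz(2)]] power_int_mult mult_ac[where 'a = complex])
  also have "\<dots> = gauss_mult (a * c - b * d) (a * d + b * c) (u, v)"
    by (simp add: gauss_mult_def algebra_simps)
  finally show ?thesis .
qed

lemma gauss_mult_closed:
  assumes "x \<in> carrier torus"
  shows "gauss_mult a b x \<in> carrier torus"
  using assms by (auto simp: gauss_mult_def unit_power_simps)

lemma gauss_mult_hom: "gauss_mult a b \<in> hom torus torus"
proof (rule homI)
  show "gauss_mult a b (x \<otimes>\<^bsub>torus\<^esub> y) = gauss_mult a b x \<otimes>\<^bsub>torus\<^esub> gauss_mult a b y" for x y
    by (cases x; cases y) (simp add: gauss_mult_def power_int_mult_distrib mult_ac)
qed (rule gauss_mult_closed)

lemma quotient_hom_gauss_mult: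
  assumes "a\<^sup>2 + b\<^sup>2 > 0"
  shows "quotient_hom torus torus (gauss_mult a b)"
proof (rule quotient_hom_compact[OF compact_torus gauss_mult_hom])
  show "continuous_map (gtopology torus) (gtopology torus) (gauss_mult a b)"
  proof (rule continuous_map_torus)
    show "continuous_on (sphere 0 1 \<times> sphere 0 1) (gauss_mult a b)"
      unfolding gauss_mult_def case_prod_beta by (intro continuous_intros) auto
    show "gauss_mult a b x \<in> sphere 0 1 \<times> sphere 0 1" if "x \<in> sphere 0 1 \<times> sphere 0 1" for x
      using gauss_mult_closed[of x a b] that by simp
  qed
  \<comment> \<open>Composing with the conjugate \<open>a - b\<i>\<close> gives the power map with exponent \<open>a\<^sup>2 + b\<^sup>2\<close>.\<close>
  show "gauss_mult a b ` carrier torus = carrier torus"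
  proof (intro equalityI subsetI)
    fix x assume "x \<in> carrier torus"
    then obtain u v where x: "x = (u, v)" "cmod u = 1" "cmod v = 1" by auto
    define n where "n = nat (a\<^sup>2 + b\<^sup>2)"
    have n: "n > 0" "int n = a\<^sup>2 + b\<^sup>2" using assms by (auto simp: n_def)
    obtain r where r: "cmod r = 1" "r ^ n = u" using circle_root[OF x(2) n(1)] by blast
    obtain s where s: "cmod s = 1" "s ^ n = v" using circle_root[OF x(3) n(1)] by blast
    have "gauss_mult a b (gauss_mult a (- b) (r, s)) = gauss_mult (int n) 0 (r, s)"
      unfolding gauss_mult_comp[OF r(1) s(1)] n(2) by (simp add: power2_eq_square)
    also have "\<dots> = x" by (simp add: gauss_mult_def x r s power_int_of_nat)
    finally have "x = gauss_mult a b (gauss_mult a (- b) (r, s))" by simp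
    moreover have "gauss_mult a (- b) (r, s) \<in> carrier torus"
      by (rule gauss_mult_closed) (simp add: r s)
    ultimately show "x \<in> gauss_mult a b ` carrier torus" by (rule image_eqI)
  qed (use gauss_mult_closed in blast)
qed (auto simp: Hausdorff_space_subtopology)

lemma gauss_mult_quarter_turn:
  assumes "x \<in> carrier torus"
  shows "gauss_mult a b (quarter_turn x) = quarter_turn (gauss_mult a b x)"
  using assms by (auto simp: gauss_mult_def quarter_turn_def unit_power_simps mult.commute)

text \<open>Under \<open>S\<^sup>1 \<times> S\<^sup>1 = \<complex> / \<int>[\<i>]\<close>, where the quarter turn acts as a unit, the deck group is the kernel of
  multiplication by \<open>a + b\<i>\<close> and \<open>\<plusminus>(1, 1)\<close> is the kernel of multiplication by \<open>1 + \<i>\<close>. Since these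
  multiplications commute, pulling the first back along the second or conversely gives the same group.\<close>

lemma gauss_kernel:
  assumes uv: "cmod u = 1" "cmod v = 1"
    and ab: "a\<^sup>2 + b\<^sup>2 = int m" "int m dvd b - int q * a" "int m dvd a + int q * b" "a * c + b * d = 1"
  shows "(u * v) ^ m = 1 \<and> v * cnj u = (u * v) ^ q \<longleftrightarrow>
         gauss_mult a b (u, v) = (1, 1) \<or> gauss_mult a b (u, v) = (- 1, - 1)"
proof -
  define s t where "s = u * v" and "t = v * cnj u"
  have nz: "u \<noteq> 0" "v \<noteq> 0" "s \<noteq> 0" "t \<noteq> 0" using uv by (auto simp: s_def t_def)
  define P Q where "P = fst (gauss_mult a b (u, v))" and "Q = snd (gauss_mult a b (u, v))"
  have P: "P = u powi a * v powi b" and Q: "Q = v powi a * u powi (- b)"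
    by (simp_all add: P_def Q_def gauss_mult_def)
  have PQ: "P * Q = s powi a * t powi b"
    by (simp add: P Q s_def t_def uv unit_power_simps mult_ac)
  have Pnz: "P \<noteq> 0" using nz by (simp add: P)
  have QP: "Q * inverse P = t powi a * s powi (- b)"
    using nz by (simp add: P Q s_def t_def uv unit_power_simps mult_ac)
  have "gauss_mult a b (u, v) = (1, 1) \<or> gauss_mult a b (u, v) = (- 1, - 1) \<longleftrightarrow>
      (P = 1 \<and> Q = 1) \<or> (P = -1 \<and> Q = -1)"
    by (auto simp: P_def Q_def prod_eq_iff)
  also have "\<dots> \<longleftrightarrow> P * Q = 1 \<and> Q * inverse P = 1"
  proof
    assume *: "P * Q = 1 \<and> Q * inverse P = 1"
    then have "Q = P" using Pnz by (simp add: field_simps)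
    then have "P = 1 \<or> P = -1" using * by (simp add: square_eq_1_iff)
    then show "(P = 1 \<and> Q = 1) \<or> (P = -1 \<and> Q = -1)" using \<open>Q = P\<close> by auto
  qed auto
  also have "\<dots> \<longleftrightarrow> s powi a * t powi b = 1 \<and> t powi a * s powi (- b) = 1"
    unfolding PQ QP ..
  also have "\<dots> \<longleftrightarrow> s ^ m = 1 \<and> t = s ^ q"
  proof
    assume *: "s ^ m = 1 \<and> t = s ^ q"
    have one: "s powi k = 1" if "int m dvd k" for k
    proof -
      obtain l where "k = int m * l" using \<open>int m dvd k\<close> by (auto simp: dvd_def)
      then show ?thesis using * by (simp add: power_int_mult)
    qed
    have t: "t = s powi (int q)" using * by (simp add: power_int_of_nat)
    have tk: "t powi k = s powi (int q * k)" for k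
      unfolding t by (simp only: power_int_mult)
    have "s powi a * t powi b = s powi (a + int q * b)"
      unfolding tk power_int_add[OF disjI1[OF nz(3)]] ..
    moreover have "t powi a * s powi (- b) = s powi (- (b - int q * a))"
    proof -
      have "t powi a * s powi (- b) = s powi (int q * a + (- b))"
        unfolding tk power_int_add[OF disjI1[OF nz(3)]] ..
      also have "int q * a + (- b) = - (b - int q * a)" by simp
      finally show ?thesis .
    qed
    ultimately show "s powi a * t powi b = 1 \<and> t powi a * s powi (- b) = 1"
      using one[of "a + int q * b"] one[of "- (b - int q * a)"] ab(2,3) by (simp only: dvd_minus_iff simp_thms)
  next
    assume *: "s powi a * t powi b = 1 \<and> t powi a * s powi (- b) = 1"
    then have tb: "t powi b = s powi (- a)" and ta: "t powi a = s powi b"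
      using nz by (simp_all add: power_int_minus field_simps)
    have tk: "t powi (a * k + b * l) = s powi (b * k - a * l)" for k l
    proof -
      have "t powi (a * k + b * l) = (t powi a) powi k * (t powi b) powi l"
        using nz by (simp add: power_int_add power_int_mult)
      also have "\<dots> = s powi (b * k) * s powi (- a * l)"
        unfolding ta tb by (simp only: power_int_mult)
      also have "\<dots> = s powi (b * k - a * l)"
        using nz by (simp add: power_int_add[symmetric])
      finally show ?thesis .
    qed
    have "s powi (a * a + b * b) = s powi (a * a) * (t powi a) powi b"
      unfolding ta using nz by (simp add: power_int_add power_int_mult)
    also have "(t powi a) powi b = (t powi b) powi a"
      by (simp add: power_int_mult[symmetric] mult.commute)
    also have "s powi (a * a) * (t powi b) powi a = 1"
      unfolding tb power_int_mult[symmetric] power_int_add[OF disjI1[OF nz(3)], symmetric] by simp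
    finally have "s powi (int m) = 1" using ab(1) by (simp add: power2_eq_square)
    then have sm: "s ^ m = 1" by (simp add: power_int_of_nat)
    have "t = t powi (a * c + b * d)" using ab(4) by simp
    also have "\<dots> = s powi (b * c - a * d)" by (rule tk)
    also have "b * c - a * d = int q * (a * c + b * d) + ((b - int q * a) * c - (a + int q * b) * d)"
      by (simp add: algebra_simps)
    also have "s powi \<dots> = s powi (int q)"
    proof -
      obtain l where "(b - int q * a) * c - (a + int q * b) * d = int m * l"
        using ab(2,3) by (metis dvd_def dvd_diff dvd_mult2)
      then show ?thesis
        using nz sm by (simp add: ab(4) power_int_add power_int_mult power_int_of_nat)
    qed
    finally show "s ^ m = 1 \<and> t = s ^ q" using sm by (simp add: power_int_of_nat)
  qed
  finally show ?thesis by (simp add: s_def t_def)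
qed

text \<open>The diagonal action preceded by multiplication by \<open>1 + \<i>\<close>, a double cover of the torus by itself that
  matches the twisted product in the model group.\<close>

definition half_turn_action :: "complex \<times> complex \<Rightarrow> complex \<times> complex \<Rightarrow> complex \<times> complex" where
  "half_turn_action = (\<lambda>(u, v). diag_map (u * v, v * cnj u))"

context lens_general
begin

lemma orthogonal_quarter_turn: "orthogonal_transformation quarter_turn"
proof (rule orthogonal_transformation_pairI)
  show "linear quarter_turn" by (rule linearI) (auto simp: quarter_turn_def)
  show "norm (quarter_turn (z, w)) = norm (z, w)" for z w
    by (simp add: quarter_turn_def norm_Pair)
qed

lemma isom_quarter_turn:
  assumes sq: "[(int q)\<^sup>2 = - 1] (mod int m)"
  shows "topgroup_iso (isom_group (lens_space m q))
          (semidirect_cyclic (circle_group \<times>\<^sub>~ circle_group) 4 (\<lambda>A. (\<lambda>(z, w). (w, cnj z)) ` A)) \<and>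
        isom_pi0 (lens_space m q) \<cong> integer_mod_group 4"
proof -
  let ?act = "\<lambda>(x, n::int). half_turn_action x \<circ> quarter_turn ^^ nat n"
  let ?K = "semidirect_cyclic torus 4 quarter_turn"
  have not1: "\<not> [(int q)\<^sup>2 = 1] (mod int m)"
  proof
    assume "[(int q)\<^sup>2 = 1] (mod int m)"
    then have "[1 = - 1] (mod int m)" using sq by (metis cong_sym cong_trans)
    then have "int m dvd 2" by (simp add: cong_iff_dvd_diff)
    then show False using q by (auto dest: zdvd_imp_le)
  qed
  have turn: "(quarter_turn ^^ 0) x = x" "(quarter_turn ^^ 1) x = quarter_turn x"
    "(quarter_turn ^^ 2) x = conj_both x" "(quarter_turn ^^ 3) x = (cnj (snd x), fst x)" for x
    by (cases x; simp add: quarter_turn_def conj_both_def numeral_2_eq_2 numeral_3_eq_3)+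
  have four: "(quarter_turn ^^ 4) z = z" for z
    by (cases z) (simp add: quarter_turn_def numeral_eq_Suc)
  have LA: "lens_action m q ?K ?act"
  proof (rule lens_action_semidirect[OF compact_torus])
    show "cyclic_action torus 4 quarter_turn"
    proof -
      have "quarter_turn \<in> hom torus torus"
        by (rule homI) (auto simp: quarter_turn_def)
      then show ?thesis using four by (simp add: cyclic_action_def)
    qed
    show "half_turn_action (x \<otimes>\<^bsub>torus\<^esub> y) = half_turn_action x \<circ> half_turn_action y" for x y
      by (cases x; cases y) (simp add: fun_eq_iff half_turn_action_def mult_ac)
    show "quarter_turn \<circ> half_turn_action x = half_turn_action (quarter_turn x) \<circ> quarter_turn" for x
      by (cases x) (simp add: fun_eq_iff quarter_turn_def half_turn_action_def mult_ac)
    show "(quarter_turn ^^ 4) z = z" for z by (rule four)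
    show "orthogonal_transformation (half_turn_action x)" if "x \<in> carrier torus" for x
      using that orthogonal_diag_map by (auto simp: half_turn_action_def norm_mult)
    show "normalizes_deck m q (half_turn_action x)" for x
      using normalizes_diag by (cases x) (simp add: half_turn_action_def)
    show "orthogonal_transformation quarter_turn" by (rule orthogonal_quarter_turn)
    show "normalizes_deck m q quarter_turn"
      unfolding normalizes_deck_def
    proof (rule exI[of _ q], rule allI)
      fix x :: "complex \<times> complex"
      obtain z w where x: "x = (z, w)" by (cases x)
      show "quarter_turn (rot x) = (rot ^^ q) (quarter_turn x)"
        using sq unfolding square_minus_one[symmetric]
        by (simp add: x quarter_turn_def lens_rotation_eq lens_rotation_funpow)
    qed
    show "continuous_map (gtopology torus) euclidean (\<lambda>x. half_turn_action x z)" for z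
      unfolding topgroup_prod_simps circle_group_simps diag_map_def half_turn_action_def case_prod_beta
      by (intro continuous_map_Times_euclidean continuous_intros)
    fix T :: "complex \<times> complex \<Rightarrow> complex \<times> complex"
    assume T: "orthogonal_transformation T" "normalizes_deck m q T"
    obtain u v where uv: "cmod u = 1" "cmod v = 1"
      "(\<forall>z w. T (z, w) = (u * z, v * w)) \<or> (\<forall>z w. T (z, w) = (u * cnj z, v * cnj w)) \<or>
       (\<forall>z w. T (z, w) = (u * w, v * cnj z)) \<or> (\<forall>z w. T (z, w) = (u * cnj w, v * z))"
      by (rule normalizer_monomial[OF T]) (use not1 in blast)
    obtain r where r: "cmod r = 1" "r\<^sup>2 = u * cnj v"
      using circle_root[of "u * cnj v" 2] uv by (auto simp: norm_mult)
    have vv: "v * cnj v = 1" and rr: "r * cnj r = 1" using uv r by (simp_all add: unit_mult_cnj)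
    have e1: "r * (v * r) = u" 
    proof -
      have "r * (v * r) = v * r\<^sup>2" by (simp add: power2_eq_square mult_ac)
      also have "\<dots> = u * (v * cnj v)" unfolding r(2) by (simp add: mult_ac)
      finally show ?thesis by (simp add: vv)
    qed
    have e2: "v * r * cnj r = v" using rr by (simp add: mult.assoc)
    have h: "half_turn_action (r, v * r) (z, w) = (u * z, v * w)" for z w
      by (simp add: half_turn_action_def e1 e2)
    have "(\<forall>x. T x = half_turn_action (r, v * r) ((quarter_turn ^^ 0) x)) \<or>
        (\<forall>x. T x = half_turn_action (r, v * r) ((quarter_turn ^^ 1) x)) \<or>
        (\<forall>x. T x = half_turn_action (r, v * r) ((quarter_turn ^^ 2) x)) \<or>
        (\<forall>x. T x = half_turn_action (r, v * r) ((quarter_turn ^^ 3) x))"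
      using uv(3) unfolding turn split_paired_All by (simp add: quarter_turn_def conj_both_def h) blast
    then have "\<exists>j \<in> {0, 1, 2, 3}. \<forall>x. T x = half_turn_action (r, v * r) ((quarter_turn ^^ j) x)" by blast
    then obtain j where j: "j \<in> {0, 1, 2, 3}" "\<forall>x. T x = half_turn_action (r, v * r) ((quarter_turn ^^ j) x)"
      by (rule bexE)
    have "T = half_turn_action (r, v * r) \<circ> quarter_turn ^^ j"
      by (rule ext) (simp only: comp_apply j(2)[rule_format])
    moreover have "j < 4" using j(1) by auto
    moreover have "(r, v * r) \<in> carrier torus" using r uv by (simp add: norm_mult)
    ultimately show "\<exists>x\<in>carrier torus. \<exists>j<4. T = half_turn_action x \<circ> quarter_turn ^^ j"
      by blast
  qed
  interpret lens_action m q ?K ?act by (rule LA)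
  have mem4: "n \<in> carrier (integer_mod_group 4) \<longleftrightarrow> n \<in> {0, 1, 2, 3}" for n
    by (auto simp: carrier_integer_mod_group)
  have deck: "deck_map m q (?act ((u, v), n)) \<longleftrightarrow> n = 0 \<and> (u * v) ^ m = 1 \<and> v * cnj u = (u * v) ^ q"
    if n: "n \<in> {0, 1, 2, 3}" and uv: "cmod u = 1" "cmod v = 1" for u v n
  proof (cases "n = 0")
    case True
    then show ?thesis using deck_diag_iff[of "u * v" "v * cnj u"] by (simp add: deck_map_iff half_turn_action_def)
  next
    case False
    have nz: "u \<noteq> 0" "v \<noteq> 0" using uv by auto
    have "\<not> deck_map m q (?act ((u, v), n))"
    proof
      assume d: "deck_map m q (?act ((u, v), n))"
      consider "n = 1" | "n = 2" | "n = 3" using n False by auto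
      then show False
      proof cases
        case 1
        then show ?thesis using deck_map_axis(1)[OF d, of 1] nz
          by (simp add: half_turn_action_def quarter_turn_def)
      next
        case 2
        have "(quarter_turn ^^ 2) (z, w) = (cnj z, cnj w)" for z w
          unfolding turn conj_both_def by simp
        then have "u * v * (- \<i>) = \<i> * (u * v)"
          using deck_map_axis(2)[OF d] 2 by (simp add: half_turn_action_def)
        then have "2 * (\<i> * (u * v)) = 0" by algebra
        then show ?thesis using nz by simp
      next
        case 3
        have "(quarter_turn ^^ 3) (z, w) = (cnj w, z)" for z w
          unfolding turn by simp
        then show ?thesis using deck_map_axis(1)[OF d, of 1] nz 3
          by (simp add: half_turn_action_def)
      qed
    qed
    then show ?thesis using False by simp
  qed
  obtain a b c d where ab: "a\<^sup>2 + b\<^sup>2 = int m" "int m dvd b - int q * a" "int m dvd a + int q * b" "a * c + b * d = 1"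
  proof -
    have "int m dvd (int q)\<^sup>2 + 1" using sq by (simp add: cong_iff_dvd_diff)
    moreover have "int m > 0" using m by simp
    ultimately obtain b a c d where *: "b\<^sup>2 + a\<^sup>2 = int m" "int m dvd b - int q * a" "b * d + a * c = 1"
      using gaussian_factor by blast
    have "a + int q * b = a * ((int q)\<^sup>2 + 1) + int q * (b - int q * a)"
      by (simp add: power2_eq_square algebra_simps)
    then have "int m dvd a + int q * b"
      using *(2) \<open>int m dvd (int q)\<^sup>2 + 1\<close> by (metis dvd_add dvd_mult)
    then show ?thesis using that[of a b c d] * by (simp add: add.commute)
  qed
  define N where "N = {(\<one>\<^bsub>circle_group\<^esub>, \<one>\<^bsub>circle_group\<^esub>), (- \<one>\<^bsub>circle_group\<^esub>, - \<one>\<^bsub>circle_group\<^esub>)}"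
  note tw = quotient_hom_twisted[OF compact_circle_group has_minus_one(2) compact_circle_group has_minus_one(2), folded N_def]
  define p0 where "p0 = r_coset torus N \<circ> gauss_mult a b"
  have q0: "quotient_hom torus (circle_group \<times>\<^sub>~ circle_group) p0"
    unfolding p0_def by (rule quotient_hom_compose[OF quotient_hom_gauss_mult tw(1)]) (use ab(1) m in simp)
  have qt: "quarter_turn x \<in> carrier torus" if "x \<in> carrier torus" for x
    using that by (auto simp: quarter_turn_def)
  have qh: "quotient_hom ?K (semidirect_cyclic (circle_group \<times>\<^sub>~ circle_group) 4 (\<lambda>A. (\<lambda>(z, w). (w, cnj z)) ` A))
      (\<lambda>(x, n). (p0 x, n))"
  proof (rule quotient_hom_semidirect[OF q0])
    fix x assume x: "x \<in> carrier torus"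
    show "quarter_turn x \<in> carrier torus" using qt[OF x] .
    have g: "gauss_mult a b x \<in> carrier torus" using gauss_mult_closed[OF x] .
    have "p0 (quarter_turn x) = r_coset torus N (quarter_turn (gauss_mult a b x))"
      by (simp only: p0_def comp_apply gauss_mult_quarter_turn[OF x])
    also have "\<dots> = quarter_turn ` r_coset torus N (gauss_mult a b x)"
      unfolding tw(3)[OF g] tw(3)[OF qt[OF g]] by (auto simp: quarter_turn_def case_prod_beta)
    finally show "p0 (quarter_turn x) = (\<lambda>(z, w). (w, cnj z)) ` p0 x"
      by (simp add: p0_def quarter_turn_def)
  qed simp
  have "topgroup_iso (isom_group (lens_space m q))
      (semidirect_cyclic (circle_group \<times>\<^sub>~ circle_group) 4 (\<lambda>A. (\<lambda>(z, w). (w, cnj z)) ` A))"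
  proof (rule isom_group_iso[OF qh])
    fix k assume "k \<in> carrier ?K"
    then obtain u v n where k: "k = ((u, v), n)" "cmod u = 1" "cmod v = 1" "n \<in> {0, 1, 2, 3}"
      unfolding semidirect_cyclic_simps mem_Times_iff mem4 by (cases k) auto
    have g: "gauss_mult a b (u, v) \<in> carrier torus" by (rule gauss_mult_closed) (simp add: k)
    have g1: "gauss_mult a b (1, 1) = (1, 1)" by (simp add: gauss_mult_def)
    have "p0 (u, v) = p0 (1, 1) \<longleftrightarrow> gauss_mult a b (u, v) \<in> N"
      using tw(2)[OF g] by (simp add: p0_def g1)
    also have "\<dots> \<longleftrightarrow> (u * v) ^ m = 1 \<and> v * cnj u = (u * v) ^ q"
      unfolding gauss_kernel[OF k(2,3) ab] by (simp add: N_def)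
    finally show "(case k of (x, n) \<Rightarrow> (p0 x, n)) = (case \<one>\<^bsub>?K\<^esub> of (x, n) \<Rightarrow> (p0 x, n)) \<longleftrightarrow> deck_map m q (?act k)"
      unfolding k(1) deck[OF k(4,2,3)] by auto
  qed
  moreover have "isom_pi0 (lens_space m q) \<cong> integer_mod_group 4"
  proof (rule isom_pi0_iso[of snd])
    note label = semidirect_label[OF _ compact_torus path_connected_torus, where k = 4 and \<phi> = quarter_turn]
    show "snd \<in> hom ?K (integer_mod_group 4)" "snd ` carrier ?K = carrier (integer_mod_group 4)"
      "continuous_map (gtopology ?K) (discrete_topology (carrier (integer_mod_group 4))) snd"
      by (rule label; simp)+
    show "path_connectedin (gtopology ?K) {k \<in> carrier ?K. snd k = d}"
      if "d \<in> carrier (integer_mod_group 4)" for d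
      using that by (intro label) auto
    fix k assume k: "k \<in> carrier ?K" "deck_map m q (?act k)"
    obtain u v n where k': "k = ((u, v), n)" "cmod u = 1" "cmod v = 1" "n \<in> {0, 1, 2, 3}"
      using k(1) unfolding semidirect_cyclic_simps mem_Times_iff mem4 by (cases k) auto
    have "n = 0" using k(2) unfolding k'(1) deck[OF k'(4,2,3)] by blast
    then show "snd k = snd \<one>\<^bsub>?K\<^esub>" by (simp add: k')
  qed
  ultimately show ?thesis ..
qed

end

subsection \<open>The case \<open>q\<^sup>2 \<equiv> 1\<close>\<close>

text \<open>Two commuting copies of \<open>O(2)\<close> in \<open>O(4)\<close>; their circles are the scalars and the maps of complex determinant \<open>1\<close>
  in the diagonal torus.\<close>

definition dihedral_left :: "complex \<times> complex \<Rightarrow> complex \<times> complex \<Rightarrow> complex \<times> complex" where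
  "dihedral_left = (\<lambda>(s0, s1) (z, w). (s0 * z + s1 * cnj w, s0 * w + s1 * cnj z))"

definition dihedral_right :: "complex \<times> complex \<Rightarrow> complex \<times> complex \<Rightarrow> complex \<times> complex" where
  "dihedral_right = (\<lambda>(t0, t1) (z, w). (t0 * z + t1 * w, cnj t0 * w + cnj t1 * z))"

abbreviation dihedral_action ::
  "(complex \<times> complex) \<times> (complex \<times> complex) \<Rightarrow> complex \<times> complex \<Rightarrow> complex \<times> complex" where
  "dihedral_action \<equiv> \<lambda>(x, y). dihedral_left x \<circ> dihedral_right y"

abbreviation O2_squared :: "((complex \<times> complex) \<times> (complex \<times> complex)) topgroup" where
  "O2_squared \<equiv> topgroup_prod O2 O2"

text \<open>The pair \<open>(s, t)\<close> acts on the coordinate axes by the scalars \<open>s t\<close> and \<open>s t\<^sup>-\<^sup>1\<close>, which for a deck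
  transformation are \<open>x\<close> and \<open>x\<^sup>q\<close> with \<open>x\<^sup>m = 1\<close>. Then \<open>s\<^sup>2 = x\<^sup>q\<^sup>+\<^sup>1\<close> and \<open>t\<^sup>2 = x\<^sup>1\<^sup>-\<^sup>q\<close>, so the orders of \<open>s\<close> and \<open>t\<close>
  divide \<open>2m / gcd(m, q + 1)\<close> and \<open>2m / gcd(m, q - 1)\<close>.\<close>

lemma dihedral_kernel_relations:
  fixes s t :: complex
  assumes "cmod s = 1" "cmod t = 1" "q \<ge> 1"
  shows "s * cnj t = (s * t) ^ q \<longleftrightarrow> s ^ (q - 1) * t ^ (q + 1) = 1"
    and "s * cnj t = (s * t) ^ q \<Longrightarrow> s\<^sup>2 = (s * t) ^ (q + 1) \<and> t\<^sup>2 * (s * t) ^ (q - 1) = 1"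
proof -
  have st: "s * cnj s = 1" "t * cnj t = 1" using assms unit_mult_cnj by blast+
  have nz: "s \<noteq> 0" "t \<noteq> 0" using assms by auto
  have sq: "s ^ q = s * s ^ (q - 1)" "(s * t) ^ q = (s * t) * (s * t) ^ (q - 1)"
    using assms(3) by (simp_all add: power_eq_if)
  have t1: "t * (s * cnj t) = s"
  proof -
    have "t * (s * cnj t) = s * (t * cnj t)" by (simp only: mult_ac)
    then show ?thesis by (simp add: st)
  qed
  have "s * cnj t = (s * t) ^ q \<longleftrightarrow> t * (s * cnj t) = t * (s * t) ^ q" using nz by simp
  also have "\<dots> \<longleftrightarrow> s * 1 = s * (s ^ (q - 1) * t ^ (q + 1))"
    unfolding t1 power_mult_distrib sq(1) by (simp add: mult_ac)
  also have "\<dots> \<longleftrightarrow> s ^ (q - 1) * t ^ (q + 1) = 1"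
    using nz unfolding mult_cancel_left by auto
  finally show "s * cnj t = (s * t) ^ q \<longleftrightarrow> s ^ (q - 1) * t ^ (q + 1) = 1" .
  assume *: "s * cnj t = (s * t) ^ q"
  have "s\<^sup>2 = s * (t * (s * cnj t))" unfolding t1 by (simp add: power2_eq_square)
  also have "\<dots> = (s * t) ^ (q + 1)" unfolding * by (simp add: mult_ac)
  finally have 1: "s\<^sup>2 = (s * t) ^ (q + 1)" .
  have "s * (t\<^sup>2 * (s * t) ^ (q - 1)) = t * ((s * t) * (s * t) ^ (q - 1))"
    by (simp add: power2_eq_square mult_ac)
  also have "\<dots> = t * (s * cnj t)" unfolding * sq(2) ..
  also have "\<dots> = s * 1" unfolding t1 by simp
  finally have "t\<^sup>2 * (s * t) ^ (q - 1) = 1" using nz unfolding mult_cancel_left by auto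
  with 1 show "s\<^sup>2 = (s * t) ^ (q + 1) \<and> t\<^sup>2 * (s * t) ^ (q - 1) = 1" ..
qed

text \<open>Here \<open>m\<close> is even and \<open>2m / d1 = d2\<close>, so the bounds on the orders of \<open>s\<close> and \<open>t\<close> are the forward
  implication.\<close>

lemma dihedral_kernel_double:
  fixes s t :: complex
  assumes st: "cmod s = 1" "cmod t = 1" and q: "q \<ge> 1" and cop: "coprime m q"
  defines "d1 \<equiv> gcd m (q + 1)" and "d2 \<equiv> gcd m (q - 1)"
  assumes d: "d1 * d2 = 2 * m"
  shows "(s * t) ^ m = 1 \<and> s * cnj t = (s * t) ^ q \<longleftrightarrow> s ^ d2 = 1 \<and> t ^ d1 = 1"
proof
  have dm: "d1 dvd m" "d2 dvd m" and dq: "d1 dvd q + 1" "d2 dvd q - 1"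
    by (simp_all add: d1_def d2_def)
  obtain e1 where e1: "q + 1 = d1 * e1" using dq(1) by (auto simp: dvd_def)
  obtain e2 where e2: "q - 1 = d2 * e2" using dq(2) by (auto simp: dvd_def)
  {
    assume *: "s ^ d2 = 1 \<and> t ^ d1 = 1"
    obtain f1 where f1: "m = d1 * f1" using dm(1) by (rule dvdE)
    obtain f2 where f2: "m = d2 * f2" using dm(2) by (rule dvdE)
    have "s ^ m = 1" using * by (subst f2) (simp add: power_mult)
    moreover have "t ^ m = 1" using * by (subst f1) (simp add: power_mult)
    moreover have "s ^ (q - 1) = 1" "t ^ (q + 1) = 1"
      unfolding e1 e2 power_mult using * by simp_all
    ultimately show "(s * t) ^ m = 1 \<and> s * cnj t = (s * t) ^ q"
      unfolding dihedral_kernel_relations(1)[OF st q] by (simp add: power_mult_distrib)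
  next
    assume *: "(s * t) ^ m = 1 \<and> s * cnj t = (s * t) ^ q"
    have "even (d1 * d2)" using d by simp
    then have "even m" using dm by (auto dest: dvd_trans)
    then have "odd q" using cop by (metis coprime_common_divisor_nat coprime_def dvd_refl odd_one)
    then have "even (q + 1)" "even (q - 1)" by simp_all
    then have "even d1" "even d2" using \<open>even m\<close> by (simp_all add: d1_def d2_def)
    then obtain k1 k2 where k: "d1 = 2 * k1" "d2 = 2 * k2" by (auto elim!: evenE)
    have km: "d1 * k2 = m" "d2 * k1 = m" using d k by (simp_all add: ac_simps)
    note rel = dihedral_kernel_relations(2)[OF st q conjunct2[OF *]]
    have "s ^ d2 = (s\<^sup>2) ^ k2" by (simp add: k power_mult)
    also have "\<dots> = (s * t) ^ ((q + 1) * k2)" using rel by (simp only: power_mult)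
    also have "(q + 1) * k2 = m * e1" unfolding e1 using km(1) by (simp add: mult_ac)
    also have "(s * t) ^ \<dots> = 1" using * by (simp only: power_mult power_one)
    finally have "s ^ d2 = 1" .
    have "(s * t) ^ ((q - 1) * k1) = 1"
    proof -
      have "(q - 1) * k1 = m * e2" unfolding e2 using km(2) by (simp add: mult_ac)
      then show ?thesis using * by (simp only: power_mult power_one)
    qed
    then have "t ^ d1 = (t\<^sup>2) ^ k1 * ((s * t) ^ (q - 1)) ^ k1"
      by (simp add: k power_mult[symmetric])
    also have "\<dots> = (t\<^sup>2 * (s * t) ^ (q - 1)) ^ k1" by (simp only: power_mult_distrib)
    also have "\<dots> = 1" using rel by (simp only: power_one)
    finally have "t ^ d1 = 1" .
    with \<open>s ^ d2 = 1\<close> show "s ^ d2 = 1 \<and> t ^ d1 = 1" ..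
  }
qed

text \<open>Now \<open>2m / d1 = 2 d2\<close>, so the orders only determine \<open>s ^ d2\<close> and \<open>t ^ d1\<close> up to sign; the parities of
  the divisors and cofactors show that the two signs agree.\<close>

lemma dihedral_kernel_single:
  fixes s t :: complex
  assumes st: "cmod s = 1" "cmod t = 1" and q: "q \<ge> 1" and cop: "coprime m q" and m: "m > 0"
  defines "d1 \<equiv> gcd m (q + 1)" and "d2 \<equiv> gcd m (q - 1)"
  assumes d: "d1 * d2 = m"
  shows "(s * t) ^ m = 1 \<and> s * cnj t = (s * t) ^ q \<longleftrightarrow>
     (s ^ d2 = 1 \<and> t ^ d1 = 1) \<or> (s ^ d2 = -1 \<and> t ^ d1 = -1)"
proof -
  have dq: "d1 dvd q + 1" "d2 dvd q - 1"
    by (simp_all add: d1_def d2_def)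
  have d0: "d1 > 0" "d2 > 0" using m by (simp_all add: d1_def d2_def)
  obtain e1 where e1: "q + 1 = d1 * e1" using dq(1) by (auto simp: dvd_def)
  obtain e2 where e2: "q - 1 = d2 * e2" using dq(2) by (auto simp: dvd_def)
  have pq: "even (q - 1) = even (q + 1)" using q by simp
  \<comment> \<open>For even \<open>m\<close> both divisors are even, and the cofactors are odd because they are coprime to the
    complementary divisors \<open>m / d1 = d2\<close> and \<open>m / d2 = d1\<close>.\<close>
  have parity: "(even d1 \<and> even d2 \<and> odd e1 \<and> odd e2) \<or> (odd d1 \<and> odd d2 \<and> odd m \<and> even e1 = even e2)"
  proof (cases "even m")
    case True
    then have "odd q" using cop by (metis coprime_common_divisor_nat coprime_def dvd_refl odd_one)
    then have "even (q + 1)" "even (q - 1)" by simp_all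
    then have ev: "even d1" "even d2" using True by (simp_all add: d1_def d2_def)
    have "gcd (d1 * d2) (d1 * e1) = d1" unfolding d e1[symmetric] by (simp add: d1_def)
    then have "d1 * gcd d2 e1 = d1 * 1" by (simp add: gcd_mult_distrib_nat)
    then have "gcd d2 e1 = 1" using d0 by simp
    then have "odd e1" using ev by (metis gcd_greatest odd_one)
    have "gcd (d2 * d1) (d2 * e2) = d2" unfolding mult.commute[of d2 d1] d e2[symmetric] by (simp add: d2_def)
    then have "d2 * gcd d1 e2 = d2 * 1" by (simp add: gcd_mult_distrib_nat)
    then have "gcd d1 e2 = 1" using d0 by simp
    then have "odd e2" using ev by (metis gcd_greatest odd_one)
    with \<open>odd e1\<close> ev show ?thesis by blast
  next
    case False
    then have "odd d1" "odd d2" using d by auto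
    moreover have "even e1 = even e2"
      using pq \<open>odd d1\<close> \<open>odd d2\<close> unfolding e1 e2 by simp
    ultimately show ?thesis using False by blast
  qed
  show ?thesis
  proof
    assume "(s ^ d2 = 1 \<and> t ^ d1 = 1) \<or> (s ^ d2 = -1 \<and> t ^ d1 = -1)"
    then obtain \<epsilon> where \<epsilon>: "\<epsilon> = 1 \<or> \<epsilon> = -1" "s ^ d2 = \<epsilon>" "t ^ d1 = \<epsilon>" by blast
    have sm: "s ^ m = \<epsilon> ^ d1" unfolding \<epsilon>(2)[symmetric] power_mult[symmetric] by (simp add: d[symmetric] mult.commute)
    have tm: "t ^ m = \<epsilon> ^ d2" unfolding \<epsilon>(3)[symmetric] power_mult[symmetric] by (simp add: d[symmetric])
    have "even (d1 + d2)" "even (e2 + e1)" using parity by auto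
    then have "\<epsilon> ^ (d1 + d2) = 1" "\<epsilon> ^ (e2 + e1) = 1" using \<epsilon>(1) by auto
    moreover have "s ^ (q - 1) = \<epsilon> ^ e2" "t ^ (q + 1) = \<epsilon> ^ e1"
      unfolding e1 e2 power_mult \<epsilon> by simp_all
    ultimately show "(s * t) ^ m = 1 \<and> s * cnj t = (s * t) ^ q"
      unfolding dihedral_kernel_relations(1)[OF st q] by (simp add: power_mult_distrib sm tm power_add)
  next
    assume *: "(s * t) ^ m = 1 \<and> s * cnj t = (s * t) ^ q"
    note rel = dihedral_kernel_relations(2)[OF st q conjunct2[OF *]]
    from parity show "(s ^ d2 = 1 \<and> t ^ d1 = 1) \<or> (s ^ d2 = -1 \<and> t ^ d1 = -1)"
    proof
      assume p: "even d1 \<and> even d2 \<and> odd e1 \<and> odd e2"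
      then obtain k1 k2 where k: "d1 = 2 * k1" "d2 = 2 * k2" by (auto elim!: evenE)
      define h where "h = d1 * k2"
      have h: "d2 * k1 = h" "2 * h = m" using d k by (simp_all add: h_def)
      define y where "y = (s * t) ^ h"
      have "y\<^sup>2 = 1" using * h(2) by (simp add: y_def power_mult[symmetric] mult.commute)
      then have y: "y = 1 \<or> y = -1" by (simp add: power2_eq_1_iff)
      have "s ^ d2 = (s\<^sup>2) ^ k2" by (simp add: k power_mult)
      also have "\<dots> = (s * t) ^ ((q + 1) * k2)" using rel by (simp only: power_mult)
      also have "(q + 1) * k2 = h * e1" unfolding e1 h_def by (simp add: mult_ac)
      also have "(s * t) ^ \<dots> = y ^ e1" by (simp only: power_mult y_def)
      also have "\<dots> = y" using y p by auto
      finally have sy: "s ^ d2 = y" .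
      have "(s * t) ^ ((q - 1) * k1) = y"
      proof -
        have "(q - 1) * k1 = h * e2" unfolding e2 h(1)[symmetric] by (simp add: mult_ac)
        then have "(s * t) ^ ((q - 1) * k1) = y ^ e2" by (simp only: power_mult y_def)
        then show ?thesis using y p by auto
      qed
      then have "t ^ d1 * y = (t\<^sup>2) ^ k1 * ((s * t) ^ (q - 1)) ^ k1"
        by (simp add: k power_mult[symmetric])
      also have "\<dots> = (t\<^sup>2 * (s * t) ^ (q - 1)) ^ k1" by (simp only: power_mult_distrib)
      also have "\<dots> = 1" using rel by (simp only: power_one)
      finally have "t ^ d1 * y = 1" .
      then have "t ^ d1 = y" using y by (auto simp: minus_equation_iff[of _ 1] eq_commute[of "- 1"])
      with sy y show ?thesis by auto
    next
      assume p: "odd d1 \<and> odd d2 \<and> odd m \<and> even e1 = even e2"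
      have "(s ^ d2)\<^sup>2 = (s\<^sup>2) ^ d2" by (simp add: power_mult[symmetric] mult.commute)
      also have "\<dots> = (s * t) ^ ((q + 1) * d2)" using rel by (simp only: power_mult)
      also have "(q + 1) * d2 = m * e1" unfolding e1 d[symmetric] by (simp add: mult_ac)
      also have "(s * t) ^ \<dots> = 1" using * by (simp only: power_mult power_one)
      finally have s1: "s ^ d2 = 1 \<or> s ^ d2 = -1" by (simp add: power2_eq_1_iff)
      have x1: "((s * t) ^ (q - 1)) ^ d1 = 1"
      proof -
        have "(q - 1) * d1 = m * e2" unfolding e2 d[symmetric] by (simp add: mult_ac)
        then show ?thesis using * by (simp only: power_mult[symmetric]) (simp only: power_mult power_one)
      qed
      have "(t ^ d1)\<^sup>2 = (t\<^sup>2) ^ d1 * ((s * t) ^ (q - 1)) ^ d1"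
        unfolding x1 by (simp add: power_mult[symmetric] mult.commute)
      also have "\<dots> = (t\<^sup>2 * (s * t) ^ (q - 1)) ^ d1" by (simp only: power_mult_distrib)
      also have "\<dots> = 1" using rel by (simp only: power_one)
      finally have t1: "t ^ d1 = 1 \<or> t ^ d1 = -1" by (simp add: power2_eq_1_iff)
      have "s ^ m = (s ^ d2) ^ d1" "t ^ m = (t ^ d1) ^ d2"
        unfolding power_mult[symmetric] by (simp_all add: d[symmetric] mult.commute)
      then have "s ^ m = s ^ d2" "t ^ m = t ^ d1" using s1 t1 p by auto
      then have "s ^ d2 * t ^ d1 = 1" using * by (simp add: power_mult_distrib)
      then show ?thesis using s1 t1 by auto
    qed
  qed
qed

context lens_general
begin

lemma lens_action_dihedral:
  assumes sq: "[(int q)\<^sup>2 = 1] (mod int m)"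
  shows "lens_action m q O2_squared dihedral_action"
proof (rule lens_action_prod[OF compact_O2 compact_O2])
  let ?\<xi> = "lens_root m"
  have sq': "?\<xi> ^ (q * q) = ?\<xi>" using sq by (simp only: square_one)
  have notm1: "\<not> [(int q)\<^sup>2 = - 1] (mod int m)"
  proof
    assume "[(int q)\<^sup>2 = - 1] (mod int m)"
    then have "[1 = - 1] (mod int m)" using sq by (metis cong_sym cong_trans)
    then have "int m dvd 2" by (simp add: cong_iff_dvd_diff)
    then show False using q by (auto dest: zdvd_imp_le)
  qed
  show "dihedral_left (x \<otimes>\<^bsub>O2\<^esub> y) = dihedral_left x \<circ> dihedral_left y" for x y
    by (cases x; cases y) (simp add: fun_eq_iff dihedral_left_def algebra_simps)
  show "dihedral_right (x \<otimes>\<^bsub>O2\<^esub> y) = dihedral_right x \<circ> dihedral_right y" for x y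
    by (cases x; cases y) (simp add: fun_eq_iff dihedral_right_def algebra_simps)
  show "dihedral_right y \<circ> dihedral_left x = dihedral_left x \<circ> dihedral_right y" for x y
    by (cases x; cases y) (simp add: fun_eq_iff dihedral_left_def dihedral_right_def algebra_simps)
  show "orthogonal_transformation (dihedral_left x)" if "x \<in> carrier O2" for x
  proof (rule orthogonal_transformation_pairI)
    show "linear (dihedral_left x)"
      by (rule linearI) (cases x; auto simp: dihedral_left_def algebra_simps)+
    show "norm (dihedral_left x (z, w)) = norm (z, w)" for z w
      using that by (auto simp: dihedral_left_def norm_Pair norm_mult add.commute elim!: two_circles_cases)
  qed
  show "orthogonal_transformation (dihedral_right x)" if "x \<in> carrier O2" for x
  proof (rule orthogonal_transformation_pairI)
    show "linear (dihedral_right x)"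
      by (rule linearI) (cases x; auto simp: dihedral_right_def algebra_simps)+
    show "norm (dihedral_right x (z, w)) = norm (z, w)" for z w
      using that by (auto simp: dihedral_right_def norm_Pair norm_mult add.commute elim!: two_circles_cases)
  qed
  show "normalizes_deck m q (dihedral_left x)" if "x \<in> carrier O2" for x
  proof -
    have "x \<in> two_circles" using that by simp
    then show ?thesis
    proof (cases rule: two_circles_cases)
      case (fst s)
      have "dihedral_left x = diag_map (s, s)" by (simp add: fun_eq_iff fst dihedral_left_def)
      then show ?thesis using normalizes_diag by simp
    next
      case (snd s)
      have r1: "?\<xi> ^ (q * (m - 1)) = cnj ?\<xi> ^ q"
        using lens_root_inverse[of q] by simp
      have "?\<xi> ^ (q * (q * (m - 1))) = cnj (?\<xi> ^ (q * q))"
        using lens_root_inverse[of "q * q"] by (simp add: mult.assoc)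
      then have r2: "?\<xi> ^ (q * (q * (m - 1))) = cnj ?\<xi>" unfolding sq' .
      show ?thesis
        unfolding normalizes_deck_def
      proof (rule exI[of _ "q * (m - 1)"], rule allI)
        fix y :: "complex \<times> complex"
        obtain z w where y: "y = (z, w)" by (cases y)
        show "dihedral_left x (rot y) = (rot ^^ (q * (m - 1))) (dihedral_left x y)"
          unfolding y lens_rotation_eq dihedral_left_def snd prod.case lens_rotation_funpow r1 r2 by simp
      qed
    qed
  qed
  show "normalizes_deck m q (dihedral_right x)" if "x \<in> carrier O2" for x
  proof -
    have "x \<in> two_circles" using that by simp
    then show ?thesis
    proof (cases rule: two_circles_cases)
      case (fst s)
      have "dihedral_right x = diag_map (s, cnj s)" by (simp add: fun_eq_iff fst dihedral_right_def)
      then show ?thesis using normalizes_diag by simp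
    next
      case (snd s)
      show ?thesis
        unfolding normalizes_deck_def
      proof (rule exI[of _ q], rule allI)
        fix y :: "complex \<times> complex"
        obtain z w where y: "y = (z, w)" by (cases y)
        show "dihedral_right x (rot y) = (rot ^^ q) (dihedral_right x y)"
          unfolding y lens_rotation_eq dihedral_right_def snd prod.case lens_rotation_funpow sq' by simp
      qed
    qed
  qed
  show "continuous_map (prod_topology (gtopology O2) (gtopology O2)) euclidean
         (\<lambda>(x, y). dihedral_left x (dihedral_right y z))" for z
    unfolding O2_simps dihedral_left_def dihedral_right_def case_prod_beta
    by (intro continuous_map_Times_euclidean continuous_intros)
  fix T :: "complex \<times> complex \<Rightarrow> complex \<times> complex"
  assume T: "orthogonal_transformation T" "normalizes_deck m q T"
  obtain u v where uv: "cmod u = 1" "cmod v = 1"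
    "(\<forall>z w. T (z, w) = (u * z, v * w)) \<or> (\<forall>z w. T (z, w) = (u * cnj z, v * cnj w)) \<or>
     (\<forall>z w. T (z, w) = (u * w, v * z)) \<or> (\<forall>z w. T (z, w) = (u * cnj w, v * cnj z))"
    by (rule normalizer_monomial[OF T]) (use notm1 in blast)
  obtain s where s: "cmod s = 1" "s\<^sup>2 = u * v"
    using circle_root[of "u * v" 2] uv by (auto simp: norm_mult)
  have uu: "u * cnj u = 1" and ss: "s * cnj s = 1" using uv s by (simp_all add: unit_mult_cnj)
  define t where "t = u * cnj s"
  have t: "cmod t = 1" by (simp add: t_def norm_mult uv s)
  have e1: "s * t = u"
  proof -
    have "s * t = u * (s * cnj s)" unfolding t_def by (simp only: mult_ac)
    then show ?thesis by (simp add: ss)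
  qed
  have e2: "s * cnj t = v"
  proof -
    have "s * cnj t = cnj u * s\<^sup>2" by (simp add: t_def power2_eq_square mult_ac)
    also have "\<dots> = v * (u * cnj u)" unfolding s(2) by (simp only: mult_ac)
    finally show ?thesis by (simp add: uu)
  qed
  have L: "dihedral_left (s, 0) (z, w) = (s * z, s * w)" "dihedral_left (0, s) (z, w) = (s * cnj w, s * cnj z)"
    and R: "dihedral_right (t, 0) (z, w) = (t * z, cnj t * w)" "dihedral_right (0, t) (z, w) = (t * w, cnj t * z)"
    for z w by (simp_all add: dihedral_left_def dihedral_right_def)
  have a: "s * (t * z) = u * z" "s * (cnj t * z) = v * z" for z
    by (simp_all only: mult.assoc[symmetric] e1 e2)
  have "(\<forall>z w. T (z, w) = dihedral_left (s, 0) (dihedral_right (t, 0) (z, w))) \<or>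
     (\<forall>z w. T (z, w) = dihedral_left (0, s) (dihedral_right (0, t) (z, w))) \<or>
     (\<forall>z w. T (z, w) = dihedral_left (s, 0) (dihedral_right (0, t) (z, w))) \<or>
     (\<forall>z w. T (z, w) = dihedral_left (0, s) (dihedral_right (t, 0) (z, w)))"
    using uv(3) by (simp add: L R a)
  then have "\<exists>x \<in> {(s, 0), (0, s)}. \<exists>y \<in> {(t, 0), (0, t)}. \<forall>z w. T (z, w) = dihedral_left x (dihedral_right y (z, w))"
    by blast
  then obtain x y where xy: "x \<in> {(s, 0), (0, s)}" "y \<in> {(t, 0), (0, t)}"
      "\<forall>z w. T (z, w) = dihedral_left x (dihedral_right y (z, w))" by blast
  have "T = dihedral_left x \<circ> dihedral_right y"
    using xy(3) by (simp add: fun_eq_iff)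
  moreover have "x \<in> carrier O2" "y \<in> carrier O2" using xy(1,2) s t by auto
  ultimately show "\<exists>x \<in> carrier O2. \<exists>y \<in> carrier O2. T = dihedral_left x \<circ> dihedral_right y" by blast
qed

lemma deck_dihedral:
  assumes "x \<in> two_circles" "y \<in> two_circles"
  shows "deck_map m q (dihedral_action (x, y)) \<longleftrightarrow> snd x = 0 \<and> snd y = 0 \<and>
    (fst x * fst y) ^ m = 1 \<and> fst x * cnj (fst y) = (fst x * fst y) ^ q"
  using assms(1)
proof (cases rule: two_circles_cases)
  case (fst s)
  show ?thesis using assms(2)
  proof (cases rule: two_circles_cases)
    case fst': (fst t)
    have "dihedral_action (x, y) (z, w) = diag_map (s * t, s * cnj t) (z, w)" for z w
      by (simp add: fst fst' dihedral_left_def dihedral_right_def)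
    then have "deck_map m q (dihedral_action (x, y)) \<longleftrightarrow> (s * t) ^ m = 1 \<and> s * cnj t = (s * t) ^ q"
      unfolding deck_map_iff deck_diag_iff[symmetric] by simp
    then show ?thesis by (simp add: fst fst')
  next
    case (snd t)
    have "snd (dihedral_action (x, y) (1, 0)) = s * cnj t"
      by (simp add: fst snd dihedral_left_def dihedral_right_def)
    then show ?thesis using deck_map_axis(1)[of "dihedral_action (x, y)" 1] fst snd by auto
  qed
next
  case (snd s)
  show ?thesis using assms(2)
  proof (cases rule: two_circles_cases)
    case (fst t)
    have "snd (dihedral_action (x, y) (1, 0)) = s * cnj t"
      by (simp add: fst snd dihedral_left_def dihedral_right_def)
    then show ?thesis using deck_map_axis(1)[of "dihedral_action (x, y)" 1] fst snd by auto
  next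
    case snd': (snd t)
    have "fst (dihedral_action (x, y) (z, 0)) = s * t * cnj z" for z
      by (simp add: snd snd' dihedral_left_def dihedral_right_def)
    then have F: "fst (dihedral_action (x, y) (1, 0)) = s * t" "fst (dihedral_action (x, y) (\<i>, 0)) = - (\<i> * (s * t))"
      by (simp_all only:) simp_all
    have "\<not> deck_map m q (dihedral_action (x, y))"
    proof
      assume "deck_map m q (dihedral_action (x, y))"
      from deck_map_axis(2,3)[OF this] have "- (\<i> * (s * t)) = \<i> * (s * t)" "s * t \<noteq> 0"
        unfolding F .
      then show False by simp
    qed
    moreover have "s \<noteq> 0" using snd by auto
    ultimately show ?thesis using snd by simp
  qed
qed

lemma isom_pi0_dihedral:
  assumes sq: "[(int q)\<^sup>2 = 1] (mod int m)"
  shows "isom_pi0 (lens_space m q) \<cong> integer_mod_group 2 \<times>\<times> integer_mod_group 2"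
proof -
  interpret lens_action m q O2_squared dihedral_action
    using sq by (rule lens_action_dihedral)
  let ?D = "integer_mod_group 2"
  define c where "c = (\<lambda>(x, y). (circle_label x, circle_label y))"
  show ?thesis
  proof (rule isom_pi0_iso[of c])
    show "c \<in> hom O2_squared (?D \<times>\<times> ?D)"
      using circle_label(1) by (auto simp: c_def hom_def)
    show "c ` carrier O2_squared = carrier (?D \<times>\<times> ?D)"
    proof -
      have "c ` (two_circles \<times> two_circles) = circle_label ` two_circles \<times> circle_label ` two_circles"
        by (auto simp: c_def)
      then show ?thesis by (simp add: circle_label(3))
    qed
    show "continuous_map (gtopology O2_squared) (discrete_topology (carrier (?D \<times>\<times> ?D))) c"
      using circle_label(4) by (simp add: c_def prod_topology_discrete_topology continuous_map_prod_top
          del: prod_topology_subtopology_eu)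
    fix d assume d: "d \<in> carrier (?D \<times>\<times> ?D)"
    obtain d1 d2 where d12: "d = (d1, d2)" "d1 \<in> carrier ?D" "d2 \<in> carrier ?D" using d by auto
    have "{k \<in> carrier O2_squared. c k = d} =
        {x \<in> two_circles. circle_label x = d1} \<times> {x \<in> two_circles. circle_label x = d2}"
      by (auto simp: c_def d12)
    moreover have "path_connectedin (top_of_set two_circles) {x \<in> two_circles. circle_label x = e}"
      if "e \<in> carrier ?D" for e
      using circle_label(5)[OF that] by (auto simp: path_connectedin_subtopology)
    ultimately show "path_connectedin (gtopology O2_squared) {k \<in> carrier O2_squared. c k = d}"
      using d12 by (simp only: topgroup_prod_simps O2_simps path_connectedin_Times) simp
  next
    fix k assume k: "k \<in> carrier O2_squared" "deck_map m q (dihedral_action k)"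
    obtain x y where xy: "k = (x, y)" by (cases k)
    have "x \<in> two_circles" "y \<in> two_circles" using k(1) by (simp_all add: xy)
    from deck_dihedral[OF this] k(2) have "snd x = 0" "snd y = 0" unfolding xy by blast+
    then show "c k = c \<one>\<^bsub>O2_squared\<^esub>" by (simp add: c_def xy circle_label_def)
  qed
qed

lemma quotient_hom_dihedral_powers:
  assumes "a > 0" "b > 0"
  shows "quotient_hom O2_squared O2_squared (\<lambda>(x, y). (pair_power a x, pair_power b y))"
  by (rule quotient_hom_prod[OF compact_O2 compact_O2])
    (use assms in \<open>auto intro!: quotient_hom_pair_power compact_O2 pair_power_hom Hausdorff_space_subtopology\<close>)

lemma isom_dihedral_double:
  assumes sq: "[(int q)\<^sup>2 = 1] (mod int m)" and d: "gcd m (q + 1) * gcd m (q - 1) = 2 * m"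
  shows "topgroup_iso (isom_group (lens_space m q)) (topgroup_prod O2 O2)"
proof -
  interpret lens_action m q O2_squared dihedral_action
    using sq by (rule lens_action_dihedral)
  define d1 d2 where "d1 = gcd m (q + 1)" and "d2 = gcd m (q - 1)"
  have d0: "d1 > 0" "d2 > 0" using m by (simp_all add: d1_def d2_def)
  show ?thesis
  proof (rule isom_group_iso[OF quotient_hom_dihedral_powers[OF d0(2,1)]])
    fix k assume "k \<in> carrier O2_squared"
    then obtain x y where k: "k = (x, y)" "x \<in> two_circles" "y \<in> two_circles" by (cases k) simp
    have "pair_power d2 x = (1, 0) \<and> pair_power d1 y = (1, 0) \<longleftrightarrow>
        snd x = 0 \<and> snd y = 0 \<and> fst x ^ d2 = 1 \<and> fst y ^ d1 = 1"
      using d0 by (auto simp: pair_power_def)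
    also have "\<dots> \<longleftrightarrow> deck_map m q (dihedral_action (x, y))"
      unfolding deck_dihedral[OF k(2,3)] using k(2,3) dihedral_kernel_double[OF _ _ _ coprime, of "fst x" "fst y"] q d
      by (auto simp: d1_def d2_def elim!: two_circles_cases)
    finally show "(case k of (x, y) \<Rightarrow> (pair_power d2 x, pair_power d1 y)) =
        (case \<one>\<^bsub>O2_squared\<^esub> of (x, y) \<Rightarrow> (pair_power d2 x, pair_power d1 y)) \<longleftrightarrow> deck_map m q (dihedral_action k)"
      using d0 by (simp add: k(1)) (simp add: pair_power_def zero_power)
  qed
qed

lemma isom_dihedral_single:
  assumes sq: "[(int q)\<^sup>2 = 1] (mod int m)" and d: "gcd m (q + 1) * gcd m (q - 1) = m"
  shows "topgroup_iso (isom_group (lens_space m q)) (O2 \<times>\<^sub>~ O2)"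
proof -
  interpret lens_action m q O2_squared dihedral_action
    using sq by (rule lens_action_dihedral)
  define d1 d2 where "d1 = gcd m (q + 1)" and "d2 = gcd m (q - 1)"
  have d0: "d1 > 0" "d2 > 0" using m by (simp_all add: d1_def d2_def)
  have m0: "m > 0" using m by simp
  define N where "N = {(\<one>\<^bsub>O2\<^esub>, \<one>\<^bsub>O2\<^esub>), (- \<one>\<^bsub>O2\<^esub>, - \<one>\<^bsub>O2\<^esub>)}"
  note tw = quotient_hom_twisted[OF compact_O2 has_minus_one(4) compact_O2 has_minus_one(4), folded N_def]
  let ?p = "\<lambda>(x, y). (pair_power d2 x, pair_power d1 y)"
  show ?thesis
  proof (rule isom_group_iso[OF quotient_hom_compose[OF quotient_hom_dihedral_powers[OF d0(2,1)] tw(1)]])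
    fix k assume "k \<in> carrier O2_squared"
    then obtain x y where k: "k = (x, y)" "x \<in> two_circles" "y \<in> two_circles" by (cases k) simp
    have pk: "(pair_power d2 x, pair_power d1 y) \<in> carrier O2_squared"
      using k(2,3) pair_power_surj[OF d0(1)] pair_power_surj[OF d0(2)] by auto
    have one: "pair_power d2 (1, 0) = (1, 0)" "pair_power d1 (1, 0) = (1, 0)"
      using d0 by (simp_all add: pair_power_def)
    have "(r_coset O2_squared N \<circ> ?p) k = (r_coset O2_squared N \<circ> ?p) \<one>\<^bsub>O2_squared\<^esub> \<longleftrightarrow>
        (pair_power d2 x, pair_power d1 y) \<in> N"
      using tw(2)[OF pk] by (simp add: k(1) one)
    also have "\<dots> \<longleftrightarrow> snd x = 0 \<and> snd y = 0 \<and>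
        ((fst x ^ d2 = 1 \<and> fst y ^ d1 = 1) \<or> (fst x ^ d2 = -1 \<and> fst y ^ d1 = -1))"
      using d0 by (auto simp: N_def pair_power_def)
    also have "\<dots> \<longleftrightarrow> deck_map m q (dihedral_action (x, y))"
      unfolding deck_dihedral[OF k(2,3)] using k(2,3) dihedral_kernel_single[OF _ _ _ coprime m0, of "fst x" "fst y"] q d
      by (auto simp: d1_def d2_def elim!: two_circles_cases)
    finally show "(r_coset O2_squared N \<circ> ?p) k = (r_coset O2_squared N \<circ> ?p) \<one>\<^bsub>O2_squared\<^esub> \<longleftrightarrow>
        deck_map m q (dihedral_action k)"
      unfolding k(1) .
  qed
qed

end

section \<open>The isometry groups of lens spaces\<close>

theorem mainTheorem2:
  fixes m q :: nat
  assumes "m \<ge> 1"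
    and "m = 1 \<Longrightarrow> q = 0"
    and "m = 2 \<Longrightarrow> q = 1"
    and "m > 2 \<Longrightarrow> 1 \<le> q \<and> real q < real m / 2 \<and> gcd m q = 1"
  shows
    "(m = 1 \<longrightarrow>
        topgroup_iso (isom_group (lens_space m q)) (orthogonal_group :: (real^4^4) topgroup) \<and>
        isom_pi0 (lens_space m q) \<cong> integer_mod_group 2) \<and>
     (m = 2 \<longrightarrow>
        topgroup_iso (isom_group (lens_space m q))
          (semidirect_cyclic
             (topgroup_prod (special_orthogonal_group :: (real^3^3) topgroup)
                            (special_orthogonal_group :: (real^3^3) topgroup))
             2 (\<lambda>(A, B). (B, A))) \<and>
        isom_pi0 (lens_space m q) \<cong> integer_mod_group 2) \<and>
     (m > 2 \<and> odd m \<and> q = 1 \<longrightarrow>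
        topgroup_iso (isom_group (lens_space m q)) (O2_star \<times>\<^sub>~ S3_group) \<and>
        isom_pi0 (lens_space m q) \<cong> integer_mod_group 2) \<and>
     (m > 2 \<and> even m \<and> q = 1 \<longrightarrow>
        topgroup_iso (isom_group (lens_space m q))
          (topgroup_prod O2 (special_orthogonal_group :: (real^3^3) topgroup)) \<and>
        isom_pi0 (lens_space m q) \<cong> integer_mod_group 2) \<and>
     (m > 2 \<and> 1 < q \<and> \<not> [(int q)\<^sup>2 = 1] (mod int m) \<and> \<not> [(int q)\<^sup>2 = - 1] (mod int m) \<longrightarrow>
        topgroup_iso (isom_group (lens_space m q)) Dih_torus \<and>
        isom_pi0 (lens_space m q) \<cong> integer_mod_group 2) \<and>
     (m > 2 \<and> 1 < q \<and> [(int q)\<^sup>2 = - 1] (mod int m) \<longrightarrow>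
        topgroup_iso (isom_group (lens_space m q))
          (semidirect_cyclic (circle_group \<times>\<^sub>~ circle_group) 4
             (\<lambda>A. (\<lambda>(z, w). (w, cnj z)) ` A)) \<and>
        isom_pi0 (lens_space m q) \<cong> integer_mod_group 4) \<and>
     (m > 2 \<and> 1 < q \<and> [(int q)\<^sup>2 = 1] (mod int m) \<and> gcd m (q + 1) * gcd m (q - 1) = m \<longrightarrow>
        topgroup_iso (isom_group (lens_space m q)) (O2 \<times>\<^sub>~ O2) \<and>
        isom_pi0 (lens_space m q) \<cong> integer_mod_group 2 \<times>\<times> integer_mod_group 2) \<and>
     (m > 2 \<and> 1 < q \<and> [(int q)\<^sup>2 = 1] (mod int m) \<and> gcd m (q + 1) * gcd m (q - 1) = 2 * m \<longrightarrow>
        topgroup_iso (isom_group (lens_space m q)) (topgroup_prod O2 O2) \<and>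
        isom_pi0 (lens_space m q) \<cong> integer_mod_group 2 \<times>\<times> integer_mod_group 2)"
  proof -
  have cop: "coprime m q"
  proof (cases "m > 2")
    case True
    then show ?thesis using assms(4) by (simp add: coprime_iff_gcd_eq_1)
  next
    case False
    then have "m = 1 \<or> m = 2" using assms(1) by linarith
    then show ?thesis using assms(2,3) by auto
  qed
  have one: "lens_one m" if "m > 2" using that by unfold_locales auto
  have general: "lens_general m q" if "m > 2" "1 < q"
    using that assms(1,4) cop by unfold_locales auto
  show ?thesis
  proof (intro conjI impI; (elim conjE)?)
    assume "m = 1"
    with assms(2) show "topgroup_iso (isom_group (lens_space m q)) (orthogonal_group :: (real^4^4) topgroup)"
        "isom_pi0 (lens_space m q) \<cong> integer_mod_group 2"
      using lens_sphere by simp_all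
  next
    assume "m = 2"
    with assms(3) show "topgroup_iso (isom_group (lens_space m q))
          (semidirect_cyclic
             (topgroup_prod (special_orthogonal_group :: (real^3^3) topgroup)
                            (special_orthogonal_group :: (real^3^3) topgroup))
             2 (\<lambda>(A, B). (B, A)))"
        "isom_pi0 (lens_space m q) \<cong> integer_mod_group 2"
      using lens_projective_space by simp_all
  next
    assume "m > 2" "odd m" and q: "q = 1"
    then interpret lens_one m by (intro one)
    show "topgroup_iso (isom_group (lens_space m q)) (O2_star \<times>\<^sub>~ S3_group)"
        "isom_pi0 (lens_space m q) \<cong> integer_mod_group 2"
      unfolding q by (rule isom_group_odd[OF \<open>odd m\<close>], rule isom_pi0_two_sided)
  next
    assume "m > 2" "even m" and q: "q = 1"
    then interpret lens_one m by (intro one)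
    show "topgroup_iso (isom_group (lens_space m q))
          (topgroup_prod O2 (special_orthogonal_group :: (real^3^3) topgroup))"
        "isom_pi0 (lens_space m q) \<cong> integer_mod_group 2"
      unfolding q by (rule isom_group_even[OF \<open>even m\<close>], rule isom_pi0_two_sided)
  next
    assume "m > 2" "1 < q" and sq: "\<not> [(int q)\<^sup>2 = 1] (mod int m)" "\<not> [(int q)\<^sup>2 = - 1] (mod int m)"
    then interpret lens_general m q by (intro general)
    show "topgroup_iso (isom_group (lens_space m q)) Dih_torus"
        "isom_pi0 (lens_space m q) \<cong> integer_mod_group 2"
      using isom_generic[OF sq] by (rule conjunct1, rule conjunct2)
  next
    assume "m > 2" "1 < q" and sq: "[(int q)\<^sup>2 = - 1] (mod int m)"
    then interpret lens_general m q by (intro general)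
    show "topgroup_iso (isom_group (lens_space m q))
          (semidirect_cyclic (circle_group \<times>\<^sub>~ circle_group) 4
             (\<lambda>A. (\<lambda>(z, w). (w, cnj z)) ` A))"
        "isom_pi0 (lens_space m q) \<cong> integer_mod_group 4"
      using isom_quarter_turn[OF sq] by (rule conjunct1, rule conjunct2)
  next
    assume "m > 2" "1 < q" and sq: "[(int q)\<^sup>2 = 1] (mod int m)"
      and d: "gcd m (q + 1) * gcd m (q - 1) = m"
    then interpret lens_general m q by (intro general)
    show "topgroup_iso (isom_group (lens_space m q)) (O2 \<times>\<^sub>~ O2)"
        "isom_pi0 (lens_space m q) \<cong> integer_mod_group 2 \<times>\<times> integer_mod_group 2"
      by (rule isom_dihedral_single[OF sq d], rule isom_pi0_dihedral[OF sq])
  next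
    assume "m > 2" "1 < q" and sq: "[(int q)\<^sup>2 = 1] (mod int m)"
      and d: "gcd m (q + 1) * gcd m (q - 1) = 2 * m"
    then interpret lens_general m q by (intro general)
    show "topgroup_iso (isom_group (lens_space m q)) (topgroup_prod O2 O2)"
        "isom_pi0 (lens_space m q) \<cong> integer_mod_group 2 \<times>\<times> integer_mod_group 2"
      by (rule isom_dihedral_double[OF sq d], rule isom_pi0_dihedral[OF sq])
  qed
qed

end
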